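(* Let $b\in L^2(0,1;\mathbb{R})$ and put $b_n=\int_0^1b(x)\sin(n\pi x)\,\mathrm{d}x$ for $n\ge1$. Let $X=H_0^1(0,1)\times L^2(0,1)$ and $U=\mathbb{C}$, let $A$ be the operator on $X$ defined by $A(u,v)=(v,u'')$ with domain $D(A)=(H^2(0,1)\cap H_0^1(0,1))\times H_0^1(0,1)$, and let $B\colon U\to X$ be the bounded linear operator $Bz=(0,b(\cdot)z)$, $z\in\mathbb{C}$. Suppose that there exist $\beta>0$ and $c_0>0$ such that $|b_n|\ge c_0n^{-\beta}$ for all $n\ge1$. Suppose further that $\phi\colon U\to U$ is monotone and locally Lipschitz continuous, and that there exist $\delta>0$ and $c>0$ such that $$\operatorname{Re}\langle\phi(u),u\rangle\ge c|u|^2 \ \text{ if } |u|\le\delta,\qquad \operatorname{Re}\langle\phi(u),u\rangle\ge c\ \text{ if } |u|>\delta .$$ Then all mild solutions of $$\dot x(t)=Ax(t)-B\phi(B^*x(t)),\qquad t\ge0,$$ satisfy $\|x(t)\|\to0$ as $t\to\infty$, and all classical solutions of this equation satisfy $\|x(t)\|=O(t^{-1/(2\beta)})$ as $t\to\infty$.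
   Context: All function spaces are complex-valued unless indicated. $X$ carries the inner product $\langle(u_1,v_1),(u_2,v_2)\rangle=\int_0^1u_1'\overline{u_2'}\,\mathrm{d}x+\int_0^1v_1\overline{v_2}\,\mathrm{d}x$, so that $A$ is skew-adjoint and generates a contraction semigroup $(T(t))_{t\ge0}$ on $X$, and $B^*(u,v)=\int_0^1b(s)v(s)\,\mathrm{d}s$. On $U=\mathbb{C}$, $\langle z,w\rangle=z\overline{w}$. The map $\phi$ is monotone if $\operatorname{Re}\langle\phi(u_1)-\phi(u_2),u_1-u_2\rangle\ge0$ for all $u_1,u_2\in U$. With $x(t)=(u(\cdot,t),u_t(\cdot,t))$, the equation is the abstract formulation of a one-dimensional wave equation on $(0,1)$ with Dirichlet boundary conditions and weak non-linear damping. A classical solution of $\dot x(t)=Ax(t)-B\phi(B^*x(t))$, $t\ge 0$, is a function $x(\cdot)\in C^1([0,\infty);X)$ such that $x(t)\in D(A)$ for all $t\ge0$ and the equation holds for all $t\ge0$. A mild solution is a function $x(\cdot)\in C([0,\infty);X)$ such that, with $x_0=x(0)\in X$, $x(t)=T(t)x_0-\int_0^tT(t-s)B\phi(B^*x(s))\,\mathrm{d}s$ for all $t\ge0$. The $O$-constants may depend on the individual solution. *)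

theory Defs
  imports "HOL-Analysis.Analysis"
begin

abbreviation unit_interval :: "real measure" where
  "unit_interval \<equiv> lebesgue_on {0<..<1}"

definition square_integrable :: "(real \<Rightarrow> 'a::real_normed_vector) \<Rightarrow> bool" where
  "square_integrable f \<longleftrightarrow>
     f \<in> borel_measurable unit_interval \<and> integrable unit_interval (\<lambda>x. (norm (f x))\<^sup>2)"

lemma square_integrable_mult:
  fixes f g :: "real \<Rightarrow> complex"
  assumes "square_integrable f" "square_integrable g"
  shows "integrable unit_interval (\<lambda>x. f x * g x)"
proof (rule Bochner_Integration.integrable_bound)
  show "integrable unit_interval (\<lambda>x. (norm (f x))\<^sup>2 + (norm (g x))\<^sup>2)"
    using assms by (auto simp: square_integrable_def)
  show "(\<lambda>x. f x * g x) \<in> borel_measurable unit_interval"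
    using assms by (auto simp: square_integrable_def)
  have "norm (f x * g x) \<le> (norm (f x))\<^sup>2 + (norm (g x))\<^sup>2" for x
    using sum_squares_bound[of "norm (f x)" "norm (g x)"]
      mult_nonneg_nonneg[OF norm_ge_zero[of "f x"] norm_ge_zero[of "g x"]]
    unfolding norm_mult by linarith
  then show "AE x in unit_interval. norm (f x * g x) \<le> norm ((norm (f x))\<^sup>2 + (norm (g x))\<^sup>2)"
    by (simp add: abs_of_nonneg)
qed

lemma square_integrable_cnj:
  "square_integrable g \<Longrightarrow> square_integrable (\<lambda>x. cnj (g x))"
  by (auto simp: square_integrable_def
      intro: measurable_compose[OF _ borel_measurable_continuous_onI[OF continuous_on_cnj[OF continuous_on_id]]])

lemma square_integrable_add:
  fixes f g :: "real \<Rightarrow> complex"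
  assumes "square_integrable f" "square_integrable g"
  shows "square_integrable (\<lambda>x. f x + g x)"
  unfolding square_integrable_def
proof
  show m: "(\<lambda>x. f x + g x) \<in> borel_measurable unit_interval"
    using assms by (auto simp: square_integrable_def)
  show "integrable unit_interval (\<lambda>x. (norm (f x + g x))\<^sup>2)"
  proof (rule Bochner_Integration.integrable_bound)
    show "integrable unit_interval (\<lambda>x. 2 * (norm (f x))\<^sup>2 + 2 * (norm (g x))\<^sup>2)"
      using assms by (auto simp: square_integrable_def)
    show "(\<lambda>x. (norm (f x + g x))\<^sup>2) \<in> borel_measurable unit_interval"
      using m by auto
    have "(norm (f x + g x))\<^sup>2 \<le> 2 * (norm (f x))\<^sup>2 + 2 * (norm (g x))\<^sup>2" for x
    proof -
      have "(norm (f x + g x))\<^sup>2 \<le> (norm (f x) + norm (g x))\<^sup>2"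
        by (simp add: norm_triangle_ineq power_mono)
      also have "\<dots> \<le> 2 * (norm (f x))\<^sup>2 + 2 * (norm (g x))\<^sup>2"
        using sum_squares_bound[of "norm (f x)" "norm (g x)"] by (simp add: power2_sum)
      finally show ?thesis .
    qed
    then show "AE x in unit_interval. norm ((norm (f x + g x))\<^sup>2)
        \<le> norm (2 * (norm (f x))\<^sup>2 + 2 * (norm (g x))\<^sup>2)"
      by (simp add: abs_of_nonneg)
  qed
qed

lemma square_integrable_scaleR:
  fixes f :: "real \<Rightarrow> complex"
  shows "square_integrable f \<Longrightarrow> square_integrable (\<lambda>x. r *\<^sub>R f x)"
  by (auto simp: square_integrable_def power_mult_distrib)

lemma square_integrable_zero: "square_integrable (\<lambda>x. 0::complex)"
  by (simp add: square_integrable_def)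

lemma square_integrable_uminus:
  fixes f :: "real \<Rightarrow> complex"
  shows "square_integrable f \<Longrightarrow> square_integrable (\<lambda>x. - f x)"
  by (auto simp: square_integrable_def)

lemma square_integrable_diff:
  fixes f g :: "real \<Rightarrow> complex"
  assumes "square_integrable f" "square_integrable g"
  shows "square_integrable (\<lambda>x. f x - g x)"
  using square_integrable_add[OF assms(1) square_integrable_uminus[OF assms(2)]] by simp

definition l2_rel :: "(real \<Rightarrow> complex) \<Rightarrow> (real \<Rightarrow> complex) \<Rightarrow> bool" where
  "l2_rel f g \<longleftrightarrow>
     square_integrable f \<and> square_integrable g \<and> (AE x in unit_interval. f x = g x)"

quotient_type l2 = "real \<Rightarrow> complex" / partial: l2_rel
proof (rule part_equivpI)
  show "\<exists>f. l2_rel f f"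
    using square_integrable_zero by (auto simp: l2_rel_def)
  show "symp l2_rel"
    by (rule sympI) (auto simp: l2_rel_def)
  show "transp l2_rel"
    by (rule transpI) (auto simp: l2_rel_def)
qed

instantiation l2 :: real_vector
begin

lift_definition zero_l2 :: l2 is "\<lambda>_. 0"
  by (simp add: l2_rel_def square_integrable_zero)

lift_definition plus_l2 :: "l2 \<Rightarrow> l2 \<Rightarrow> l2" is "\<lambda>f g x. f x + g x"
  by (auto simp: l2_rel_def intro: square_integrable_add)

lift_definition uminus_l2 :: "l2 \<Rightarrow> l2" is "\<lambda>f x. - f x"
  by (auto simp: l2_rel_def intro: square_integrable_uminus)

lift_definition minus_l2 :: "l2 \<Rightarrow> l2 \<Rightarrow> l2" is "\<lambda>f g x. f x - g x"
  by (auto simp: l2_rel_def intro: square_integrable_diff)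

lift_definition scaleR_l2 :: "real \<Rightarrow> l2 \<Rightarrow> l2" is "\<lambda>r f x. r *\<^sub>R f x"
  by (auto simp: l2_rel_def intro: square_integrable_scaleR)

instance
proof
  fix a b c :: l2 and r s :: real
  show "a + b + c = a + (b + c)"
    by transfer (auto simp: l2_rel_def add.assoc intro!: square_integrable_add)
  show "a + b = b + a"
    by transfer (auto simp: l2_rel_def add.commute intro!: square_integrable_add)
  show "0 + a = a"
    by transfer (auto simp: l2_rel_def)
  show "- a + a = 0"
    by transfer (auto simp: l2_rel_def square_integrable_zero)
  show "a - b = a + - b"
    by transfer (auto simp: l2_rel_def intro!: square_integrable_diff)
  show "r *\<^sub>R (a + b) = r *\<^sub>R a + r *\<^sub>R b"
    by transfer (auto simp: l2_rel_def algebra_simps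
        intro!: square_integrable_add square_integrable_scaleR)
  show "(r + s) *\<^sub>R a = r *\<^sub>R a + s *\<^sub>R a"
    by transfer (auto simp: l2_rel_def algebra_simps
        intro!: square_integrable_add square_integrable_scaleR)
  show "r *\<^sub>R s *\<^sub>R a = (r * s) *\<^sub>R a"
    by transfer (auto simp: l2_rel_def intro!: square_integrable_scaleR)
  show "1 *\<^sub>R a = a"
    by transfer (auto simp: l2_rel_def)
qed

end

instantiation l2 :: real_inner
begin

(* The real inner product underlying the complex one, i.e. its real part: both induce the same norm. *)
lift_definition inner_l2 :: "l2 \<Rightarrow> l2 \<Rightarrow> real" is
  "\<lambda>f g. Re (LINT x|unit_interval. f x * cnj (g x))"
proof -
  fix f f' g g' assume "l2_rel f f'" "l2_rel g g'"
  then show "Re (LINT x|unit_interval. f x * cnj (g x)) = Re (LINT x|unit_interval. f' x * cnj (g' x))"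
    by (intro arg_cong[where f = Re] integral_cong_AE)
       (auto simp: l2_rel_def intro!: borel_measurable_integrable
         square_integrable_mult square_integrable_cnj)
qed

definition norm_l2 :: "l2 \<Rightarrow> real" where "norm_l2 u = sqrt (inner u u)"
definition sgn_l2 :: "l2 \<Rightarrow> l2" where "sgn_l2 u = u /\<^sub>R norm u"
definition dist_l2 :: "l2 \<Rightarrow> l2 \<Rightarrow> real" where "dist_l2 u v = norm (u - v)"
definition uniformity_l2 :: "(l2 \<times> l2) filter" where
  "uniformity_l2 = (INF e\<in>{0<..}. principal {(u, v). dist u v < e})"
definition open_l2 :: "l2 set \<Rightarrow> bool" where
  "open_l2 S \<longleftrightarrow> (\<forall>u\<in>S. eventually (\<lambda>(u', v). u' = u \<longrightarrow> v \<in> S) uniformity)"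

instance
proof
  fix a b c :: l2 and r :: real
  show "dist a b = norm (a - b)" by (rule dist_l2_def)
  show "sgn a = a /\<^sub>R norm a" by (rule sgn_l2_def)
  show "norm a = sqrt (inner a a)" by (rule norm_l2_def)
  show "inner a b = inner b a"
  proof transfer
    fix a b :: "real \<Rightarrow> complex"
    have "(LINT x|unit_interval. b x * cnj (a x)) = (LINT x|unit_interval. cnj (a x * cnj (b x)))"
      by (simp add: mult.commute)
    also have "\<dots> = cnj (LINT x|unit_interval. a x * cnj (b x))"
      by (rule Bochner_Integration.integral_cnj)
    finally show "Re (LINT x|unit_interval. a x * cnj (b x)) = Re (LINT x|unit_interval. b x * cnj (a x))"
      by simp
  qed
  show "inner (a + b) c = inner a c + inner b c"
  proof transfer
    fix a b c :: "real \<Rightarrow> complex"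
    assume "l2_rel a a" "l2_rel b b" "l2_rel c c"
    then show "Re (LINT x|unit_interval. (a x + b x) * cnj (c x)) =
      Re (LINT x|unit_interval. a x * cnj (c x)) + Re (LINT x|unit_interval. b x * cnj (c x))"
      by (simp add: l2_rel_def distrib_right square_integrable_mult square_integrable_cnj)
  qed
  show "inner (r *\<^sub>R a) b = r * inner a b"
    by transfer simp
  have sq: "(LINT x|unit_interval. f x * cnj (f x)) = of_real (LINT x|unit_interval. (norm (f x))\<^sup>2)"
    for f :: "real \<Rightarrow> complex"
    unfolding complex_norm_square[symmetric] by (rule integral_complex_of_real)
  show "0 \<le> inner a a"
    by transfer (simp add: sq)
  show "inner a a = 0 \<longleftrightarrow> a = 0"
  proof transfer
    fix a :: "real \<Rightarrow> complex" assume "l2_rel a a"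
    then show "(Re (LINT x|unit_interval. a x * cnj (a x)) = 0) = l2_rel a (\<lambda>_. 0)"
      by (auto simp: sq l2_rel_def square_integrable_zero square_integrable_def
          integral_nonneg_eq_0_iff_AE)
  qed
  show "uniformity = (INF e\<in>{0<..}. principal {(x, y::l2). dist x y < e})"
    by (rule uniformity_l2_def)
  show "open S \<longleftrightarrow> (\<forall>x\<in>S. \<forall>\<^sub>F (x', y) in uniformity. x' = x \<longrightarrow> y \<in> S)" for S :: "l2 set"
    by (rule open_l2_def)
qed

end

lift_definition l2_pairing :: "l2 \<Rightarrow> l2 \<Rightarrow> complex" is
  "\<lambda>f g. LINT x|unit_interval. f x * g x"
proof -
  fix f f' g g' assume "l2_rel f f'" "l2_rel g g'"
  then show "(LINT x|unit_interval. f x * g x) = (LINT x|unit_interval. f' x * g' x)"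
    by (intro integral_cong_AE)
       (auto simp: l2_rel_def intro!: borel_measurable_integrable square_integrable_mult)
qed

(* As usual in one dimension, continuously differentiable functions with compact support serve as
   test functions; smooth ones give the same weak derivatives and the same closure. *)
definition test_function :: "(real \<Rightarrow> complex) \<Rightarrow> bool" where
  "test_function \<psi> \<longleftrightarrow> \<psi> C1_differentiable_on UNIV \<and>
     (\<exists>K. compact K \<and> K \<subseteq> {0<..<1} \<and> (\<forall>x. x \<notin> K \<longrightarrow> \<psi> x = 0))"

definition has_weak_derivative :: "l2 \<Rightarrow> l2 \<Rightarrow> bool" where
  "has_weak_derivative u g \<longleftrightarrow> (\<forall>\<psi>. test_function \<psi> \<longrightarrow>
     l2_pairing u (abs_l2 (\<lambda>x. vector_derivative \<psi> (at x))) = - l2_pairing g (abs_l2 \<psi>))"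

definition weak_derivative :: "l2 \<Rightarrow> l2" where
  "weak_derivative u = (THE g. has_weak_derivative u g)"

definition H1 :: "l2 set" where
  "H1 = {u. \<exists>g. has_weak_derivative u g}"

definition H1_norm :: "l2 \<Rightarrow> real" where
  "H1_norm u = sqrt ((norm u)\<^sup>2 + (norm (weak_derivative u))\<^sup>2)"

definition H2 :: "l2 set" where
  "H2 = {u \<in> H1. weak_derivative u \<in> H1}"

definition H1_0 :: "l2 set" where
  "H1_0 = {u \<in> H1. \<forall>e>0. \<exists>\<psi>. test_function \<psi> \<and> H1_norm (u - abs_l2 \<psi>) < e}"

lemma square_integrable_continuous:
  fixes f :: "real \<Rightarrow> complex"
  assumes "continuous_on UNIV f"
  shows "square_integrable f"
  unfolding square_integrable_def
proof
  show m: "f \<in> borel_measurable unit_interval"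
    using assms by (intro continuous_imp_measurable_on_sets_lebesgue) (auto intro: continuous_on_subset)
  have "compact (f ` {0..1})"
    by (intro compact_continuous_image continuous_on_subset[OF assms]) auto
  then obtain M where M: "\<And>x. x \<in> {0..1} \<Longrightarrow> norm (f x) \<le> M"
    using compact_imp_bounded bounded_iff by (metis imageI)
  have fin: "finite_measure unit_interval"
    by (rule finite_measure_lebesgue_on) auto
  show "integrable unit_interval (\<lambda>x. (norm (f x))\<^sup>2)"
  proof (rule finite_measure.integrable_const_bound[OF fin, where B = "M\<^sup>2"])
    show "AE x in unit_interval. norm ((norm (f x))\<^sup>2) \<le> M\<^sup>2"
      using M by (auto intro!: AE_I2 power_mono)
    show "(\<lambda>x. (norm (f x))\<^sup>2) \<in> borel_measurable unit_interval" using m by auto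
  qed
qed

lemma test_function_deriv:
  assumes "test_function \<psi>"
  shows "(\<psi> has_vector_derivative vector_derivative \<psi> (at x)) (at x)"
    and "continuous_on UNIV (\<lambda>x. vector_derivative \<psi> (at x))"
    and "continuous_on UNIV \<psi>"
proof -
  have *: "\<psi> C1_differentiable_on UNIV" using assms by (simp add: test_function_def)
  then show "(\<psi> has_vector_derivative vector_derivative \<psi> (at x)) (at x)"
    by (simp add: C1_differentiable_on_eq vector_derivative_works)
  show "continuous_on UNIV (\<lambda>x. vector_derivative \<psi> (at x))"
    using * by (simp add: C1_differentiable_on_eq)
  show "continuous_on UNIV \<psi>"
    using * C1_differentiable_on_eq differentiable_imp_continuous_within
    by (metis UNIV_I continuous_at_imp_continuous_on)
qed

lemma test_function_square_integrable:
  assumes "test_function \<psi>"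
  shows "square_integrable \<psi>" "square_integrable (\<lambda>x. vector_derivative \<psi> (at x))"
  using test_function_deriv[OF assms] by (auto intro: square_integrable_continuous)

lemma rep_l2: "square_integrable (rep_l2 u)"
  using Quotient3_rep_reflp[OF Quotient3_l2] by (simp add: l2_rel_def)

lemma abs_rep_l2: "abs_l2 (rep_l2 u) = u"
  using Quotient3_abs_rep[OF Quotient3_l2] .

lemma abs_l2_eq_iff:
  assumes "square_integrable f" "square_integrable g"
  shows "abs_l2 f = abs_l2 g \<longleftrightarrow> (AE x in unit_interval. f x = g x)"
  using Quotient3_rel[OF Quotient3_l2, of f g] assms by (auto simp: l2_rel_def)

lemma l2_pairing_abs:
  assumes "square_integrable f" "square_integrable g"
  shows "l2_pairing (abs_l2 f) (abs_l2 g) = (LINT x|unit_interval. f x * g x)"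
  using assms by (intro l2_pairing.abs_eq) (auto simp: l2_rel_def)

lemma l2_add_abs:
  assumes "square_integrable f" "square_integrable g"
  shows "abs_l2 f + abs_l2 g = abs_l2 (\<lambda>x. f x + g x)"
  using assms by (intro plus_l2.abs_eq) (auto simp: l2_rel_def)

lemma l2_scaleR_abs:
  assumes "square_integrable f"
  shows "r *\<^sub>R abs_l2 f = abs_l2 (\<lambda>x. r *\<^sub>R f x)"
  using assms by (intro scaleR_l2.abs_eq) (auto simp: l2_rel_def)

lemma l2_pairing_add_left: "l2_pairing (u + v) w = l2_pairing u w + l2_pairing v w"
  by transfer (simp add: l2_rel_def distrib_right square_integrable_mult)

lemma l2_pairing_scaleR_left: "l2_pairing (r *\<^sub>R u) w = r *\<^sub>R l2_pairing u w"
  by transfer simp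

lemma l2_pairing_diff_left: "l2_pairing (u - v) w = l2_pairing u w - l2_pairing v w"
  using l2_pairing_add_left[of u "(-1) *\<^sub>R v" w] l2_pairing_scaleR_left[of "-1" v w] by simp

lemma norm_l2_abs:
  assumes "square_integrable f"
  shows "norm (abs_l2 f) = sqrt (LINT x|unit_interval. (cmod (f x))\<^sup>2)"
proof -
  have "inner (abs_l2 f) (abs_l2 f) = Re (LINT x|unit_interval. f x * cnj (f x))"
    using assms by (intro inner_l2.abs_eq) (auto simp: l2_rel_def)
  also have "\<dots> = Re (of_real (LINT x|unit_interval. (cmod (f x))\<^sup>2))"
    unfolding complex_norm_square[symmetric] by (simp only: integral_complex_of_real)
  finally show ?thesis by (simp add: norm_eq_sqrt_inner)
qed

lemma has_derivative_max_0_square: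
  "((\<lambda>s::real. (max 0 s)\<^sup>2) has_real_derivative 2 * max 0 s) (at s)"
proof -
  consider "s < 0" | "s = 0" | "s > 0" by linarith
  then show ?thesis
  proof cases
    case 1
    have "((\<lambda>s::real. 0) has_real_derivative 2 * max 0 s) (at s)" using 1 by simp
    then show ?thesis
      by (rule has_field_derivative_transform_within_open[of _ _ _ "{..<0}"]) (use 1 in auto)
  next
    case 3
    have "((\<lambda>s::real. s\<^sup>2) has_real_derivative 2 * max 0 s) (at s)"
      using 3 by (auto intro!: derivative_eq_intros)
    then show ?thesis
      by (rule has_field_derivative_transform_within_open[of _ _ _ "{0<..}"]) (use 3 in auto)
  next
    case 2
    have "((\<lambda>h::real. (max 0 h)\<^sup>2 / h) \<longlongrightarrow> 0) (at 0)"
    proof (rule Lim_null_comparison)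
      show "\<forall>\<^sub>F h in at 0. norm ((max 0 h)\<^sup>2 / h) \<le> \<bar>h::real\<bar>"
        by (intro always_eventually) (auto simp: max_def power2_eq_square)
      show "((\<lambda>h::real. \<bar>h\<bar>) \<longlongrightarrow> 0) (at 0)"
        by (intro tendsto_rabs_zero tendsto_ident_at)
    qed
    then show ?thesis using 2 by (simp add: has_field_derivative_iff)
  qed
qed

definition bump :: "real \<Rightarrow> real \<Rightarrow> nat \<Rightarrow> real \<Rightarrow> real" where
  "bump a b n x = 1 - inverse (1 + real n * (max 0 ((x - a) * (b - x)))\<^sup>2)"

lemma bump_deriv:
  "(bump a b n has_real_derivative
      real n * (2 * max 0 ((x - a) * (b - x)) * (a + b - 2 * x))
        / (1 + real n * (max 0 ((x - a) * (b - x)))\<^sup>2)\<^sup>2) (at x)"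
proof -
  have p: "((\<lambda>x. (x - a) * (b - x)) has_real_derivative (a + b - 2 * x)) (at x)"
    by (auto intro!: derivative_eq_intros)
  have m: "((\<lambda>x. (max 0 ((x - a) * (b - x)))\<^sup>2) has_real_derivative
      2 * max 0 ((x - a) * (b - x)) * (a + b - 2 * x)) (at x)"
    using DERIV_chain2[OF has_derivative_max_0_square p] .
  have pos: "1 + real n * (max 0 ((x - a) * (b - x)))\<^sup>2 > 0"
    by (simp add: add_pos_nonneg)
  have "((\<lambda>x. 1 - inverse (1 + real n * (max 0 ((x - a) * (b - x)))\<^sup>2)) has_real_derivative
      real n * (2 * max 0 ((x - a) * (b - x)) * (a + b - 2 * x))
        / (1 + real n * (max 0 ((x - a) * (b - x)))\<^sup>2)\<^sup>2) (at x)"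
  proof (rule DERIV_cong[OF DERIV_diff[OF DERIV_const
        DERIV_inverse'[OF DERIV_add[OF DERIV_const DERIV_cmult[OF m]]]]])
    have "0 - - (inverse q * (0 + real n * d) * inverse q) = real n * d / q\<^sup>2" for q d :: real
      by (simp add: divide_inverse power2_eq_square)
    then show "0 - - (inverse (1 + real n * (max 0 ((x - a) * (b - x)))\<^sup>2) *
        (0 + real n * (2 * max 0 ((x - a) * (b - x)) * (a + b - 2 * x))) *
        inverse (1 + real n * (max 0 ((x - a) * (b - x)))\<^sup>2)) =
      real n * (2 * max 0 ((x - a) * (b - x)) * (a + b - 2 * x))
        / (1 + real n * (max 0 ((x - a) * (b - x)))\<^sup>2)\<^sup>2" .
  qed (use pos in simp)
  then show ?thesis by (simp add: bump_def[abs_def])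
qed

lemma test_function_bump:
  assumes "0 < a" "a < b" "b < 1"
  shows "test_function (\<lambda>x. of_real (bump a b n x))"
  unfolding test_function_def
proof
  have pos: "1 + real n * (max 0 ((x - a) * (b - x)))\<^sup>2 \<noteq> 0" for x
    by (smt (verit) mult_nonneg_nonneg of_nat_0_le_iff zero_le_power2)
  show "(\<lambda>x. complex_of_real (bump a b n x)) C1_differentiable_on UNIV"
    unfolding C1_differentiable_on_def
  proof (intro exI conjI ballI)
    show "((\<lambda>x. complex_of_real (bump a b n x)) has_vector_derivative
      of_real (real n * (2 * max 0 ((x - a) * (b - x)) * (a + b - 2 * x))
        / (1 + real n * (max 0 ((x - a) * (b - x)))\<^sup>2)\<^sup>2)) (at x)" for x
      by (intro has_vector_derivative_of_real bump_deriv)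
    show "continuous_on UNIV (\<lambda>x. complex_of_real (real n * (2 * max 0 ((x - a) * (b - x)) * (a + b - 2 * x))
        / (1 + real n * (max 0 ((x - a) * (b - x)))\<^sup>2)\<^sup>2))"
      using pos by (intro continuous_intros) auto
  qed
  show "\<exists>K. compact K \<and> K \<subseteq> {0<..<1} \<and> (\<forall>x. x \<notin> K \<longrightarrow> complex_of_real (bump a b n x) = 0)"
  proof (intro exI[of _ "{a..b}"] conjI allI impI)
    fix x assume "x \<notin> {a..b}"
    show "complex_of_real (bump a b n x) = 0"
    proof (cases "(x - a) * (b - x) \<le> 0")
      case True then show ?thesis by (simp add: bump_def max_def)
    next
      case False
      then have "(x > a \<and> b > x) \<or> (x < a \<and> b < x)" by (auto simp: not_le zero_less_mult_iff)
      with \<open>x \<notin> {a..b}\<close> \<open>a < b\<close> show ?thesis by auto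
    qed
  qed (use assms in auto)
qed

lemma integral_zero_if_orthogonal_test_functions:
  assumes g: "square_integrable g"
    and orth: "\<And>\<psi>. test_function \<psi> \<Longrightarrow> (LINT x|unit_interval. g x * \<psi> x) = 0"
    and ab: "0 < a" "a < b" "b < 1"
  shows "(LINT x|unit_interval. g x * indicator {a<..<b} x) = 0"
    and "integrable unit_interval (\<lambda>x. g x * indicator {a<..<b} x)"
proof -
  have gm: "g \<in> borel_measurable unit_interval" using g by (simp add: square_integrable_def)
  have one: "square_integrable (\<lambda>x. 1::complex)" by (intro square_integrable_continuous continuous_intros)
  have gi: "integrable unit_interval g" using square_integrable_mult[OF g one] by simp
  have im: "(\<lambda>x. indicator {a<..<b} x :: complex) \<in> borel_measurable unit_interval"
    by (intro borel_measurable_indicator) (use ab in \<open>auto simp: sets_restrict_space intro!: image_eqI[of _ _ "{a<..<b}"]\<close>)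
  let ?s = "\<lambda>n x. g x * complex_of_real (bump a b n x)"
  have bm: "(\<lambda>x. complex_of_real (bump a b n x)) \<in> borel_measurable unit_interval" for n
    using test_function_square_integrable(1)[OF test_function_bump[of a b n]] ab
    by (simp add: square_integrable_def)
  have "(\<lambda>n. LINT x|unit_interval. ?s n x) \<longlonglongrightarrow> (LINT x|unit_interval. g x * indicator {a<..<b} x)"
  proof (rule integral_dominated_convergence)
    show "(\<lambda>x. g x * indicator {a<..<b} x) \<in> borel_measurable unit_interval"
      using gm im by simp
    show "?s n \<in> borel_measurable unit_interval" for n
      using gm bm by simp
    show "integrable unit_interval (\<lambda>x. norm (g x))" using gi by simp
    have "(\<lambda>n. ?s n x) \<longlonglongrightarrow> g x * indicator {a<..<b} x" for x
    proof (cases "x \<in> {a<..<b}")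
      case True
      define m where "m = (max 0 ((x - a) * (b - x)))\<^sup>2"
      have "m > 0" using True by (simp add: m_def)
      have "filterlim (\<lambda>n. 1 + real n * m) at_top sequentially"
        by (intro filterlim_tendsto_add_at_top[OF tendsto_const]
              filterlim_at_top_mult_tendsto_pos[OF tendsto_const \<open>m > 0\<close>] filterlim_real_sequentially)
      then have "(\<lambda>n. inverse (1 + real n * m)) \<longlonglongrightarrow> 0"
        by (rule tendsto_inverse_0_at_top)
      then have "(\<lambda>n. g x * of_real (1 - inverse (1 + real n * m))) \<longlonglongrightarrow> g x * of_real (1 - 0)"
        by (intro tendsto_intros)
      then show ?thesis using True by (simp add: bump_def m_def)
    next
      case False
      have "\<not> (0 < (x - a) * (b - x))"
        using False ab by (auto simp: zero_less_mult_iff)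
      then have "bump a b n x = 0" for n by (simp add: bump_def max_def)
      then show ?thesis using False by simp
    qed
    then show "AE x in unit_interval. (\<lambda>n. ?s n x) \<longlonglongrightarrow> g x * indicator {a<..<b} x"
      by (intro AE_I2)
    have "\<bar>bump a b n x\<bar> \<le> 1" for n x
    proof -
      have "1 + real n * (max 0 ((x - a) * (b - x)))\<^sup>2 \<ge> 1" by simp
      then have "inverse (1 + real n * (max 0 ((x - a) * (b - x)))\<^sup>2) \<le> 1"
        "inverse (1 + real n * (max 0 ((x - a) * (b - x)))\<^sup>2) \<ge> 0"
        by (auto simp: inverse_le_1_iff)
      then show ?thesis unfolding bump_def by linarith
    qed
    then show "AE x in unit_interval. norm (?s n x) \<le> norm (g x)" for n
      by (intro AE_I2) (simp add: norm_mult mult_left_le)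
  qed
  moreover have "(LINT x|unit_interval. ?s n x) = 0" for n
    using ab by (intro orth test_function_bump) auto
  ultimately show "(LINT x|unit_interval. g x * indicator {a<..<b} x) = 0"
    by (simp add: LIMSEQ_const_iff)
  show "integrable unit_interval (\<lambda>x. g x * indicator {a<..<b} x)"
    by (rule Bochner_Integration.integrable_bound[OF gi])
       (use gm im in \<open>auto simp: indicator_def\<close>)
qed

lemma AE_zero_if_orthogonal_test_functions:
  assumes g: "square_integrable g"
    and orth: "\<And>\<psi>. test_function \<psi> \<Longrightarrow> (LINT x|unit_interval. g x * \<psi> x) = 0"
  shows "AE x in unit_interval. g x = 0"
proof -
  define f where "f x = (if x \<in> {0<..<1} then g x else 0)" for x
  have one: "square_integrable (\<lambda>x. 1::complex)" by (intro square_integrable_continuous continuous_intros)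
  have gi: "integrable unit_interval g" using square_integrable_mult[OF g one] by simp
  have "f absolutely_integrable_on UNIV"
    unfolding f_def absolutely_integrable_restrict_UNIV
    using gi by (simp add: set_integrable_restrict_space integrable_restrict_space set_integrable_def)
  then have "f integrable_on cbox a b" for a b
    using integrable_on_subcbox set_lebesgue_integral_eq_integral(1) by blast
  then obtain N where N: "negligible N" "\<And>x e. x \<notin> N \<Longrightarrow> 0 < e \<Longrightarrow>
      \<exists>d>0. \<forall>h. 0 < h \<and> h < d \<longrightarrow> norm (integral (cbox x (x + h *\<^sub>R One)) f /\<^sub>R h ^ DIM(real) - f x) < e"
    by (rule integrable_ccontinuous_explicit) blast
  have int0: "integral {a..b} f = 0" if ab: "0 < a" "a < b" "b < 1" for a b
  proof -
    have "((\<lambda>x. g x * indicator {a<..<b} x) has_integral 0) {0<..<1}"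
      using has_integral_integral_lebesgue_on[OF integral_zero_if_orthogonal_test_functions(2)[OF g orth ab]]
        integral_zero_if_orthogonal_test_functions(1)[OF g orth ab] by simp
    then have "((\<lambda>x. if x \<in> {0<..<1} then g x * indicator {a<..<b} x else 0) has_integral 0) UNIV"
      by (simp only: has_integral_restrict_UNIV)
    also have "(\<lambda>x. if x \<in> {0<..<1} then g x * indicator {a<..<b} x else 0) =
        (\<lambda>x. if x \<in> {a<..<b} then f x else 0)"
      using ab by (auto simp: f_def fun_eq_iff)
    finally have "(f has_integral 0) {a<..<b}"
      by (simp only: has_integral_restrict_UNIV)
    then have "(f has_integral 0) {a..b}"
      by (simp add: has_integral_Icc_iff_Ioo)
    then show ?thesis by (rule integral_unique)
  qed
  have "g x = 0" if x: "x \<in> {0<..<1}" "x \<notin> N" for x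
  proof (rule ccontr)
    assume "g x \<noteq> 0"
    then have "0 < norm (g x)" by simp
    from N(2)[OF x(2) this] obtain d where d: "d > 0"
      "\<And>h. 0 < h \<Longrightarrow> h < d \<Longrightarrow> norm (integral (cbox x (x + h *\<^sub>R One)) f /\<^sub>R h ^ DIM(real) - f x) < norm (g x)"
      by blast
    define h where "h = min (d / 2) ((1 - x) / 2)"
    have h: "0 < h" "h < d" "x + h < 1" using d x by (auto simp: h_def min_def field_simps)
    have "integral {x..x + h} f = 0" using h x by (intro int0) auto
    then have "norm (f x) < norm (g x)" using d(2)[OF h(1,2)] by simp
    then show False using x by (simp add: f_def)
  qed
  then have "{x \<in> {0<..<1}. g x \<noteq> 0} \<subseteq> N" by auto
  then have "negligible {x \<in> {0<..<1}. g x \<noteq> 0}" using N(1) negligible_subset by blast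
  then have "AE x in lebesgue. x \<in> {0<..<1} \<longrightarrow> g x = 0"
    by (intro AE_I'[of "{x \<in> {0<..<1}. g x \<noteq> 0}"]) (auto simp: negligible_iff_null_sets)
  then show ?thesis by (subst AE_restrict_space_iff) auto
qed

lemma weak_derivative_unique:
  assumes "has_weak_derivative u g" "has_weak_derivative u h"
  shows "g = h"
proof -
  have sq: "square_integrable (\<lambda>x. rep_l2 g x - rep_l2 h x)"
    by (intro square_integrable_diff rep_l2)
  have diff: "abs_l2 (\<lambda>x. rep_l2 g x - rep_l2 h x) = g - h"
    using minus_l2.abs_eq[of "rep_l2 g" "rep_l2 h"] by (simp add: l2_rel_def rep_l2 abs_rep_l2)
  have "AE x in unit_interval. rep_l2 g x - rep_l2 h x = 0"
  proof (rule AE_zero_if_orthogonal_test_functions[OF sq])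
    fix \<psi> assume \<psi>: "test_function \<psi>"
    have "l2_pairing (g - h) (abs_l2 \<psi>) = 0"
      using assms \<psi> by (simp add: has_weak_derivative_def l2_pairing_diff_left)
    then show "(LINT x|unit_interval. (rep_l2 g x - rep_l2 h x) * \<psi> x) = 0"
      using l2_pairing_abs[OF sq test_function_square_integrable(1)[OF \<psi>]] diff by simp
  qed
  then have "abs_l2 (rep_l2 g) = abs_l2 (rep_l2 h)"
    by (simp add: abs_l2_eq_iff rep_l2)
  then show ?thesis by (simp add: abs_rep_l2)
qed

lemma weak_derivative_eqI: "has_weak_derivative u g \<Longrightarrow> weak_derivative u = g"
  unfolding weak_derivative_def using weak_derivative_unique by blast

lemma has_weak_derivative_weak_derivative:
  "u \<in> H1 \<Longrightarrow> has_weak_derivative u (weak_derivative u)"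
  using weak_derivative_eqI by (auto simp: H1_def)

lemma has_weak_derivative_add:
  "has_weak_derivative u g \<Longrightarrow> has_weak_derivative v h \<Longrightarrow> has_weak_derivative (u + v) (g + h)"
  by (simp add: has_weak_derivative_def l2_pairing_add_left)

lemma has_weak_derivative_scaleR:
  "has_weak_derivative u g \<Longrightarrow> has_weak_derivative (r *\<^sub>R u) (r *\<^sub>R g)"
  by (simp add: has_weak_derivative_def l2_pairing_scaleR_left)

lemma has_weak_derivative_diff:
  "has_weak_derivative u g \<Longrightarrow> has_weak_derivative v h \<Longrightarrow> has_weak_derivative (u - v) (g - h)"
  by (simp add: has_weak_derivative_def l2_pairing_diff_left)

lemma H1_norm_prod: "H1_norm u = norm (u, weak_derivative u)"
  by (simp add: H1_norm_def norm_Pair)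

lemma test_function_boundary:
  assumes "test_function \<psi>"
  shows "\<psi> 0 = 0" "\<psi> 1 = 0"
proof -
  obtain K where K: "K \<subseteq> {0<..<1}" "\<And>x. x \<notin> K \<Longrightarrow> \<psi> x = 0"
    using assms by (auto simp: test_function_def)
  then have "0 \<notin> K" "1 \<notin> K" by auto
  then show "\<psi> 0 = 0" "\<psi> 1 = 0" by (auto intro: K(2))
qed

lemma has_weak_derivative_test_function:
  assumes "test_function \<psi>"
  shows "has_weak_derivative (abs_l2 \<psi>) (abs_l2 (\<lambda>x. vector_derivative \<psi> (at x)))"
  unfolding has_weak_derivative_def
proof (intro allI impI)
  fix \<eta> assume \<eta>: "test_function \<eta>"
  let ?\<psi>' = "\<lambda>x. vector_derivative \<psi> (at x)" and ?\<eta>' = "\<lambda>x. vector_derivative \<eta> (at x)"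
  note sq = test_function_square_integrable[OF assms] test_function_square_integrable[OF \<eta>]
  have i1: "integrable unit_interval (\<lambda>x. \<psi> x * ?\<eta>' x)"
    and i2: "integrable unit_interval (\<lambda>x. ?\<psi>' x * \<eta> x)"
    using sq by (auto intro: square_integrable_mult)
  have "((\<lambda>x. \<psi> x * ?\<eta>' x + ?\<psi>' x * \<eta> x) has_integral (\<psi> 1 * \<eta> 1 - \<psi> 0 * \<eta> 0)) {0..1}"
    by (intro fundamental_theorem_of_calculus has_vector_derivative_mult
          has_vector_derivative_at_within[OF test_function_deriv(1)[OF assms]]
          has_vector_derivative_at_within[OF test_function_deriv(1)[OF \<eta>]]) simp
  then have "((\<lambda>x. \<psi> x * ?\<eta>' x + ?\<psi>' x * \<eta> x) has_integral 0) {0<..<1}"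
    by (simp add: test_function_boundary[OF assms] has_integral_Icc_iff_Ioo)
  moreover have "((\<lambda>x. \<psi> x * ?\<eta>' x + ?\<psi>' x * \<eta> x) has_integral
      (LINT x|unit_interval. \<psi> x * ?\<eta>' x + ?\<psi>' x * \<eta> x)) {0<..<1}"
    using i1 i2 by (intro has_integral_integral_lebesgue_on) auto
  ultimately have "(LINT x|unit_interval. \<psi> x * ?\<eta>' x + ?\<psi>' x * \<eta> x) = 0"
    using has_integral_unique by blast
  then have "(LINT x|unit_interval. \<psi> x * ?\<eta>' x) = - (LINT x|unit_interval. ?\<psi>' x * \<eta> x)"
    using i1 i2 by (simp add: eq_neg_iff_add_eq_0)
  then show "l2_pairing (abs_l2 \<psi>) (abs_l2 ?\<eta>') = - l2_pairing (abs_l2 ?\<psi>') (abs_l2 \<eta>)"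
    using sq by (simp add: l2_pairing_abs)
qed

lemma test_function_H1: "test_function \<psi> \<Longrightarrow> abs_l2 \<psi> \<in> H1"
  using has_weak_derivative_test_function by (auto simp: H1_def)

lemma test_function_poincare:
  assumes "test_function \<psi>"
  shows "norm (abs_l2 \<psi>) \<le> norm (weak_derivative (abs_l2 \<psi>))"
proof -
  let ?d = "\<lambda>x. vector_derivative \<psi> (at x)"
  note sq = test_function_square_integrable[OF assms]
  have one: "square_integrable (\<lambda>x. 1::complex)" by (intro square_integrable_continuous continuous_intros)
  have wd: "weak_derivative (abs_l2 \<psi>) = abs_l2 ?d"
    by (rule weak_derivative_eqI[OF has_weak_derivative_test_function[OF assms]])
  define D where "D = norm (abs_l2 ?d)"
  have sn: "square_integrable (\<lambda>x. complex_of_real (cmod (?d x)))"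
    using test_function_deriv(2)[OF assms] by (intro square_integrable_continuous continuous_intros)
  have nD: "norm (abs_l2 (\<lambda>x. complex_of_real (cmod (?d x)))) = D"
    by (simp add: D_def norm_l2_abs[OF sn] norm_l2_abs[OF sq(2)])
  have prob: "measure unit_interval {0<..<1} = 1"
    by (simp add: measure_restrict_space)
  have n1: "norm (abs_l2 (\<lambda>x. 1)) = 1"
    using prob by (simp add: norm_l2_abs[OF one])
  have "inner (abs_l2 (\<lambda>x. complex_of_real (cmod (?d x)))) (abs_l2 (\<lambda>x. 1)) =
      Re (LINT x|unit_interval. complex_of_real (cmod (?d x)) * cnj 1)"
    using sn one by (intro inner_l2.abs_eq) (auto simp: l2_rel_def)
  also have "\<dots> = (LINT x|unit_interval. cmod (?d x))" by simp
  finally have L1: "(LINT x|unit_interval. cmod (?d x)) \<le> D"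
    using norm_cauchy_schwarz[of "abs_l2 (\<lambda>x. complex_of_real (cmod (?d x)))" "abs_l2 (\<lambda>x. 1)"] nD n1
    by simp
  have di: "integrable unit_interval ?d" using square_integrable_mult[OF sq(2) one] by simp
  have nb: "cmod (\<psi> x) \<le> D" if x: "x \<in> {0<..<1}" for x
  proof -
    have cont: "continuous_on {0..x} (\<lambda>x. cmod (?d x))" "continuous_on {0..1} (\<lambda>x. cmod (?d x))"
      by (auto intro!: continuous_intros continuous_on_subset[OF test_function_deriv(2)[OF assms]])
    have "(?d has_integral (\<psi> x - \<psi> 0)) {0..x}"
      using x by (intro fundamental_theorem_of_calculus
            has_vector_derivative_at_within[OF test_function_deriv(1)[OF assms]]) simp
    then have "\<psi> x = integral {0..x} ?d" "?d integrable_on {0..x}"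
      using test_function_boundary[OF assms] by (auto simp: integral_unique)
    then have "cmod (\<psi> x) \<le> integral {0..x} (\<lambda>x. cmod (?d x))"
      by (metis integral_norm_bound_integral order_refl integrable_continuous_interval cont(1))
    also have "\<dots> \<le> integral {0..1} (\<lambda>x. cmod (?d x))"
      using x by (intro integral_subset_le integrable_continuous_interval cont) auto
    also have "\<dots> = (LINT x|unit_interval. cmod (?d x))"
      using has_integral_integral_lebesgue_on[OF integrable_norm[OF di]]
      by (intro integral_unique) (simp add: has_integral_Icc_iff_Ioo)
    finally show ?thesis using L1 by simp
  qed
  have D0: "D \<ge> 0" by (simp add: D_def)
  have "(LINT x|unit_interval. (cmod (\<psi> x))\<^sup>2) \<le> (LINT x|unit_interval. D\<^sup>2)"
    using sq(1) nb D0 finite_measure.integrable_const[OF finite_measure_lebesgue_on[of "{0<..<1::real}"]]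
    by (intro integral_mono) (auto simp: square_integrable_def intro!: power_mono)
  also have "\<dots> = D\<^sup>2" using prob by simp
  finally show ?thesis
    unfolding wd D_def[symmetric] norm_l2_abs[OF sq(1)]
    using D0 real_sqrt_le_iff real_sqrt_abs by (metis abs_of_nonneg)
qed

lemma H1_0_approx:
  assumes "u \<in> H1_0" "e > 0"
  obtains \<psi> where "test_function \<psi>" "norm (u - abs_l2 \<psi>) < e"
    "norm (weak_derivative u - weak_derivative (abs_l2 \<psi>)) < e"
proof -
  obtain \<psi> where \<psi>: "test_function \<psi>" "H1_norm (u - abs_l2 \<psi>) < e"
    using assms by (auto simp: H1_0_def)
  have "u \<in> H1" using assms by (simp add: H1_0_def)
  then have "weak_derivative (u - abs_l2 \<psi>) = weak_derivative u - weak_derivative (abs_l2 \<psi>)"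
    using has_weak_derivative_weak_derivative[OF test_function_H1[OF \<psi>(1)]]
      has_weak_derivative_weak_derivative
    by (intro weak_derivative_eqI has_weak_derivative_diff)
  then have "norm (u - abs_l2 \<psi>, weak_derivative u - weak_derivative (abs_l2 \<psi>)) < e"
    using \<psi>(2) by (simp add: H1_norm_prod)
  then show ?thesis
    using \<psi>(1) norm_fst_le norm_snd_le that by (meson le_less_trans)
qed

lemma H1_0_poincare:
  assumes "u \<in> H1_0"
  shows "norm u \<le> norm (weak_derivative u)"
proof (rule field_le_epsilon)
  fix e :: real assume "e > 0"
  then obtain \<psi> where \<psi>: "test_function \<psi>" "norm (u - abs_l2 \<psi>) < e / 2"
      "norm (weak_derivative u - weak_derivative (abs_l2 \<psi>)) < e / 2"
    using H1_0_approx[OF assms, of "e / 2"] by auto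
  have "norm u \<le> norm (abs_l2 \<psi>) + norm (u - abs_l2 \<psi>)"
    by (metis add.commute norm_triangle_sub)
  moreover have "norm (weak_derivative (abs_l2 \<psi>)) \<le> norm (weak_derivative u)
      + norm (weak_derivative u - weak_derivative (abs_l2 \<psi>))"
    by (metis norm_minus_commute norm_triangle_sub)
  ultimately show "norm u \<le> norm (weak_derivative u) + e"
    using test_function_poincare[OF \<psi>(1)] \<psi> by linarith
qed

lemma H1_add:
  assumes "u \<in> H1" "v \<in> H1"
  shows "u + v \<in> H1" "weak_derivative (u + v) = weak_derivative u + weak_derivative v"
  using has_weak_derivative_add[OF assms[THEN has_weak_derivative_weak_derivative]]
  by (auto simp: H1_def weak_derivative_eqI)

lemma H1_scaleR:
  assumes "u \<in> H1"
  shows "r *\<^sub>R u \<in> H1" "weak_derivative (r *\<^sub>R u) = r *\<^sub>R weak_derivative u"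
  using has_weak_derivative_scaleR[OF assms[THEN has_weak_derivative_weak_derivative]]
  by (auto simp: H1_def weak_derivative_eqI)

lemma H1_diff: "u \<in> H1 \<Longrightarrow> v \<in> H1 \<Longrightarrow> u - v \<in> H1"
  using H1_add(1)[of u "(-1) *\<^sub>R v"] H1_scaleR(1)[of v "-1"] by simp

lemma H1_norm_add_le:
  "u \<in> H1 \<Longrightarrow> v \<in> H1 \<Longrightarrow> H1_norm (u + v) \<le> H1_norm u + H1_norm v"
  by (simp add: H1_norm_prod H1_add flip: add_Pair) (rule norm_triangle_ineq)

lemma H1_norm_scaleR: "u \<in> H1 \<Longrightarrow> H1_norm (r *\<^sub>R u) = \<bar>r\<bar> * H1_norm u"
  by (simp add: H1_norm_prod H1_scaleR flip: scaleR_Pair)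

lemma test_function_add:
  assumes "test_function \<psi>" "test_function \<eta>"
  shows "test_function (\<lambda>x. \<psi> x + \<eta> x)"
proof -
  obtain K L where "compact K" "K \<subseteq> {0<..<1}" "\<And>x. x \<notin> K \<Longrightarrow> \<psi> x = 0"
    "compact L" "L \<subseteq> {0<..<1}" "\<And>x. x \<notin> L \<Longrightarrow> \<eta> x = 0"
    using assms by (auto simp: test_function_def)
  then have "\<exists>K. compact K \<and> K \<subseteq> {0<..<1} \<and> (\<forall>x. x \<notin> K \<longrightarrow> \<psi> x + \<eta> x = 0)"
    by (intro exI[of _ "K \<union> L"]) auto
  then show ?thesis using assms by (simp add: test_function_def)
qed

lemma test_function_scaleR:
  assumes "test_function \<psi>"
  shows "test_function (\<lambda>x. r *\<^sub>R \<psi> x)"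
proof -
  have "(\<lambda>x. r *\<^sub>R \<psi> x) C1_differentiable_on UNIV"
    using assms by (intro C1_differentiable_on_scaleR) (auto simp: test_function_def)
  then show ?thesis using assms by (auto simp: test_function_def)
qed

lemma zero_mem_H1_0: "0 \<in> H1_0"
proof -
  have t: "test_function (\<lambda>x. 0)" by (auto simp: test_function_def intro!: exI[of _ "{}"])
  have "abs_l2 (\<lambda>x. 0) = 0" by (simp add: zero_l2_def)
  moreover have "has_weak_derivative 0 0"
    using has_weak_derivative_scaleR[OF has_weak_derivative_test_function[OF t], of 0] by simp
  ultimately show ?thesis
    using t by (auto simp: H1_0_def H1_def H1_norm_def weak_derivative_eqI intro!: exI[of _ "\<lambda>x. 0"])
qed

lemma add_mem_H1_0:
  assumes "u \<in> H1_0" "v \<in> H1_0"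
  shows "u + v \<in> H1_0"
proof -
  have H: "u \<in> H1" "v \<in> H1" using assms by (auto simp: H1_0_def)
  have "\<exists>\<psi>. test_function \<psi> \<and> H1_norm (u + v - abs_l2 \<psi>) < e" if "e > 0" for e
  proof -
    have "e / 2 > 0" using that by simp
    then obtain \<psi> \<eta> where t: "test_function \<psi>" "H1_norm (u - abs_l2 \<psi>) < e / 2"
      "test_function \<eta>" "H1_norm (v - abs_l2 \<eta>) < e / 2"
      using assms unfolding H1_0_def by blast
    have "u - abs_l2 \<psi> \<in> H1" "v - abs_l2 \<eta> \<in> H1"
      using H t by (auto intro: H1_diff test_function_H1)
    then have "H1_norm ((u - abs_l2 \<psi>) + (v - abs_l2 \<eta>)) < e"
      using H1_norm_add_le t by fastforce
    moreover have "(u - abs_l2 \<psi>) + (v - abs_l2 \<eta>) = u + v - abs_l2 (\<lambda>x. \<psi> x + \<eta> x)"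
      using l2_add_abs t test_function_square_integrable(1) by (metis add_diff_add)
    ultimately show ?thesis using test_function_add t by (metis (no_types, lifting))
  qed
  then show ?thesis using H H1_add(1) by (auto simp: H1_0_def)
qed

lemma scaleR_mem_H1_0:
  assumes "u \<in> H1_0"
  shows "r *\<^sub>R u \<in> H1_0"
proof -
  have H: "u \<in> H1" using assms by (auto simp: H1_0_def)
  have "\<exists>\<psi>. test_function \<psi> \<and> H1_norm (r *\<^sub>R u - abs_l2 \<psi>) < e" if "e > 0" for e
  proof -
    have "e / (\<bar>r\<bar> + 1) > 0" using that by simp
    then obtain \<psi> where t: "test_function \<psi>" "H1_norm (u - abs_l2 \<psi>) < e / (\<bar>r\<bar> + 1)"
      using assms unfolding H1_0_def by blast
    have "u - abs_l2 \<psi> \<in> H1"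
      using H t by (auto intro: H1_diff test_function_H1)
    then have "H1_norm (r *\<^sub>R (u - abs_l2 \<psi>)) = \<bar>r\<bar> * H1_norm (u - abs_l2 \<psi>)"
      by (rule H1_norm_scaleR)
    also have "\<dots> \<le> (\<bar>r\<bar> + 1) * H1_norm (u - abs_l2 \<psi>)"
      by (intro mult_right_mono) (auto simp: H1_norm_def)
    also have "\<dots> < e" using t by (simp add: pos_less_divide_eq mult.commute)
    finally have "H1_norm (r *\<^sub>R u - abs_l2 (\<lambda>x. r *\<^sub>R \<psi> x)) < e"
      using l2_scaleR_abs[OF test_function_square_integrable(1)[OF t(1)]]
      by (simp add: scaleR_diff_right)
    then show ?thesis using test_function_scaleR[OF t(1)] by blast
  qed
  then show ?thesis using H H1_scaleR(1) by (auto simp: H1_0_def)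
qed

typedef h10 = H1_0
  using zero_mem_H1_0 by blast

setup_lifting type_definition_h10

lemma Rep_h10_H1: "Rep_h10 u \<in> H1"
  using Rep_h10[of u] by (simp add: H1_0_def)

instantiation h10 :: real_vector
begin

lift_definition zero_h10 :: h10 is 0 by (rule zero_mem_H1_0)
lift_definition plus_h10 :: "h10 \<Rightarrow> h10 \<Rightarrow> h10" is "(+)" by (rule add_mem_H1_0)
lift_definition scaleR_h10 :: "real \<Rightarrow> h10 \<Rightarrow> h10" is "(*\<^sub>R)" by (rule scaleR_mem_H1_0)
lift_definition uminus_h10 :: "h10 \<Rightarrow> h10" is "uminus"
  using scaleR_mem_H1_0[of _ "-1"] by simp
lift_definition minus_h10 :: "h10 \<Rightarrow> h10 \<Rightarrow> h10" is "(-)"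
  using add_mem_H1_0 scaleR_mem_H1_0[of _ "-1"] by fastforce

instance
  by standard (transfer; simp add: algebra_simps)+

end

instantiation h10 :: real_inner
begin

(* By Poincare's inequality the L2 inner product of the derivatives is definite on H1_0. *)
definition inner_h10 :: "h10 \<Rightarrow> h10 \<Rightarrow> real" where
  "inner_h10 u v = inner (weak_derivative (Rep_h10 u)) (weak_derivative (Rep_h10 v))"
definition norm_h10 :: "h10 \<Rightarrow> real" where "norm_h10 u = sqrt (inner u u)"
definition sgn_h10 :: "h10 \<Rightarrow> h10" where "sgn_h10 u = u /\<^sub>R norm u"
definition dist_h10 :: "h10 \<Rightarrow> h10 \<Rightarrow> real" where "dist_h10 u v = norm (u - v)"
definition uniformity_h10 :: "(h10 \<times> h10) filter" where
  "uniformity_h10 = (INF e\<in>{0<..}. principal {(u, v). dist u v < e})"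
definition open_h10 :: "h10 set \<Rightarrow> bool" where
  "open_h10 S \<longleftrightarrow> (\<forall>u\<in>S. eventually (\<lambda>(u', v). u' = u \<longrightarrow> v \<in> S) uniformity)"

instance
proof
  fix a b c :: h10 and r :: real
  show "dist a b = norm (a - b)" by (rule dist_h10_def)
  show "sgn a = a /\<^sub>R norm a" by (rule sgn_h10_def)
  show "norm a = sqrt (inner a a)" by (rule norm_h10_def)
  show "inner a b = inner b a" by (simp add: inner_h10_def inner_commute)
  show "inner (a + b) c = inner a c + inner b c"
    by (simp add: inner_h10_def plus_h10.rep_eq H1_add Rep_h10_H1 inner_add_left)
  show "inner (r *\<^sub>R a) b = r * inner a b"
    by (simp add: inner_h10_def scaleR_h10.rep_eq H1_scaleR Rep_h10_H1)
  show "0 \<le> inner a a" by (simp add: inner_h10_def)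
  have "weak_derivative (Rep_h10 0) = 0"
    using H1_scaleR(2)[OF Rep_h10_H1[of 0], of 0] by (simp add: zero_h10.rep_eq)
  moreover have "a = 0" if "weak_derivative (Rep_h10 a) = 0"
    using H1_0_poincare[OF Rep_h10[of a]] that Rep_h10_inject[of a 0] by (simp add: zero_h10.rep_eq)
  ultimately show "inner a a = 0 \<longleftrightarrow> a = 0"
    by (auto simp: inner_h10_def)
  show "uniformity = (INF e\<in>{0<..}. principal {(x, y::h10). dist x y < e})"
    by (rule uniformity_h10_def)
  show "open S \<longleftrightarrow> (\<forall>x\<in>S. \<forall>\<^sub>F (x', y) in uniformity. x' = x \<longrightarrow> y \<in> S)" for S :: "h10 set"
    by (rule open_h10_def)
qed

end

type_synonym state = "h10 \<times> l2"

(* The product norm on state is the norm of X, sqrt (LINT |u'|^2 + LINT |v|^2). *)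

definition wave_domain :: "state set" where
  "wave_domain = {(u, v). Rep_h10 u \<in> H2 \<and> v \<in> H1_0}"

(* Only meaningful on wave_domain. *)
definition wave_operator :: "state \<Rightarrow> state" where
  "wave_operator = (\<lambda>(u, v). (Abs_h10 v, weak_derivative (weak_derivative (Rep_h10 u))))"

definition control :: "(real \<Rightarrow> real) \<Rightarrow> complex \<Rightarrow> state" where
  "control b z = (0, abs_l2 (\<lambda>s. complex_of_real (b s) * z))"

definition observation :: "(real \<Rightarrow> real) \<Rightarrow> state \<Rightarrow> complex" where
  "observation b = (\<lambda>(u, v). l2_pairing (abs_l2 (\<lambda>s. complex_of_real (b s))) v)"

(* Only real-linearity of the operators T t is required; for a semigroup generated by a
   complex-linear operator, complex-linearity follows from uniqueness of the semigroup. *)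
definition contraction_semigroup :: "(real \<Rightarrow> 'a::real_normed_vector \<Rightarrow> 'a) \<Rightarrow> bool" where
  "contraction_semigroup T \<longleftrightarrow>
     (\<forall>t\<ge>0. linear (T t) \<and> (\<forall>x. norm (T t x) \<le> norm x)) \<and>
     (\<forall>x. T 0 x = x) \<and>
     (\<forall>s\<ge>0. \<forall>t\<ge>0. \<forall>x. T (s + t) x = T s (T t x)) \<and>
     (\<forall>x. continuous_on {0..} (\<lambda>t. T t x))"

definition is_generator ::
    "'a set \<Rightarrow> ('a \<Rightarrow> 'a) \<Rightarrow> (real \<Rightarrow> 'a::real_normed_vector \<Rightarrow> 'a) \<Rightarrow> bool" where
  "is_generator D A T \<longleftrightarrow>
     (\<forall>x y. ((\<lambda>h. (T h x - x) /\<^sub>R h) \<longlongrightarrow> y) (at_right 0) \<longleftrightarrow> x \<in> D \<and> A x = y)"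

text \<open>Solutions of \<open>x' = A x - F x\<close> on \<open>[0, \<infinity>)\<close>; values at negative times are irrelevant.\<close>

definition mild_solution ::
    "(real \<Rightarrow> 'a \<Rightarrow> 'a) \<Rightarrow> ('a \<Rightarrow> 'a) \<Rightarrow> (real \<Rightarrow> 'a::real_normed_vector) \<Rightarrow> bool" where
  "mild_solution T F x \<longleftrightarrow>
     continuous_on {0..} x \<and>
     (\<forall>t\<ge>0. x t = T t (x 0) - integral {0..t} (\<lambda>s. T (t - s) (F (x s))))"

definition classical_solution ::
    "'a set \<Rightarrow> ('a \<Rightarrow> 'a) \<Rightarrow> ('a \<Rightarrow> 'a) \<Rightarrow> (real \<Rightarrow> 'a::real_normed_vector) \<Rightarrow> bool" where
  "classical_solution D A F x \<longleftrightarrow>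
     (\<exists>x'. continuous_on {0..} x' \<and>
       (\<forall>t\<ge>0. (x has_vector_derivative x' t) (at t within {0..}) \<and>
         x t \<in> D \<and> x' t = A (x t) - F (x t)))"

end

(* Expanding in the eigenfunctions of the Dirichlet Laplacian turns the equation into oscillators
   P_n' = n pi Q_n, Q_n' = - n pi P_n - beta_n f with f = phi(w), w = sum_n beta_n Q_n. All free
   frequencies are multiples of pi, so over a time span of length 2 the observed free evolution is a
   Fourier series, and by Duhamel's formula and the coercivity of phi the energy lost in that span
   dominates the weak energy sum_n beta_n^2 (|P_n|^2 + |Q_n|^2). Monotonicity of phi makes
   |x(t + h) - x(t)| nonincreasing in t; hence averages of x over time spans of fixed length h stay
   bounded in the domain of A, which controls the high modes, while the low modes are controlled by
   the weak energy. For a mild solution h is chosen small but fixed, and this gives convergence to 0.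
   For a classical solution one may let h tend to 0 and optimise the threshold between low and high
   modes, so that the energy E satisfies E(t + 2) <= E(t) - k E(t)^(1 + beta). *)
theory Submission
  imports Defs
begin

section \<open>Orthogonal expansions, trigonometric integrals and a decay recursion\<close>

text \<open>The obstacle is that a mild solution need not be differentiable in \<open>X\<close> nor
  lie in the domain of \<open>A\<close>, so its energy cannot be differentiated directly. Identities
  are therefore proved for single modes, which are differentiable for mild and classical solutions
  alike, and then summed under time integrals with bounds uniform in the number of modes. The
  semigroup enters through its action on the modes, which the generator and contractivity determine.
  The lower bound on |b_n| prices the low modes: below a threshold M the weak energy controls them
  at the cost of a factor M^(2 beta), while above M an error of order M^(-2) remains. Choosing
  M^(-2) proportional to the energy E makes the lost energy at least a multiple of E^(1 + beta).
  Then E decays like t^(-1/beta), and the norm is its square root. The bound on the averages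
  contains |x(h) - x(0)| / h. For a classical solution this stays bounded as h tends to 0; for a
  mild solution it may blow up, so only the qualitative statement survives.\<close>

lemma orthogonal_expansion:
  fixes E :: "nat \<Rightarrow> 'c::real_inner \<Rightarrow> 'a::{real_inner, complete_space}"
  assumes orth: "\<And>m n z w. inner (E m z) (E n w) = (if m = n then inner z w else 0)"
    and coord: "\<And>n x z. inner x (E n z) = inner (C n x) z"
    and total: "\<And>x. (\<And>n. C n x = 0) \<Longrightarrow> x = 0"
  shows "(\<lambda>n. inner (C n x) (C n y)) sums inner x y"
proof -
  \<comment> \<open>By \<open>orth\<close> and \<open>coord\<close>, \<open>E n\<close> embeds the
    n-th mode isometrically and \<open>C n\<close> is its adjoint. Hence \<open>S x N\<close> is the
    orthogonal projection of \<open>x\<close> onto the first \<open>N\<close> modes, and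
    \<open>s x N\<close> its squared norm.\<close>
  define S where "S x N = (\<Sum>n<N. E n (C n x))" for x N
  define s where "s x N = (\<Sum>n<N. (norm (C n x))\<^sup>2)" for x N
  have S_right: "inner y (S x N) = (\<Sum>n<N. inner (C n y) (C n x))" for x y N
    by (simp add: S_def inner_sum_right coord)
  have S_left: "inner (S x N) (E m z) = (if m < N then inner (C m x) z else 0)" for x N m z
    by (simp add: S_def inner_sum_left orth)
  have S_S: "inner (S x N) (S x M) = s x (min N M)" for x N M
  proof -
    have "inner (S x N) (S x M) = (\<Sum>n<M. inner (S x N) (E n (C n x)))"
      by (simp add: S_def[of x M] inner_sum_right)
    also have "\<dots> = (\<Sum>n<M. if n < N then (norm (C n x))\<^sup>2 else 0)"
      by (intro sum.cong) (auto simp: S_left power2_norm_eq_inner)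
    also have "\<dots> = (\<Sum>n\<in>{..<M} \<inter> {..<N}. (norm (C n x))\<^sup>2)"
      by (simp add: sum.inter_restrict)
    also have "{..<M} \<inter> {..<N} = {..<min N M}" by auto
    finally show ?thesis by (simp add: s_def)
  qed
  have dist: "(norm (S x N - S x M))\<^sup>2 = \<bar>s x N - s x M\<bar>" for x N M
  proof -
    have mono: "s x i \<le> s x j" if "i \<le> j" for i j
      unfolding s_def using that by (intro sum_mono2) auto
    have "(norm (S x N - S x M))\<^sup>2 = s x N + s x M - 2 * s x (min N M)"
      by (simp add: power2_norm_eq_inner inner_diff_left inner_diff_right S_S min.commute)
    then show ?thesis
      using mono[of N M] mono[of M N] by (cases "N \<le> M") (auto simp: min_def)
  qed
  have bessel: "s x N \<le> (norm x)\<^sup>2" for x N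
  proof -
    have "0 \<le> (norm (x - S x N))\<^sup>2" by simp
    also have "\<dots> = (norm x)\<^sup>2 - s x N"
      using S_right[of x x N] S_S[of x N N]
      by (simp add: power2_norm_eq_inner inner_diff_left inner_diff_right inner_commute s_def)
    finally show ?thesis by simp
  qed
  \<comment> \<open>Distances between projections are differences of the bounded increasing sequence
    \<open>s x\<close>, so completeness yields a limit. It has the same coordinates as
    \<open>x\<close>, and totality identifies the two.\<close>
  have "S x \<longlonglongrightarrow> x" for x
  proof -
    have "Bseq (s x)"
      by (intro BseqI'[of _ "(norm x)\<^sup>2"]) (use bessel in \<open>auto simp: s_def sum_nonneg\<close>)
    moreover have "incseq (s x)"
      by (intro incseq_SucI) (simp add: s_def)
    ultimately have "Cauchy (s x)"
      by (simp add: Bseq_monoseq_convergent convergent_Cauchy incseq_imp_monoseq)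
    have "Cauchy (S x)"
    proof (rule CauchyI)
      fix e :: real assume "e > 0"
      with CauchyD[OF \<open>Cauchy (s x)\<close>, of "e\<^sup>2"]
      obtain M where "\<And>m n. m \<ge> M \<Longrightarrow> n \<ge> M \<Longrightarrow> \<bar>s x m - s x n\<bar> < e\<^sup>2" by auto
      then have "\<And>m n. m \<ge> M \<Longrightarrow> n \<ge> M \<Longrightarrow> norm (S x m - S x n) < e"
        using dist \<open>e > 0\<close> by (metis power_less_imp_less_base less_imp_le)
      then show "\<exists>M. \<forall>m\<ge>M. \<forall>n\<ge>M. norm (S x m - S x n) < e" by blast
    qed
    then obtain l where l: "S x \<longlonglongrightarrow> l" using Cauchy_convergent convergent_def by blast
    have "x - l = 0"
    proof (rule total)
      fix m
      have "inner (C m (x - l)) z = 0" for z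
      proof -
        have "(\<lambda>N. inner (x - S x N) (E m z)) \<longlonglongrightarrow> inner (x - l) (E m z)"
          by (intro tendsto_intros l)
        moreover have "\<forall>\<^sub>F N in sequentially. inner (x - S x N) (E m z) = 0"
          using eventually_gt_at_top[of m]
          by eventually_elim (simp add: inner_diff_left S_left flip: coord)
        ultimately have "inner (x - l) (E m z) = 0"
          by (metis tendsto_eventually LIMSEQ_unique)
        then show ?thesis by (simp add: coord)
      qed
      then show "C m (x - l) = 0" using inner_eq_zero_iff by blast
    qed
    then show ?thesis using l by simp
  qed
  then have "(\<lambda>N. inner x (S y N)) \<longlonglongrightarrow> inner x y"
    by (intro tendsto_intros)
  then show ?thesis by (simp add: sums_def S_right)
qed

section \<open>Orthogonality of trigonometric functions over a time span of length 2\<close>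

lemma has_integral_cos_period:
  "((\<lambda>s. cos (of_int k * pi * s)) has_integral (if k = 0 then 2 else 0)) {0..2}"
proof (cases "k = 0")
  case True
  then show ?thesis using has_integral_const_real[of "1::real" 0 2] by simp
next
  case False
  have "((\<lambda>s. cos (of_int k * pi * s)) has_integral
      sin (of_int k * pi * 2) / (of_int k * pi) - sin (of_int k * pi * 0) / (of_int k * pi)) {0..2}"
    using False by (intro fundamental_theorem_of_calculus)
      (auto intro!: derivative_eq_intros simp flip: has_real_derivative_iff_has_vector_derivative)
  moreover have "sin (of_int k * pi * 2) = 0"
    using sin_int_2pin[of k] by (simp add: mult_ac)
  ultimately show ?thesis using False by simp
qed

lemma has_integral_sin_period:
  "((\<lambda>s. sin (of_int k * pi * s)) has_integral 0) {0..2}"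
proof (cases "k = 0")
  case True
  then show ?thesis by simp
next
  case False
  have "((\<lambda>s. sin (of_int k * pi * s)) has_integral
      - cos (of_int k * pi * 2) / (of_int k * pi) - - cos (of_int k * pi * 0) / (of_int k * pi)) {0..2}"
    using False by (intro fundamental_theorem_of_calculus)
      (auto intro!: derivative_eq_intros simp flip: has_real_derivative_iff_has_vector_derivative)
  moreover have "cos (of_int k * pi * 2) = 1"
    using cos_int_2pin[of k] by (simp add: mult_ac)
  ultimately show ?thesis by simp
qed

lemma has_integral_trig_product_period:
  fixes A B A' B' :: real and m n :: nat
  defines "c \<equiv> \<lambda>k::nat. \<lambda>s. cos (real (Suc k) * pi * s)" and "d \<equiv> \<lambda>k::nat. \<lambda>s. sin (real (Suc k) * pi * s)"
  shows "((\<lambda>s. (A * c m s - B * d m s) * (A' * c n s - B' * d n s)) has_integral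
    (if m = n then A * A' + B * B' else 0)) {0..2}"
proof -
  \<comment> \<open>The summand 2 comes from the shift in \<open>Suc\<close>. It keeps
    \<open>k\<close> positive, so that only the cosine of frequency \<open>j\<close> can have a
    nonzero integral.\<close>
  define j k where "j = int m - int n" and "k = int m + int n + 2"
  have k: "k \<noteq> 0" and j: "j = 0 \<longleftrightarrow> m = n" by (auto simp: j_def k_def)
  have arg: "real (Suc m) * pi * s - real (Suc n) * pi * s = of_int j * pi * s"
    "real (Suc m) * pi * s + real (Suc n) * pi * s = of_int k * pi * s" for s
    by (simp_all add: j_def k_def algebra_simps)
  have e: "(A * c m s - B * d m s) * (A' * c n s - B' * d n s) =
     (A * A' + B * B') / 2 * cos (of_int j * pi * s) + (A * A' - B * B') / 2 * cos (of_int k * pi * s)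
     + (- (A * B' + B * A') / 2) * sin (of_int k * pi * s) + (A * B' - B * A') / 2 * sin (of_int j * pi * s)" for s
    unfolding arg[symmetric] cos_diff cos_add sin_add sin_diff c_def d_def by (simp add: field_simps)
  have "((\<lambda>s. (A * A' + B * B') / 2 * cos (of_int j * pi * s) + (A * A' - B * B') / 2 * cos (of_int k * pi * s)
     + (- (A * B' + B * A') / 2) * sin (of_int k * pi * s) + (A * B' - B * A') / 2 * sin (of_int j * pi * s))
    has_integral (A * A' + B * B') / 2 * (if j = 0 then 2 else 0) + (A * A' - B * B') / 2 * (if k = 0 then 2 else 0)
      + (- (A * B' + B * A') / 2) * 0 + (A * B' - B * A') / 2 * 0) {0..2}"
    by (intro has_integral_add has_integral_mult_right has_integral_cos_period has_integral_sin_period)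
  then show ?thesis unfolding e
    by (rule has_integral_eq_rhs) (simp add: k j)
qed

lemma has_integral_trig_square_real:
  fixes A B :: "nat \<Rightarrow> real"
  shows "((\<lambda>s. (\<Sum>n<K. A n * cos (real (Suc n) * pi * s) - B n * sin (real (Suc n) * pi * s))\<^sup>2)
    has_integral (\<Sum>n<K. (A n)\<^sup>2 + (B n)\<^sup>2)) {0..2}"
proof -
  have "((\<lambda>s. \<Sum>m<K. \<Sum>n<K. (A m * cos (real (Suc m) * pi * s) - B m * sin (real (Suc m) * pi * s)) *
      (A n * cos (real (Suc n) * pi * s) - B n * sin (real (Suc n) * pi * s)))
    has_integral (\<Sum>m<K. \<Sum>n<K. if m = n then A m * A n + B m * B n else 0)) {0..2}"
    by (intro has_integral_sum has_integral_trig_product_period finite_lessThan)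
  then show ?thesis by (simp add: power2_eq_square sum_product)
qed

text \<open>The trigonometric weights are real, so the real and imaginary parts of the sum satisfy
  the real identity separately.\<close>

lemma has_integral_trig_square:
  fixes A B :: "nat \<Rightarrow> complex"
  shows "((\<lambda>s. (cmod (\<Sum>n<K. of_real (cos (real (Suc n) * pi * s)) * A n
      - of_real (sin (real (Suc n) * pi * s)) * B n))\<^sup>2)
    has_integral (\<Sum>n<K. (cmod (A n))\<^sup>2 + (cmod (B n))\<^sup>2)) {0..2}"
  using has_integral_add[OF
    has_integral_trig_square_real[of "\<lambda>n. Re (A n)" "\<lambda>n. Re (B n)" K]
    has_integral_trig_square_real[of "\<lambda>n. Im (A n)" "\<lambda>n. Im (B n)" K]]
  by (simp add: cmod_power2 sum.distrib algebra_simps)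

text \<open>Cauchy-Schwarz against the constant 1, read off from the variance: the integral of
  \<open>(f s - m)\<^sup>2\<close> is nonnegative for the mean \<open>m\<close>.\<close>

lemma square_integral_le:
  fixes f :: "real \<Rightarrow> real"
  assumes "a < b" and f: "continuous_on {a..b} f"
  shows "(integral {a..b} f)\<^sup>2 \<le> (b - a) * integral {a..b} (\<lambda>s. (f s)\<^sup>2)"
proof -
  define m where "m = integral {a..b} f / (b - a)"
  have m: "integral {a..b} f = m * (b - a)" using assms by (simp add: m_def)
  have i: "f integrable_on {a..b}" "(\<lambda>s. (f s)\<^sup>2) integrable_on {a..b}"
    by (auto intro!: integrable_continuous_interval continuous_intros f)
  have "((\<lambda>s. (f s)\<^sup>2 - 2 * m * f s + m\<^sup>2) has_integral
      integral {a..b} (\<lambda>s. (f s)\<^sup>2) - 2 * m * integral {a..b} f + (b - a) * m\<^sup>2) {a..b}"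
    using \<open>a < b\<close> has_integral_const_real[of "m\<^sup>2" a b]
    by (intro has_integral_add has_integral_diff has_integral_mult_right integrable_integral i) auto
  moreover have "(f s)\<^sup>2 - 2 * m * f s + m\<^sup>2 \<ge> 0" for s
    using zero_le_power2[of "f s - m"] by (simp add: power2_eq_square algebra_simps)
  ultimately have "0 \<le> integral {a..b} (\<lambda>s. (f s)\<^sup>2) - 2 * m * integral {a..b} f + (b - a) * m\<^sup>2"
    by (rule has_integral_nonneg)
  then have "m\<^sup>2 * (b - a) \<le> integral {a..b} (\<lambda>s. (f s)\<^sup>2)"
    unfolding m by (simp add: power2_eq_square algebra_simps)
  then have "(b - a) * (m\<^sup>2 * (b - a)) \<le> (b - a) * integral {a..b} (\<lambda>s. (f s)\<^sup>2)"
    using assms by (intro mult_left_mono) auto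
  then show ?thesis unfolding m by (simp add: power2_eq_square algebra_simps)
qed

text \<open>The quantity \<open>a k powr (- \<beta>)\<close> grows at least linearly. With
  \<open>y = \<kappa> * a j powr \<beta>\<close>, one step multiplies it by at least
  \<open>(1 - y) powr (- \<beta>)\<close>, hence by at least \<open>1 + \<beta> * y\<close>, and
  \<open>a j powr (- \<beta>) * (\<beta> * y)\<close> is the constant
  \<open>\<beta> * \<kappa>\<close>.\<close>

lemma polynomial_decay:
  fixes a :: "nat \<Rightarrow> real"
  assumes nonneg: "\<And>k. a k \<ge> 0" and "\<kappa> > 0" "\<beta> > 0"
    and step: "\<And>k. a (Suc k) \<le> a k - \<kappa> * a k powr (1 + \<beta>)"
    and "k \<ge> 1"
  shows "a k \<le> (\<beta> * \<kappa> * real k) powr (- 1 / \<beta>)"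
proof (cases "a k = 0")
  case False
  have dec: "a (Suc j) \<le> a j" for j
    using step[of j] \<open>\<kappa> > 0\<close> by (smt (verit) mult_nonneg_nonneg powr_ge_zero)
  have pos: "a j > 0" if "j \<le> k" for j
  proof -
    have "a k \<le> a j" using lift_Suc_antimono_le[where f = a, OF dec that] .
    then show ?thesis using False nonneg[of k] by linarith
  qed
  have "a j powr (- \<beta>) \<ge> \<beta> * \<kappa> * real j" if "j \<le> k" for j
    using that
  proof (induction j)
    case (Suc j)
    define y where "y = \<kappa> * a j powr \<beta>"
    have p: "a j > 0" "a (Suc j) > 0" using pos Suc by auto
    have s: "a (Suc j) \<le> a j * (1 - y)"
      using step[of j] p by (simp add: y_def powr_add algebra_simps)
    then have "0 < a j * (1 - y)" using p by linarith
    \<comment> \<open>Positivity of the next term, known up to index \<open>k\<close>, forces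
      \<open>y < 1\<close>; otherwise the logarithm below would be meaningless.\<close>
    then have y1: "1 - y > 0" using p by (simp add: zero_less_mult_iff)
    have "ln (1 - y) \<le> - y" using ln_le_minus_one[OF y1] by simp
    then have "\<beta> * y \<le> - \<beta> * ln (1 - y)" using \<open>\<beta> > 0\<close> mult_left_mono[of "ln (1 - y)" "- y" \<beta>] by simp
    then have "1 + \<beta> * y \<le> (1 - y) powr (- \<beta>)"
      using y1 exp_ge_add_one_self[of "- \<beta> * ln (1 - y)"] unfolding powr_def by simp
    then have "a j powr (- \<beta>) * (1 + \<beta> * y) \<le> a j powr (- \<beta>) * (1 - y) powr (- \<beta>)"
      by (intro mult_left_mono) auto
    also have "\<dots> = (a j * (1 - y)) powr (- \<beta>)" using p y1 by (simp add: powr_mult)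
    also have "\<dots> \<le> a (Suc j) powr (- \<beta>)"
      using s p \<open>\<beta> > 0\<close> by (intro powr_mono2') auto
    finally have "a j powr (- \<beta>) * (1 + \<beta> * y) \<le> a (Suc j) powr (- \<beta>)" .
    moreover have "a j powr (- \<beta>) * (1 + \<beta> * y) = a j powr (- \<beta>) + \<beta> * \<kappa>"
      using p by (simp add: y_def powr_minus field_simps)
    moreover have "\<beta> * \<kappa> * real (Suc j) = \<beta> * \<kappa> * real j + \<beta> * \<kappa>"
      by (simp add: algebra_simps)
    ultimately show ?case using Suc by linarith
  qed (use \<open>\<beta> > 0\<close> in simp)
  then have "(a k powr (- \<beta>)) powr (- 1 / \<beta>) \<le> (\<beta> * \<kappa> * real k) powr (- 1 / \<beta>)"
    using assms by (intro powr_mono2') auto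
  then show ?thesis using pos[of k] \<open>\<beta> > 0\<close> by (simp add: powr_powr)
qed simp

section \<open>Systems of oscillators with a common forcing\<close>

text \<open>Indices start at 0, the Dirichlet frequencies at \<open>pi\<close>.\<close>

definition freq :: "nat \<Rightarrow> real" where "freq n = real (Suc n) * pi"

text \<open>The wave equation seen through coordinates: \<open>P n\<close> for the displacement and
  \<open>Q n\<close> for the velocity of mode \<open>n\<close>. One sequence \<open>coef\<close>
  weights the observation and, in \<open>solution\<close>, the forcing, because observation and
  control are adjoint to each other.\<close>

locale modal_system =
  fixes P Q :: "nat \<Rightarrow> 'a::{real_inner, banach} \<Rightarrow> complex"
    and coef :: "nat \<Rightarrow> real" and obs :: "'a \<Rightarrow> complex"
  assumes bounded_linear_P: "\<And>n. bounded_linear (P n)"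
    and bounded_linear_Q: "\<And>n. bounded_linear (Q n)"
    and parseval: "\<And>x. (\<lambda>n. (cmod (P n x))\<^sup>2 + (cmod (Q n x))\<^sup>2) sums (norm x)\<^sup>2"
    and bounded_linear_obs: "bounded_linear obs"
    and obs_sums: "\<And>x. (\<lambda>n. coef n *\<^sub>R Q n x) sums obs x"
    and summable_coef: "summable (\<lambda>n. (coef n)\<^sup>2)"
begin

text \<open>The forcing \<open>f\<close> is a free function of time rather than a feedback. This
  makes the notion linear, so that the difference of two solutions of the nonlinear equation is a
  solution again.\<close>

definition solution :: "(real \<Rightarrow> 'a) \<Rightarrow> (real \<Rightarrow> complex) \<Rightarrow> bool" where
  "solution x f \<longleftrightarrow> continuous_on {0..} x \<and> continuous_on {0..} f \<and>
    (\<forall>n. \<forall>t\<ge>0.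
      ((\<lambda>t. P n (x t)) has_vector_derivative freq n *\<^sub>R Q n (x t)) (at t within {0..}) \<and>
      ((\<lambda>t. Q n (x t)) has_vector_derivative - (freq n *\<^sub>R P n (x t)) - coef n *\<^sub>R f t) (at t within {0..}))"

lemma solutionI:
  assumes "continuous_on {0..} x" "continuous_on {0..} f"
    and "\<And>n t. t \<ge> 0 \<Longrightarrow>
      ((\<lambda>t. P n (x t)) has_vector_derivative freq n *\<^sub>R Q n (x t)) (at t within {0..})"
    and "\<And>n t. t \<ge> 0 \<Longrightarrow> ((\<lambda>t. Q n (x t)) has_vector_derivative
      - (freq n *\<^sub>R P n (x t)) - coef n *\<^sub>R f t) (at t within {0..})"
  shows "solution x f"
  using assms by (simp add: solution_def)

lemma solutionD:
  assumes "solution x f" "t \<ge> 0" "S \<subseteq> {0..}"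
  shows "((\<lambda>t. P n (x t)) has_vector_derivative freq n *\<^sub>R Q n (x t)) (at t within S)"
    and "((\<lambda>t. Q n (x t)) has_vector_derivative
      - (freq n *\<^sub>R P n (x t)) - coef n *\<^sub>R f t) (at t within S)"
  by (rule has_vector_derivative_within_subset[OF _ assms(3)];
      use assms(1,2) in \<open>simp add: solution_def\<close>)+

lemma solution_continuous:
  assumes "solution x f" "S \<subseteq> {0..}"
  shows "continuous_on S x" "continuous_on S f"
  using assms continuous_on_subset by (auto simp: solution_def)

definition coef_norm2 :: real where "coef_norm2 = (\<Sum>n. (coef n)\<^sup>2)"

definition mode :: "nat \<Rightarrow> 'a \<Rightarrow> real" where
  "mode n x = (cmod (P n x))\<^sup>2 + (cmod (Q n x))\<^sup>2"

definition weak_energy :: "'a \<Rightarrow> real" where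
  "weak_energy x = (\<Sum>n. (coef n)\<^sup>2 * mode n x)"

lemmas P_diff = linear_diff[OF bounded_linear.linear[OF bounded_linear_P]]
lemmas Q_diff = linear_diff[OF bounded_linear.linear[OF bounded_linear_Q]]
lemmas obs_diff = linear_diff[OF bounded_linear.linear[OF bounded_linear_obs]]

lemma mode_sums: "(\<lambda>n. mode n x) sums (norm x)\<^sup>2"
  using parseval by (simp add: mode_def)

lemma mode_nonneg: "mode n x \<ge> 0"
  by (simp add: mode_def)

lemma sum_mode_le: "(\<Sum>n<K. mode n x) \<le> (norm x)\<^sup>2"
  using sum_le_suminf[OF sums_summable[OF mode_sums[of x]], of "{..<K}"] mode_nonneg
    sums_unique[OF mode_sums[of x]] by auto

lemma sum_coef_le: "(\<Sum>n<K. (coef n)\<^sup>2) \<le> coef_norm2"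
  using sum_le_suminf[OF summable_coef, of "{..<K}"] by (simp add: coef_norm2_def)

lemma coef_norm2_nonneg: "coef_norm2 \<ge> 0"
  using sum_coef_le[of 0] by simp

lemma coef_le: "(coef n)\<^sup>2 \<le> coef_norm2"
  using sum_le_suminf[OF summable_coef, of "{n}"] by (simp add: coef_norm2_def)

lemma summable_weak_energy: "summable (\<lambda>n. (coef n)\<^sup>2 * mode n x)"
proof (rule summable_comparison_test')
  show "summable (\<lambda>n. coef_norm2 * mode n x)"
    by (intro summable_mult sums_summable[OF mode_sums])
  show "norm ((coef n)\<^sup>2 * mode n x) \<le> coef_norm2 * mode n x" for n
    using coef_le[of n] mode_nonneg[of n x] by (simp add: abs_mult mult_right_mono)
qed

text \<open>Cauchy-Schwarz in the mode index. The point is uniformity in \<open>K\<close>: it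
  supplies the dominating functions when \<open>K\<close> tends to infinity under time
  integrals.\<close>

lemma partial_obs_le:
  "cmod (\<Sum>n<K. coef n *\<^sub>R Q n x) \<le> sqrt coef_norm2 * norm x"
proof -
  have "cmod (\<Sum>n<K. coef n *\<^sub>R Q n x) \<le> (\<Sum>n<K. \<bar>coef n\<bar> * cmod (Q n x))"
    by (rule order_trans[OF norm_sum]) simp
  also have "\<dots> = (\<Sum>n<K. \<bar>coef n\<bar> * \<bar>cmod (Q n x)\<bar>)" by simp
  also have "\<dots> \<le> L2_set coef {..<K} * L2_set (\<lambda>n. cmod (Q n x)) {..<K}"
    by (rule L2_set_mult_ineq)
  also have "\<dots> \<le> sqrt coef_norm2 * norm x"
  proof (intro mult_mono)
    show "L2_set coef {..<K} \<le> sqrt coef_norm2"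
      unfolding L2_set_def using sum_coef_le by simp
    have "(\<Sum>n<K. (cmod (Q n x))\<^sup>2) \<le> (\<Sum>n<K. mode n x)"
      by (intro sum_mono) (simp add: mode_def)
    then show "L2_set (\<lambda>n. cmod (Q n x)) {..<K} \<le> norm x"
      unfolding L2_set_def using sum_mode_le[where x = x and K = K] by (intro real_le_lsqrt) (auto simp: sum_nonneg)
  qed (auto simp: coef_norm2_nonneg L2_set_nonneg)
  finally show ?thesis .
qed

lemma obs_le: "cmod (obs x) \<le> sqrt coef_norm2 * norm x"
  by (rule LIMSEQ_le_const2[OF tendsto_norm[OF obs_sums[unfolded sums_def, of x]]])
     (use partial_obs_le in blast)

lemma solution_shift:
  assumes "solution x f" "h \<ge> 0"
  shows "solution (\<lambda>t. x (t + h)) (\<lambda>t. f (t + h))"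
proof -
  have sh: "((\<lambda>t. g (t + h)) has_vector_derivative d (t + h)) (at t within {0..})"
    if "\<And>t. t \<ge> 0 \<Longrightarrow> (g has_vector_derivative d t) (at t within {0..})" "t \<ge> 0"
    for g :: "real \<Rightarrow> complex" and d t
  proof -
    have "(g has_vector_derivative d (t + h)) (at (t + h) within {0..})"
      using that \<open>h \<ge> 0\<close> by simp
    then have "(g has_vector_derivative d (t + h)) (at (t + h) within (\<lambda>t. t + h) ` {0..})"
      by (rule has_vector_derivative_within_subset) (use \<open>h \<ge> 0\<close> in auto)
    moreover have "((\<lambda>t. t + h) has_vector_derivative 1) (at t within {0..})"
      by (auto intro!: derivative_eq_intros simp flip: has_real_derivative_iff_has_vector_derivative)
    ultimately show ?thesis
      using vector_diff_chain_within[of "\<lambda>t. t + h" 1 t "{0..}" g] by (simp add: o_def)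
  qed
  have c: "continuous_on {0..} (\<lambda>t. g (t + h))" if "continuous_on {0..} g"
    for g :: "real \<Rightarrow> 'z::topological_space"
    by (rule continuous_on_compose2[OF that]) (use \<open>h \<ge> 0\<close> in \<open>auto intro!: continuous_intros\<close>)
  show ?thesis
    by (intro solutionI c solution_continuous[OF assms(1)] order_refl
        sh[where g = "\<lambda>t. P n (x t)" and d = "\<lambda>t. freq n *\<^sub>R Q n (x t)" for n]
        sh[where g = "\<lambda>t. Q n (x t)" and d = "\<lambda>t. - (freq n *\<^sub>R P n (x t)) - coef n *\<^sub>R f t" for n]
        solutionD[OF assms(1)])
qed

lemma solution_diff:
  assumes "solution x f" "solution y g"
  shows "solution (\<lambda>t. x t - y t) (\<lambda>t. f t - g t)"
proof (rule solutionI)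
  show "continuous_on {0..} (\<lambda>t. x t - y t)" "continuous_on {0..} (\<lambda>t. f t - g t)"
    by (intro continuous_intros solution_continuous[OF assms(1)] solution_continuous[OF assms(2)] order_refl)+
  fix n and t :: real assume "t \<ge> 0"
  note d = has_vector_derivative_diff[OF
      solutionD(1)[OF assms(1) this order_refl] solutionD(1)[OF assms(2) this order_refl]]
    has_vector_derivative_diff[OF
      solutionD(2)[OF assms(1) this order_refl] solutionD(2)[OF assms(2) this order_refl]]
  show "((\<lambda>t. P n (x t - y t)) has_vector_derivative freq n *\<^sub>R Q n (x t - y t)) (at t within {0..})"
    "((\<lambda>t. Q n (x t - y t)) has_vector_derivative
      - (freq n *\<^sub>R P n (x t - y t)) - coef n *\<^sub>R (f t - g t)) (at t within {0..})"
    using d by (simp_all add: P_diff Q_diff algebra_simps)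
qed

lemma continuous_on_obs: "continuous_on S x \<Longrightarrow> continuous_on S (\<lambda>t. obs (x t))"
  by (rule bounded_linear.continuous_on[OF bounded_linear_obs])

lemma continuous_on_Q: "continuous_on S x \<Longrightarrow> continuous_on S (\<lambda>t. Q n (x t))"
  by (rule bounded_linear.continuous_on[OF bounded_linear_Q])

text \<open>In the derivative of \<open>mode n (x r)\<close> the two terms with
  \<open>freq n\<close> cancel and only the forcing remains. The identity is integrated mode by
  mode, since \<open>x\<close> itself may not be differentiable, and dominated convergence then lets
  the number of modes grow.\<close>

lemma energy_identity:
  assumes sol: "solution x f" and st: "0 \<le> s" "s \<le> t"
  shows "((\<lambda>r. 2 * inner (obs (x r)) (f r)) has_integral (norm (x s))\<^sup>2 - (norm (x t))\<^sup>2) {s..t}"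
proof -
  have cx: "continuous_on {s..t} x" and cf: "continuous_on {s..t} f"
    by (rule solution_continuous[OF sol]; use st in auto)+
  define w where "w K r = (\<Sum>n<K. coef n *\<^sub>R Q n (x r))" for K r
  have mode: "((\<lambda>r. - 2 * inner (coef n *\<^sub>R Q n (x r)) (f r)) has_integral mode n (x t) - mode n (x s)) {s..t}" for n
  proof (rule fundamental_theorem_of_calculus[OF st(2)])
    fix r assume r: "r \<in> {s..t}"
    have d: "((\<lambda>t. P n (x t)) has_vector_derivative freq n *\<^sub>R Q n (x r)) (at r within {s..t})"
      "((\<lambda>t. Q n (x t)) has_vector_derivative - (freq n *\<^sub>R P n (x r)) - coef n *\<^sub>R f r) (at r within {s..t})"
      by (rule solutionD[OF sol]; use st r in auto)+
    show "((\<lambda>r. mode n (x r)) has_vector_derivative - 2 * inner (coef n *\<^sub>R Q n (x r)) (f r)) (at r within {s..t})"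
      unfolding mode_def power2_norm_eq_inner
      by (rule has_vector_derivative_eq_rhs[OF has_vector_derivative_add[OF
            bounded_bilinear.has_vector_derivative[OF bounded_bilinear_inner d(1) d(1)]
            bounded_bilinear.has_vector_derivative[OF bounded_bilinear_inner d(2) d(2)]]])
         (simp add: inner_diff_left inner_diff_right inner_commute algebra_simps)
  qed
  have "((\<lambda>r. \<Sum>n<K. - 2 * inner (coef n *\<^sub>R Q n (x r)) (f r)) has_integral
      (\<Sum>n<K. mode n (x t) - mode n (x s))) {s..t}" for K
    by (intro has_integral_sum mode) auto
  then have "((\<lambda>r. - 1 * (\<Sum>n<K. - 2 * inner (coef n *\<^sub>R Q n (x r)) (f r))) has_integral
      - 1 * (\<Sum>n<K. mode n (x t) - mode n (x s))) {s..t}" for K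
    by (intro has_integral_mult_right)
  then have part: "((\<lambda>r. 2 * inner (w K r) (f r)) has_integral
      (\<Sum>n<K. mode n (x s)) - (\<Sum>n<K. mode n (x t))) {s..t}" for K
    by (simp add: w_def inner_sum_left sum_distrib_left sum_negf sum_subtractf mult.assoc)
  have "(\<lambda>r. 2 * inner (w K r) (f r)) integrable_on {s..t}" for K
    using part by blast
  moreover have "(\<lambda>r. 2 * (sqrt coef_norm2 * norm (x r) * norm (f r))) integrable_on {s..t}"
    by (intro integrable_continuous_interval continuous_intros cx cf)
  moreover have "norm (2 * inner (w K r) (f r)) \<le> 2 * (sqrt coef_norm2 * norm (x r) * norm (f r))" for K r
    using order_trans[OF Cauchy_Schwarz_ineq2[of "w K r" "f r"]
        mult_right_mono[OF partial_obs_le[where K = K and x = "x r", folded w_def] norm_ge_zero]]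
    by (simp add: abs_mult)
  moreover have "(\<lambda>K. 2 * inner (w K r) (f r)) \<longlonglongrightarrow> 2 * inner (obs (x r)) (f r)" for r
    unfolding w_def by (intro tendsto_intros obs_sums[unfolded sums_def])
  ultimately have dc: "(\<lambda>r. 2 * inner (obs (x r)) (f r)) integrable_on {s..t}"
    "(\<lambda>K. integral {s..t} (\<lambda>r. 2 * inner (w K r) (f r))) \<longlonglongrightarrow> integral {s..t} (\<lambda>r. 2 * inner (obs (x r)) (f r))"
    using dominated_convergence[of "\<lambda>K r. 2 * inner (w K r) (f r)" "{s..t}"
      "\<lambda>r. 2 * (sqrt coef_norm2 * norm (x r) * norm (f r))" "\<lambda>r. 2 * inner (obs (x r)) (f r)"] by blast+
  have "(\<lambda>K. (\<Sum>n<K. mode n (x s)) - (\<Sum>n<K. mode n (x t))) \<longlonglongrightarrow> (norm (x s))\<^sup>2 - (norm (x t))\<^sup>2"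
    by (intro tendsto_intros mode_sums[unfolded sums_def])
  with dc(2) have "integral {s..t} (\<lambda>r. 2 * inner (obs (x r)) (f r)) = (norm (x s))\<^sup>2 - (norm (x t))\<^sup>2"
    unfolding integral_unique[OF part] by (rule LIMSEQ_unique)
  then show ?thesis using dc(1) by (simp add: has_integral_iff)
qed

text \<open>\<open>g r\<close> carries the state at time \<open>r\<close> freely to time
  \<open>s\<close>. Its derivative in \<open>r\<close> contains the forcing alone, so integrating it
  compares the true velocity coordinate with the free one. Enlarging the range of integration to
  \<open>T\<close> makes the bound uniform in \<open>s\<close>.\<close>

lemma duhamel_le:
  assumes sol: "solution x f" and s: "0 \<le> s" "s \<le> T"
  shows "cmod (Q n (x s) - (cos (freq n * s) *\<^sub>R Q n (x 0) - sin (freq n * s) *\<^sub>R P n (x 0)))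
    \<le> \<bar>coef n\<bar> * integral {0..T} (\<lambda>r. cmod (f r))"
proof -
  have cf: "continuous_on {0..T} f"
    by (rule solution_continuous[OF sol]; use s in auto)+
  then have cf': "continuous_on {0..s} f" using s by (auto elim!: continuous_on_subset)
  define g where "g r = cos (freq n * (s - r)) *\<^sub>R Q n (x r) - sin (freq n * (s - r)) *\<^sub>R P n (x r)" for r
  have "((\<lambda>r. - coef n *\<^sub>R cos (freq n * (s - r)) *\<^sub>R f r) has_integral g s - g 0) {0..s}"
  proof (rule fundamental_theorem_of_calculus[OF s(1)])
    fix r assume r: "r \<in> {0..s}"
    have d: "((\<lambda>t. P n (x t)) has_vector_derivative freq n *\<^sub>R Q n (x r)) (at r within {0..s})"
      "((\<lambda>t. Q n (x t)) has_vector_derivative - (freq n *\<^sub>R P n (x r)) - coef n *\<^sub>R f r) (at r within {0..s})"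
      by (rule solutionD[OF sol]; use s r in auto)+
    have c: "((\<lambda>r. cos (freq n * (s - r))) has_real_derivative freq n * sin (freq n * (s - r))) (at r within {0..s})"
      "((\<lambda>r. sin (freq n * (s - r))) has_real_derivative - (freq n * cos (freq n * (s - r)))) (at r within {0..s})"
      by (auto intro!: derivative_eq_intros)
    show "(g has_vector_derivative - coef n *\<^sub>R cos (freq n * (s - r)) *\<^sub>R f r) (at r within {0..s})"
      unfolding g_def
      by (rule has_vector_derivative_eq_rhs[OF has_vector_derivative_diff[OF
            has_vector_derivative_scaleR[OF c(1) d(2)] has_vector_derivative_scaleR[OF c(2) d(1)]]])
         (simp add: scaleR_diff_right algebra_simps)
  qed
  then have eq: "integral {0..s} (\<lambda>r. - coef n *\<^sub>R cos (freq n * (s - r)) *\<^sub>R f r) = g s - g 0"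
    by (rule integral_unique)
  have "norm (g s - g 0) \<le> integral {0..s} (\<lambda>r. \<bar>coef n\<bar> * cmod (f r))"
    unfolding eq[symmetric]
  proof (rule integral_norm_bound_integral)
    show "(\<lambda>r. - coef n *\<^sub>R cos (freq n * (s - r)) *\<^sub>R f r) integrable_on {0..s}"
      "(\<lambda>r. \<bar>coef n\<bar> * cmod (f r)) integrable_on {0..s}"
      by (intro integrable_continuous_interval continuous_intros cf')+
    show "cmod (- coef n *\<^sub>R cos (freq n * (s - r)) *\<^sub>R f r) \<le> \<bar>coef n\<bar> * cmod (f r)" for r
      using mult_right_mono[OF abs_cos_le_one norm_ge_zero, of "freq n * (s - r)" "f r"]
      by (simp add: abs_mult mult_left_mono mult.assoc)
  qed
  also have "\<dots> \<le> integral {0..T} (\<lambda>r. \<bar>coef n\<bar> * cmod (f r))"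
    using s by (intro integral_subset_le integrable_continuous_interval continuous_intros cf cf') auto
  also have "\<dots> = \<bar>coef n\<bar> * integral {0..T} (\<lambda>r. cmod (f r))" by simp
  finally show ?thesis by (simp add: g_def)
qed

(* The free evolution observed over the period 2 is a trigonometric series in time,
   so its mean square is exactly the weak energy. *)
lemma observability:
  assumes sol: "solution x f"
  shows "weak_energy (x 0) \<le> 2 * integral {0..2} (\<lambda>r. (cmod (obs (x r)))\<^sup>2)
    + 8 * coef_norm2\<^sup>2 * integral {0..2} (\<lambda>r. (cmod (f r))\<^sup>2)"
proof -
  have cx: "continuous_on {0..2} x" and cf: "continuous_on {0..2} f"
    by (rule solution_continuous[OF sol]; auto)+
  define w where "w K r = (\<Sum>n<K. coef n *\<^sub>R Q n (x r))" for K r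
  define a where "a = integral {0..2} (\<lambda>r. cmod (f r))"
  have a2: "a\<^sup>2 \<le> 2 * integral {0..2} (\<lambda>r. (cmod (f r))\<^sup>2)"
    using square_integral_le[of 0 2 "\<lambda>r. cmod (f r)"] by (simp add: a_def continuous_intros cf)
  have a0: "a \<ge> 0" unfolding a_def
    by (intro integral_nonneg integrable_continuous_interval continuous_intros cf) simp
  \<comment> \<open>The free evolution from \<open>x 0\<close>, observed through the first
    \<open>K\<close> modes.\<close>
  define g where "g K s = (\<Sum>n<K. of_real (cos (freq n * s)) * (coef n *\<^sub>R Q n (x 0))
      - of_real (sin (freq n * s)) * (coef n *\<^sub>R P n (x 0)))" for K s
  \<comment> \<open>Each coefficient occurs twice, once where the forcing enters the mode and once
    where the mode is observed. The errors thus add up to a sum of squares of coefficients, bounded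
    independently of \<open>K\<close>.\<close>
  have gw: "cmod (w K s - g K s) \<le> coef_norm2 * a" if "s \<in> {0..2}" for K s
  proof -
    have "w K s - g K s = (\<Sum>n<K. coef n *\<^sub>R (Q n (x s) -
        (cos (freq n * s) *\<^sub>R Q n (x 0) - sin (freq n * s) *\<^sub>R P n (x 0))))"
      by (simp add: w_def g_def sum_subtractf[symmetric] scaleR_conv_of_real algebra_simps)
    also have "cmod \<dots> \<le> (\<Sum>n<K. \<bar>coef n\<bar> * (\<bar>coef n\<bar> * a))"
      using that duhamel_le[OF sol, of s 2] unfolding a_def
      by (intro order_trans[OF norm_sum] sum_mono) (simp add: mult_left_mono)
    also have "\<dots> = (\<Sum>n<K. (coef n)\<^sup>2) * a"
      by (simp add: sum_distrib_right power2_eq_square mult.assoc[symmetric])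
    also have "\<dots> \<le> coef_norm2 * a" using a0 by (intro mult_right_mono sum_coef_le)
    finally show ?thesis .
  qed
  have gi: "((\<lambda>s. (cmod (g K s))\<^sup>2) has_integral (\<Sum>n<K. (coef n)\<^sup>2 * mode n (x 0))) {0..2}" for K
    using has_integral_trig_square[of "\<lambda>n. coef n *\<^sub>R Q n (x 0)" "\<lambda>n. coef n *\<^sub>R P n (x 0)" K]
    by (simp add: g_def mode_def power_mult_distrib algebra_simps freq_def)
  have wi: "(\<lambda>s. (cmod (w K s))\<^sup>2) integrable_on {0..2}" for K
    unfolding w_def by (intro integrable_continuous_interval continuous_intros continuous_on_Q cx)
  \<comment> \<open>In the factor 4, one 2 comes from the square of a sum and one is the length of
    the time span; the bound \<open>a2\<close> later turns it into 8.\<close>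
  have part: "(\<Sum>n<K. (coef n)\<^sup>2 * mode n (x 0)) \<le>
      2 * integral {0..2} (\<lambda>s. (cmod (w K s))\<^sup>2) + 4 * coef_norm2\<^sup>2 * a\<^sup>2" for K
  proof -
    have "((\<lambda>s. 2 * (cmod (w K s))\<^sup>2 + 2 * (coef_norm2 * a)\<^sup>2) has_integral
       2 * integral {0..2} (\<lambda>s. (cmod (w K s))\<^sup>2) + 2 * (2 * (coef_norm2 * a)\<^sup>2)) {0..2}"
      using has_integral_const_real[of "(coef_norm2 * a)\<^sup>2" 0 2]
      by (intro has_integral_add has_integral_mult_right integrable_integral wi) auto
    then have "(\<Sum>n<K. (coef n)\<^sup>2 * mode n (x 0)) \<le>
       2 * integral {0..2} (\<lambda>s. (cmod (w K s))\<^sup>2) + 2 * (2 * (coef_norm2 * a)\<^sup>2)"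
    proof (rule has_integral_le[OF gi])
      fix s :: real assume s: "s \<in> {0..2}"
      have "cmod (g K s) \<le> cmod (w K s) + coef_norm2 * a"
        using gw[OF s, of K] norm_triangle_sub[of "g K s" "w K s"] by (simp add: norm_minus_commute)
      then have "(cmod (g K s))\<^sup>2 \<le> (cmod (w K s) + coef_norm2 * a)\<^sup>2" by (intro power_mono) auto
      also have "\<dots> \<le> 2 * (cmod (w K s))\<^sup>2 + 2 * (coef_norm2 * a)\<^sup>2"
        using sum_squares_bound[of "cmod (w K s)" "coef_norm2 * a"] by (simp add: power2_sum)
      finally show "(cmod (g K s))\<^sup>2 \<le> 2 * (cmod (w K s))\<^sup>2 + 2 * (coef_norm2 * a)\<^sup>2" .
    qed
    then show ?thesis by (simp add: power_mult_distrib)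
  qed
  have "(\<lambda>K. integral {0..2} (\<lambda>s. (cmod (w K s))\<^sup>2)) \<longlonglongrightarrow> integral {0..2} (\<lambda>s. (cmod (obs (x s)))\<^sup>2)"
  proof (rule dominated_convergence(2)[OF wi])
    show "(\<lambda>s. (sqrt coef_norm2 * norm (x s))\<^sup>2) integrable_on {0..2}"
      by (intro integrable_continuous_interval continuous_intros cx)
    show "norm ((cmod (w K s))\<^sup>2) \<le> (sqrt coef_norm2 * norm (x s))\<^sup>2" for K s
      using power_mono[OF partial_obs_le[where K = K and x = "x s"] norm_ge_zero, of 2] by (simp add: w_def)
    show "(\<lambda>K. (cmod (w K s))\<^sup>2) \<longlonglongrightarrow> (cmod (obs (x s)))\<^sup>2" for s
      unfolding w_def by (intro tendsto_intros obs_sums[unfolded sums_def])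
  qed
  then have "(\<lambda>K. 2 * integral {0..2} (\<lambda>s. (cmod (w K s))\<^sup>2) + 4 * coef_norm2\<^sup>2 * a\<^sup>2) \<longlonglongrightarrow>
      2 * integral {0..2} (\<lambda>s. (cmod (obs (x s)))\<^sup>2) + 4 * coef_norm2\<^sup>2 * a\<^sup>2"
    by (intro tendsto_intros)
  moreover have "(\<lambda>K. \<Sum>n<K. (coef n)\<^sup>2 * mode n (x 0)) \<longlonglongrightarrow> weak_energy (x 0)"
    unfolding weak_energy_def by (rule summable_LIMSEQ[OF summable_weak_energy])
  ultimately have "weak_energy (x 0) \<le>
      2 * integral {0..2} (\<lambda>s. (cmod (obs (x s)))\<^sup>2) + 4 * coef_norm2\<^sup>2 * a\<^sup>2"
    using part by (intro LIMSEQ_le) auto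
  also have "4 * coef_norm2\<^sup>2 * a\<^sup>2 \<le> 4 * coef_norm2\<^sup>2 * (2 * integral {0..2} (\<lambda>r. (cmod (f r))\<^sup>2))"
    using a2 by (intro mult_left_mono) auto
  finally show ?thesis by simp
qed

end

section \<open>Nonlinear damping\<close>

locale damped_system = modal_system +
  fixes \<phi> :: "complex \<Rightarrow> complex" and \<beta> \<gamma> \<delta> c :: real
  assumes \<beta>: "\<beta> > 0" and \<gamma>: "\<gamma> > 0"
    and coef_ge: "\<And>n. \<bar>coef n\<bar> \<ge> \<gamma> * real (Suc n) powr (- \<beta>)"
    and monotone: "\<And>u v. inner (\<phi> u - \<phi> v) (u - v) \<ge> 0"
    and lipschitz: "\<And>u. \<exists>r>0. \<exists>L. L-lipschitz_on (ball u r) \<phi>"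
    and \<delta>: "\<delta> > 0" and c: "c > 0"
    and coercive_small: "\<And>u. norm u \<le> \<delta> \<Longrightarrow> inner (\<phi> u) u \<ge> c * (norm u)\<^sup>2"
    and coercive_large: "\<And>u. norm u > \<delta> \<Longrightarrow> inner (\<phi> u) u \<ge> c"
begin

lemma continuous_on_\<phi>: "continuous_on S \<phi>"
proof -
  have "isCont \<phi> u" for u
  proof -
    obtain r L where r: "r > 0" and L: "L-lipschitz_on (ball u r) \<phi>" using lipschitz by blast
    then show ?thesis
      using lipschitz_on_continuous_on[OF L] continuous_on_eq_continuous_at[of "ball u r" \<phi>] by simp
  qed
  then show ?thesis by (simp add: continuous_at_imp_continuous_on)
qed

text \<open>At the origin coercivity is only the trivial inequality between zeros. It is used at the
  points \<open>- (s *\<^sub>R k)\<close> with \<open>k = \<phi> 0\<close> and small positive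
  \<open>s\<close>: after division by \<open>s\<close> it says that the inner product of the value
  there with \<open>k\<close> is at most 0, and \<open>s\<close> tending to 0 gives that the squared
  norm of \<open>k\<close> is at most 0.\<close>

lemma \<phi>_0: "\<phi> 0 = 0"
proof -
  define k where "k = \<phi> 0"
  have "((\<lambda>s::real. inner (\<phi> (- (s *\<^sub>R k))) k) \<longlongrightarrow> inner (\<phi> (- (0 *\<^sub>R k))) k) (at_right 0)"
    by (intro tendsto_intros continuous_on_tendsto_compose[OF continuous_on_\<phi>[of UNIV]]) auto
  moreover have "\<forall>\<^sub>F s in at_right 0. inner (\<phi> (- (s *\<^sub>R k))) k \<le> 0"
  proof -
    have "\<delta> / (norm k + 1) > 0" using \<delta> by (simp add: add_nonneg_pos)
    then have "\<forall>\<^sub>F s in at_right 0. s < \<delta> / (norm k + 1) \<and> s > (0::real)"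
      using eventually_at_right_field by (auto simp: eventually_conj_iff)
    then show ?thesis
    proof eventually_elim
      case (elim s)
      then have "s * (norm k + 1) < \<delta>" by (simp add: pos_less_divide_eq add_nonneg_pos)
      moreover have "s * norm k \<le> s * (norm k + 1)" using elim by simp
      moreover have "norm (- (s *\<^sub>R k)) = s * norm k" using elim by simp
      ultimately have "norm (- (s *\<^sub>R k)) \<le> \<delta>" by linarith
      then have "0 \<le> inner (\<phi> (- (s *\<^sub>R k))) (- (s *\<^sub>R k))"
        using coercive_small c by (smt (verit) mult_nonneg_nonneg zero_le_power2)
      then show ?case using elim by (simp add: mult_le_0_iff)
    qed
  qed
  ultimately have "inner (\<phi> (- (0 *\<^sub>R k))) k \<le> 0"
    by (intro tendsto_upperbound) auto
  then have "inner k k \<le> 0" by (simp flip: k_def)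
  then have "inner k k = 0" using inner_ge_zero[of k] by linarith
  then show ?thesis by (simp add: k_def)
qed

text \<open>On bounded sets \<open>\<phi>\<close> behaves like a linear damping. Near the origin the
  upper bound is the Lipschitz estimate; at distance at least \<open>r\<close> any bound
  \<open>F\<close> for the values is at most \<open>F / r\<close> times
  \<open>norm u\<close>.\<close>

lemma \<phi>_bounds:
  obtains L k where "L \<ge> 0" "k > 0"
    "\<And>u. norm u \<le> R \<Longrightarrow> norm (\<phi> u) \<le> L * norm u"
    "\<And>u. norm u \<le> R \<Longrightarrow> k * (norm u)\<^sup>2 \<le> inner (\<phi> u) u"
proof -
  obtain r L where r: "r > 0" and L: "L-lipschitz_on (ball 0 r) \<phi>" using lipschitz by blast
  have "bounded (\<phi> ` cball 0 R)"
    by (intro compact_imp_bounded compact_continuous_image continuous_on_\<phi>) simp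
  then obtain F where F: "F > 0" "\<And>u. norm u \<le> R \<Longrightarrow> norm (\<phi> u) \<le> F"
    unfolding bounded_pos by (metis image_eqI mem_cball_0)
  have "norm (\<phi> u) \<le> (\<bar>L\<bar> + F / r) * norm u" if "norm u \<le> R" for u
  proof (cases "norm u < r")
    case True
    then have "norm (\<phi> u) \<le> L * norm u"
      using lipschitz_onD[OF L, of u 0] r by (simp add: \<phi>_0 dist_norm)
    also have "\<dots> \<le> (\<bar>L\<bar> + F / r) * norm u"
      using F r by (intro mult_right_mono) (auto intro: add_increasing2)
    finally show ?thesis .
  next
    case False
    have "norm (\<phi> u) \<le> F * 1" using F that by simp
    also have "\<dots> \<le> F * (norm u / r)" using False F r by (intro mult_left_mono) auto
    also have "\<dots> \<le> (\<bar>L\<bar> + F / r) * norm u" by (simp add: distrib_right)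
    finally show ?thesis .
  qed
  \<comment> \<open>The denominator is at least 1, which serves small \<open>u\<close>, and at least
    \<open>(norm u)\<^sup>2\<close>, which serves large \<open>u\<close>.\<close>
  moreover have "c / (1 + R\<^sup>2) * (norm u)\<^sup>2 \<le> inner (\<phi> u) u" if "norm u \<le> R" for u
  proof -
    have R: "1 + R\<^sup>2 > 0" by (simp add: add_pos_nonneg)
    have u: "(norm u)\<^sup>2 \<le> R\<^sup>2" using that by (intro power_mono) auto
    show ?thesis
    proof (cases "norm u \<le> \<delta>")
      case True
      have "c / (1 + R\<^sup>2) \<le> c" using c R by (simp add: divide_le_eq mult_left_le_one_le)
      then have "c / (1 + R\<^sup>2) * (norm u)\<^sup>2 \<le> c * (norm u)\<^sup>2" by (intro mult_right_mono) auto
      then show ?thesis using coercive_small[OF True] by linarith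
    next
      case False
      have "c / (1 + R\<^sup>2) * (norm u)\<^sup>2 \<le> c / (1 + R\<^sup>2) * (1 + R\<^sup>2)"
        using u c R by (intro mult_left_mono) auto
      then show ?thesis using coercive_large[of u] False R by simp
    qed
  qed
  moreover have "c / (1 + R\<^sup>2) > 0" using c by (simp add: add_pos_nonneg)
  ultimately show ?thesis using that[of "\<bar>L\<bar> + F / r" "c / (1 + R\<^sup>2)"] F r by simp
qed

section \<open>Solutions of the closed loop: contraction and loss of energy\<close>

definition trajectory :: "(real \<Rightarrow> 'a) \<Rightarrow> bool" where
  "trajectory x \<longleftrightarrow> solution x (\<lambda>t. \<phi> (obs (x t)))"

lemma trajectory_shift: "trajectory x \<Longrightarrow> h \<ge> 0 \<Longrightarrow> trajectory (\<lambda>t. x (t + h))"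
  unfolding trajectory_def by (rule solution_shift)

text \<open>The difference solves the linear modal system with the difference of the two feedbacks
  as forcing. In its energy identity the integrand is nonnegative, which is monotonicity of
  \<open>\<phi>\<close>.\<close>

lemma trajectory_contraction:
  assumes "trajectory x" "trajectory y" "0 \<le> s" "s \<le> t"
  shows "norm (x t - y t) \<le> norm (x s - y s)"
proof -
  have "((\<lambda>r. 2 * inner (obs (x r - y r)) (\<phi> (obs (x r)) - \<phi> (obs (y r)))) has_integral
      (norm (x s - y s))\<^sup>2 - (norm (x t - y t))\<^sup>2) {s..t}"
    using assms unfolding trajectory_def by (intro energy_identity solution_diff)
  then have "0 \<le> (norm (x s - y s))\<^sup>2 - (norm (x t - y t))\<^sup>2"
    by (rule has_integral_nonneg) (use monotone in \<open>simp add: obs_diff inner_commute\<close>)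
  then have "(norm (x t - y t))\<^sup>2 \<le> (norm (x s - y s))\<^sup>2" by simp
  then show ?thesis by (rule power2_le_imp_le) simp
qed

lemma trajectory_zero: "trajectory (\<lambda>_. 0)"
  unfolding trajectory_def
  by (intro solutionI)
     (simp_all add: \<phi>_0 linear_0[OF bounded_linear.linear[OF bounded_linear_P]]
       linear_0[OF bounded_linear.linear[OF bounded_linear_Q]]
       linear_0[OF bounded_linear.linear[OF bounded_linear_obs]])

lemma trajectory_norm_antimono:
  assumes "trajectory x" "0 \<le> s" "s \<le> t"
  shows "norm (x t) \<le> norm (x s)"
  using trajectory_contraction[OF assms(1) trajectory_zero assms(2,3)] by simp

lemma trajectory_increment:
  assumes "trajectory x" "t \<ge> 0" "h \<ge> 0"
  shows "norm (x (t + h) - x t) \<le> norm (x h - x 0)"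
  using trajectory_contraction[OF trajectory_shift[OF assms(1,3)] assms(1), of 0 t] assms by simp

lemma trajectory_weak_energy:
  assumes x: "trajectory x"
  obtains \<kappa> where "\<kappa> > 0" "\<And>t. t \<ge> 0 \<Longrightarrow>
    weak_energy (x t) \<le> \<kappa> * ((norm (x t))\<^sup>2 - (norm (x (t + 2)))\<^sup>2)"
proof -
  \<comment> \<open>\<open>R\<close> bounds the observation at all times because the norm does not
    increase. Hence \<open>L\<close> and \<open>k\<close> are fixed once for the whole
    trajectory.\<close>
  define R where "R = sqrt coef_norm2 * norm (x 0)"
  obtain L k where Lk: "L \<ge> 0" "k > 0"
    "\<And>u. norm u \<le> R \<Longrightarrow> norm (\<phi> u) \<le> L * norm u"
    "\<And>u. norm u \<le> R \<Longrightarrow> k * (norm u)\<^sup>2 \<le> inner (\<phi> u) u"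
    using \<phi>_bounds by blast
  \<comment> \<open>The two constants of \<open>observability\<close>, with the forcing estimated by
    \<open>L\<close> times the observation.\<close>
  define C where "C = 2 + 8 * coef_norm2\<^sup>2 * L\<^sup>2"
  have C: "C > 0" by (simp add: C_def add_pos_nonneg)
  show ?thesis
  proof
    show "C / (2 * k) > 0" using C Lk by simp
    fix t :: real assume t: "t \<ge> 0"
    define y where "y s = x (s + t)" for s
    have y: "trajectory y" unfolding y_def using x t by (rule trajectory_shift)
    have obs_R: "cmod (obs (y s)) \<le> R" if "s \<ge> 0" for s
    proof -
      have "cmod (obs (y s)) \<le> sqrt coef_norm2 * norm (y s)" by (rule obs_le)
      also have "\<dots> \<le> R" unfolding R_def y_def using that t coef_norm2_nonneg
        by (intro mult_left_mono trajectory_norm_antimono[OF x]) auto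
      finally show ?thesis .
    qed
    have cy: "continuous_on {0..2} y" "continuous_on {0..2} (\<lambda>s. \<phi> (obs (y s)))"
      by (rule solution_continuous[OF y[unfolded trajectory_def]]; auto)+
    define I where "I = integral {0..2} (\<lambda>s. (cmod (obs (y s)))\<^sup>2)"
    have I: "((\<lambda>s. (cmod (obs (y s)))\<^sup>2) has_integral I) {0..2}"
      unfolding I_def
      by (intro integrable_integral integrable_continuous_interval continuous_intros continuous_on_obs cy)
    have "integral {0..2} (\<lambda>s. (cmod (\<phi> (obs (y s))))\<^sup>2) \<le> L\<^sup>2 * I"
    proof (rule has_integral_le)
      show "((\<lambda>s. (cmod (\<phi> (obs (y s))))\<^sup>2) has_integral integral {0..2} (\<lambda>s. (cmod (\<phi> (obs (y s))))\<^sup>2)) {0..2}"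
        by (intro integrable_integral integrable_continuous_interval continuous_intros cy)
      show "((\<lambda>s. L\<^sup>2 * (cmod (obs (y s)))\<^sup>2) has_integral L\<^sup>2 * I) {0..2}"
        by (intro has_integral_mult_right I)
      show "(cmod (\<phi> (obs (y s))))\<^sup>2 \<le> L\<^sup>2 * (cmod (obs (y s)))\<^sup>2" if "s \<in> {0..2}" for s
        using power_mono[OF Lk(3)[OF obs_R[of s]], of 2] that by (simp add: power_mult_distrib)
    qed
    then have "8 * coef_norm2\<^sup>2 * integral {0..2} (\<lambda>s. (cmod (\<phi> (obs (y s))))\<^sup>2) \<le> 8 * coef_norm2\<^sup>2 * (L\<^sup>2 * I)"
      by (intro mult_left_mono) auto
    then have 1: "weak_energy (y 0) \<le> C * I"
      using observability[OF y[unfolded trajectory_def]] by (simp add: C_def I_def algebra_simps)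
    have 2: "2 * k * I \<le> (norm (y 0))\<^sup>2 - (norm (y 2))\<^sup>2"
    proof (rule has_integral_le)
      show "((\<lambda>s. 2 * k * (cmod (obs (y s)))\<^sup>2) has_integral 2 * k * I) {0..2}"
        by (intro has_integral_mult_right I)
      show "((\<lambda>r. 2 * inner (obs (y r)) (\<phi> (obs (y r)))) has_integral (norm (y 0))\<^sup>2 - (norm (y 2))\<^sup>2) {0..2}"
        by (rule energy_identity[OF y[unfolded trajectory_def]]) auto
      show "2 * k * (cmod (obs (y s)))\<^sup>2 \<le> 2 * inner (obs (y s)) (\<phi> (obs (y s)))" if "s \<in> {0..2}" for s
        using Lk(4)[OF obs_R[of s]] that by (simp add: inner_commute)
    qed
    have "C * I = C / (2 * k) * (2 * k * I)" using Lk by simp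
    also have "\<dots> \<le> C / (2 * k) * ((norm (y 0))\<^sup>2 - (norm (y 2))\<^sup>2)"
      using 2 C Lk by (intro mult_left_mono) auto
    finally show "weak_energy (x t) \<le> C / (2 * k) * ((norm (x t))\<^sup>2 - (norm (x (t + 2)))\<^sup>2)"
      using 1 by (simp add: y_def add.commute)
  qed
qed

(* Low modes are controlled by the weak energy, high modes by the time average y,
   which has one more derivative than x. *)
lemma mode_le:
  assumes "M > 0"
  shows "mode n x \<le> M powr (2 * \<beta>) / \<gamma>\<^sup>2 * ((coef n)\<^sup>2 * mode n x)
    + 2 / M\<^sup>2 * ((real (Suc n))\<^sup>2 * mode n y) + 2 * mode n (x - y)"
proof (cases "real (Suc n) \<le> M")
  case True
  define N where "N = real (Suc n)"
  have N: "N > 0" by (simp add: N_def)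
  have "\<gamma>\<^sup>2 * N powr (- 2 * \<beta>) = (\<gamma> * N powr (- \<beta>))\<^sup>2"
    using N by (simp add: power_mult_distrib powr_power)
  also have "\<dots> \<le> \<bar>coef n\<bar>\<^sup>2" using coef_ge[of n] \<gamma> by (intro power_mono) (auto simp: N_def)
  finally have a: "\<gamma>\<^sup>2 * N powr (- 2 * \<beta>) \<le> (coef n)\<^sup>2" by simp
  \<comment> \<open>Among the indices with \<open>n + 1\<close> at most \<open>M\<close>, the lower
    bound for the coefficients is weakest at the threshold, whence the factor
    \<open>M powr (2 * \<beta>) / \<gamma>\<^sup>2\<close>.\<close>
  have "1 = M powr (2 * \<beta>) * M powr (- 2 * \<beta>)" using \<open>M > 0\<close> by (simp add: powr_add[symmetric])
  also have "\<dots> \<le> M powr (2 * \<beta>) * N powr (- 2 * \<beta>)"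
    using True \<beta> N by (intro mult_left_mono powr_mono2') (auto simp: N_def)
  also have "\<dots> = M powr (2 * \<beta>) / \<gamma>\<^sup>2 * (\<gamma>\<^sup>2 * N powr (- 2 * \<beta>))" using \<gamma> by simp
  also have "\<dots> \<le> M powr (2 * \<beta>) / \<gamma>\<^sup>2 * (coef n)\<^sup>2" using a by (intro mult_left_mono) auto
  finally have "1 * mode n x \<le> M powr (2 * \<beta>) / \<gamma>\<^sup>2 * (coef n)\<^sup>2 * mode n x"
    by (intro mult_right_mono mode_nonneg)
  then show ?thesis
    using mode_nonneg[of n y] mode_nonneg[of n "x - y"] by (simp add: mult.assoc add_increasing2)
next
  case False
  have sq: "(cmod z)\<^sup>2 \<le> 2 * (cmod w)\<^sup>2 + 2 * (cmod (z - w))\<^sup>2" for z w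
  proof -
    have "(cmod z)\<^sup>2 \<le> (cmod w + cmod (z - w))\<^sup>2"
      using norm_triangle_sub[of z w] by (intro power_mono) (auto simp: norm_minus_commute)
    also have "\<dots> \<le> 2 * (cmod w)\<^sup>2 + 2 * (cmod (z - w))\<^sup>2"
      using sum_squares_bound[of "cmod w" "cmod (z - w)"] by (simp add: power2_sum)
    finally show ?thesis .
  qed
  have "mode n x \<le> 2 * mode n y + 2 * mode n (x - y)"
    using sq[of "P n x" "P n y"] sq[of "Q n x" "Q n y"] by (simp add: mode_def P_diff Q_diff)
  moreover have "1 * mode n y \<le> (real (Suc n))\<^sup>2 / M\<^sup>2 * mode n y"
    using False \<open>M > 0\<close> by (intro mult_right_mono mode_nonneg) (simp add: power_mono)
  moreover have "0 \<le> M powr (2 * \<beta>) / \<gamma>\<^sup>2 * ((coef n)\<^sup>2 * mode n x)"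
    by (simp add: mode_nonneg)
  ultimately show ?thesis by (simp add: mult.commute mult.left_commute)
qed

text \<open>Integrating the mode equations over \<open>{t..t + h}\<close> expresses
  \<open>freq n\<close> times the coordinates of the time average through the difference quotient of
  \<open>x\<close> and the mean feedback. Contraction bounds the difference quotient at
  \<open>t\<close> by the one at time 0, and likewise the distance from \<open>x t\<close> to the
  average by the oscillation \<open>\<omega>\<close> near time 0.\<close>

lemma average_estimate:
  assumes x: "trajectory x" and t: "t \<ge> 0" and h: "h > 0" and M: "M > 0"
    and osc: "\<And>s. 0 \<le> s \<Longrightarrow> s \<le> h \<Longrightarrow> norm (x s - x 0) \<le> \<omega>"
    and F: "\<And>s. s \<ge> 0 \<Longrightarrow> cmod (\<phi> (obs (x s))) \<le> F"
  shows "(norm (x t))\<^sup>2 \<le> M powr (2 * \<beta>) / \<gamma>\<^sup>2 * weak_energy (x t)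
    + 2 / M\<^sup>2 * (2 * (norm (x h - x 0) / h)\<^sup>2 + 2 * coef_norm2 * F\<^sup>2) + 2 * \<omega>\<^sup>2"
proof -
  note sol = x[unfolded trajectory_def]
  have sub: "{t..t + h} \<subseteq> {0..}" using t by auto
  have "\<omega> \<ge> 0" using osc[of 0] h by simp
  have "F \<ge> 0" using F[of 0] norm_ge_zero order_trans by blast
  define I where "I = integral {t..t + h} x"
  define J where "J = integral {t..t + h} (\<lambda>s. \<phi> (obs (x s)))"
  have I: "(x has_integral I) {t..t + h}" and J: "((\<lambda>s. \<phi> (obs (x s))) has_integral J) {t..t + h}"
    unfolding I_def J_def
    by (intro integrable_integral integrable_continuous_interval solution_continuous[OF sol sub])+
  \<comment> \<open>\<open>y\<close> is the time average of the state, \<open>d\<close> the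
    difference quotient and \<open>g\<close> the time average of the feedback. Formally
    \<open>d\<close> equals \<open>A y - B g\<close>, which is what \<open>P_d\<close> and
    \<open>Q_d\<close> say in coordinates.\<close>
  define y d g where "y = I /\<^sub>R h" and "d = (x (t + h) - x t) /\<^sub>R h" and "g = J /\<^sub>R h"
  have P_d: "P n d = freq n *\<^sub>R Q n y" for n
  proof -
    have "((\<lambda>r. freq n *\<^sub>R Q n (x r)) has_integral P n (x (t + h)) - P n (x t)) {t..t + h}"
      using h by (intro fundamental_theorem_of_calculus solutionD(1)[OF sol _ sub]) (use t in auto)
    moreover have "((\<lambda>r. freq n *\<^sub>R Q n (x r)) has_integral freq n *\<^sub>R Q n I) {t..t + h}"
      using has_integral_cmul[OF has_integral_linear[OF I bounded_linear_Q]] by (simp add: o_def)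
    ultimately have "P n (x (t + h)) - P n (x t) = freq n *\<^sub>R Q n I" by (rule has_integral_unique)
    then show ?thesis
      by (simp add: d_def y_def P_diff linear_scale[OF bounded_linear.linear[OF bounded_linear_P]]
          linear_scale[OF bounded_linear.linear[OF bounded_linear_Q]])
  qed
  have Q_d: "Q n d = - (freq n *\<^sub>R P n y) - coef n *\<^sub>R g" for n
  proof -
    have "((\<lambda>r. - (freq n *\<^sub>R P n (x r)) - coef n *\<^sub>R \<phi> (obs (x r))) has_integral
        Q n (x (t + h)) - Q n (x t)) {t..t + h}"
      using h by (intro fundamental_theorem_of_calculus solutionD(2)[OF sol _ sub]) (use t in auto)
    moreover have "((\<lambda>r. - (freq n *\<^sub>R P n (x r)) - coef n *\<^sub>R \<phi> (obs (x r))) has_integral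
        - (freq n *\<^sub>R P n I) - coef n *\<^sub>R J) {t..t + h}"
      using has_integral_linear[OF I bounded_linear_P] J
      by (intro has_integral_diff has_integral_neg has_integral_cmul) (simp_all add: o_def)
    ultimately have "Q n (x (t + h)) - Q n (x t) = - (freq n *\<^sub>R P n I) - coef n *\<^sub>R J"
      by (rule has_integral_unique)
    moreover have "Q n d = (Q n (x (t + h)) - Q n (x t)) /\<^sub>R h"
      by (simp add: d_def Q_diff linear_scale[OF bounded_linear.linear[OF bounded_linear_Q]])
    ultimately show ?thesis
      by (simp add: y_def g_def linear_scale[OF bounded_linear.linear[OF bounded_linear_P]]
          scaleR_diff_right mult.commute)
  qed
  have g: "cmod g \<le> F"
  proof -
    have "norm J \<le> F * measure lborel {t..t + h}"
      by (rule has_integral_bound_real[OF \<open>F \<ge> 0\<close> finite.emptyI J]) (use F t in auto)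
    then show ?thesis using h by (simp add: g_def field_simps)
  qed
  have d: "(norm d)\<^sup>2 \<le> (norm (x h - x 0) / h)\<^sup>2"
    using trajectory_increment[OF x t, of h] h
    by (intro power_mono) (simp_all add: d_def divide_inverse mult.commute)
  have xy: "norm (x t - y) \<le> \<omega>"
  proof -
    have "((\<lambda>r. x r - x t) has_integral I - h *\<^sub>R x t) {t..t + h}"
      using has_integral_diff[OF I has_integral_const_real[of "x t" t "t + h"]] h by simp
    then have "norm (I - h *\<^sub>R x t) \<le> \<omega> * measure lborel {t..t + h}"
    proof (rule has_integral_bound_real[OF \<open>\<omega> \<ge> 0\<close> finite.emptyI])
      fix r assume "r \<in> {t..t + h} - {}"
      then have "0 \<le> r - t" "r - t \<le> h" by auto
      then show "norm (x r - x t) \<le> \<omega>"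
        using trajectory_increment[OF x t, of "r - t"] osc[of "r - t"] by simp
    qed
    moreover have xy: "x t - y = - ((I - h *\<^sub>R x t) /\<^sub>R h)"
      using h by (simp add: y_def scaleR_diff_right)
    have "norm (x t - y) = norm (I - h *\<^sub>R x t) / h"
      unfolding xy norm_minus_cancel using h by (simp add: divide_inverse mult.commute)
    ultimately show ?thesis using h by (simp add: pos_divide_le_eq)
  qed
  have y: "(real (Suc n))\<^sup>2 * mode n y \<le> 2 * mode n d + 2 * F\<^sup>2 * (coef n)\<^sup>2" for n
  proof -
    have "real (Suc n) * 1 \<le> freq n" unfolding freq_def using pi_ge_two by (intro mult_left_mono) auto
    then have "(real (Suc n))\<^sup>2 * mode n y \<le> (freq n)\<^sup>2 * mode n y"
      by (intro mult_right_mono power_mono mode_nonneg) auto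
    also have "\<dots> = (cmod (P n d))\<^sup>2 + (cmod (Q n d + coef n *\<^sub>R g))\<^sup>2"
      by (simp add: P_d Q_d mode_def power_mult_distrib distrib_left)
    also have "(cmod (Q n d + coef n *\<^sub>R g))\<^sup>2 \<le> (cmod (Q n d) + \<bar>coef n\<bar> * F)\<^sup>2"
      using norm_triangle_ineq[of "Q n d" "coef n *\<^sub>R g"] mult_left_mono[OF g, of "\<bar>coef n\<bar>"]
      by (intro power_mono) auto
    also have "\<dots> \<le> 2 * (cmod (Q n d))\<^sup>2 + 2 * F\<^sup>2 * (coef n)\<^sup>2"
      using sum_squares_bound[of "cmod (Q n d)" "\<bar>coef n\<bar> * F"]
      by (simp add: power2_sum power_mult_distrib mult_ac)
    finally have "(real (Suc n))\<^sup>2 * mode n y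
        \<le> (cmod (P n d))\<^sup>2 + (2 * (cmod (Q n d))\<^sup>2 + 2 * F\<^sup>2 * (coef n)\<^sup>2)" by simp
    moreover have "2 * mode n d = 2 * (cmod (P n d))\<^sup>2 + 2 * (cmod (Q n d))\<^sup>2" by (simp add: mode_def)
    ultimately show ?thesis using zero_le_power2[of "cmod (P n d)"] by linarith
  qed
  have "(\<Sum>n<K. mode n (x t)) \<le> M powr (2 * \<beta>) / \<gamma>\<^sup>2 * weak_energy (x t)
    + 2 / M\<^sup>2 * (2 * (norm (x h - x 0) / h)\<^sup>2 + 2 * coef_norm2 * F\<^sup>2) + 2 * \<omega>\<^sup>2" for K
  proof -
    have "(\<Sum>n<K. mode n (x t)) \<le> (\<Sum>n<K. M powr (2 * \<beta>) / \<gamma>\<^sup>2 * ((coef n)\<^sup>2 * mode n (x t))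
        + 2 / M\<^sup>2 * ((real (Suc n))\<^sup>2 * mode n y) + 2 * mode n (x t - y))"
      by (intro sum_mono mode_le M)
    also have "\<dots> = M powr (2 * \<beta>) / \<gamma>\<^sup>2 * (\<Sum>n<K. (coef n)\<^sup>2 * mode n (x t))
        + 2 / M\<^sup>2 * (\<Sum>n<K. (real (Suc n))\<^sup>2 * mode n y) + 2 * (\<Sum>n<K. mode n (x t - y))"
      by (simp only: sum.distrib sum_distrib_left)
    also have "\<dots> \<le> M powr (2 * \<beta>) / \<gamma>\<^sup>2 * weak_energy (x t)
    + 2 / M\<^sup>2 * (2 * (norm (x h - x 0) / h)\<^sup>2 + 2 * coef_norm2 * F\<^sup>2) + 2 * \<omega>\<^sup>2"
    proof (intro add_mono mult_left_mono)
      show "(\<Sum>n<K. (coef n)\<^sup>2 * mode n (x t)) \<le> weak_energy (x t)"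
        unfolding weak_energy_def
        by (intro sum_le_suminf summable_weak_energy) (auto simp: mode_nonneg)
      have "(\<Sum>n<K. (real (Suc n))\<^sup>2 * mode n y) \<le> (\<Sum>n<K. 2 * mode n d + 2 * F\<^sup>2 * (coef n)\<^sup>2)"
        by (intro sum_mono y)
      also have "\<dots> = 2 * (\<Sum>n<K. mode n d) + 2 * F\<^sup>2 * (\<Sum>n<K. (coef n)\<^sup>2)"
        by (simp only: sum.distrib sum_distrib_left)
      also have "\<dots> \<le> 2 * (norm (x h - x 0) / h)\<^sup>2 + 2 * F\<^sup>2 * coef_norm2"
        using sum_mode_le[where x = d and K = K] d
        by (intro add_mono mult_left_mono sum_coef_le) auto
      finally show "(\<Sum>n<K. (real (Suc n))\<^sup>2 * mode n y) \<le>
          2 * (norm (x h - x 0) / h)\<^sup>2 + 2 * coef_norm2 * F\<^sup>2" by (simp add: mult_ac)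
      show "(\<Sum>n<K. mode n (x t - y)) \<le> \<omega>\<^sup>2"
        using sum_mode_le[where x = "x t - y" and K = K] power_mono[OF xy, of 2] by simp
    qed auto
    finally show ?thesis .
  qed
  then show ?thesis
    by (intro LIMSEQ_le_const2[OF mode_sums[unfolded sums_def]]) blast
qed

lemma trajectory_feedback_bounded:
  assumes "trajectory x"
  obtains F where "\<And>s. s \<ge> 0 \<Longrightarrow> cmod (\<phi> (obs (x s))) \<le> F"
proof -
  define R where "R = sqrt coef_norm2 * norm (x 0)"
  obtain L where L: "L \<ge> 0" "\<And>u. norm u \<le> R \<Longrightarrow> norm (\<phi> u) \<le> L * norm u"
    using \<phi>_bounds by metis
  have "cmod (\<phi> (obs (x s))) \<le> L * R" if "s \<ge> 0" for s
  proof -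
    have "cmod (obs (x s)) \<le> sqrt coef_norm2 * norm (x s)" by (rule obs_le)
    also have "\<dots> \<le> R" unfolding R_def using that coef_norm2_nonneg
      by (intro mult_left_mono trajectory_norm_antimono[OF assms]) auto
    finally show ?thesis using L mult_left_mono order_trans by blast
  qed
  then show ?thesis using that by blast
qed

text \<open>Since the norm does not increase, one time with small norm suffices. The energy losses
  over spans of length 2 tend to 0 but at no known rate, so \<open>h\<close> and then
  \<open>M\<close> are fixed before the time is chosen.\<close>

theorem trajectory_stable:
  assumes x: "trajectory x"
  shows "((\<lambda>t. norm (x t)) \<longlongrightarrow> 0) at_top"
proof -
  obtain \<kappa> where \<kappa>: "\<kappa> > 0" "\<And>t. t \<ge> 0 \<Longrightarrow>
      weak_energy (x t) \<le> \<kappa> * ((norm (x t))\<^sup>2 - (norm (x (t + 2)))\<^sup>2)"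
    using trajectory_weak_energy[OF x] by blast
  obtain F where F: "\<And>s. s \<ge> 0 \<Longrightarrow> cmod (\<phi> (obs (x s))) \<le> F"
    using trajectory_feedback_bounded[OF x] by blast
  define a where "a k = (norm (x (2 * real k)))\<^sup>2" for k
  have "decseq a"
    unfolding a_def by (intro decseq_SucI power_mono trajectory_norm_antimono[OF x]) auto
  moreover have "\<And>k. 0 \<le> a k" by (simp add: a_def)
  ultimately obtain l where l: "a \<longlonglongrightarrow> l" using decseq_convergent by blast
  then have "(\<lambda>k. a k - a (Suc k)) \<longlonglongrightarrow> l - l"
    by (intro tendsto_diff) (auto simp: LIMSEQ_Suc)
  then have drop: "(\<lambda>k. B * (\<kappa> * (a k - a (Suc k)))) \<longlonglongrightarrow> 0" for B
    by (simp add: tendsto_mult_right_zero)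
  have small: "\<exists>T\<ge>0. (norm (x T))\<^sup>2 < e" if "e > 0" for e
  proof -
    \<comment> \<open>Oscillation, high modes and low modes are each allotted \<open>e / 4\<close>,
      which leaves room for the strict inequality.\<close>
    define \<omega> where "\<omega> = sqrt (e / 8)"
    have \<omega>: "\<omega> > 0" "2 * \<omega>\<^sup>2 = e / 4" using that by (auto simp: \<omega>_def)
    have "continuous_on {0..} x"
      using solution_continuous(1)[OF x[unfolded trajectory_def] order_refl] .
    then obtain h0 where h0: "h0 > 0" "\<And>s. s \<ge> 0 \<Longrightarrow> dist s 0 < h0 \<Longrightarrow> dist (x s) (x 0) < \<omega>"
      using \<omega>(1) unfolding continuous_on_iff by force
    define h where "h = h0 / 2"
    have h: "h > 0" "\<And>s. 0 \<le> s \<Longrightarrow> s \<le> h \<Longrightarrow> norm (x s - x 0) \<le> \<omega>"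
      using h0 by (auto simp: h_def dist_norm less_imp_le)
    define C where "C = 2 * (norm (x h - x 0) / h)\<^sup>2 + 2 * coef_norm2 * F\<^sup>2"
    have C: "C \<ge> 0" by (simp add: C_def coef_norm2_nonneg)
    \<comment> \<open>Adding 1 keeps \<open>M\<close> positive even when \<open>C\<close> is
      0.\<close>
    define M where "M = sqrt (8 * (C + 1) / e)"
    have M: "M > 0" "M\<^sup>2 = 8 * (C + 1) / e" using C that by (auto simp: M_def)
    have "2 / M\<^sup>2 * C \<le> 2 / M\<^sup>2 * (C + 1)" by (intro mult_left_mono) auto
    also have "\<dots> = e / 4" using C that by (simp add: M(2) field_simps)
    finally have M': "2 / M\<^sup>2 * C \<le> e / 4" .
    have "\<exists>k. M powr (2 * \<beta>) / \<gamma>\<^sup>2 * (\<kappa> * (a k - a (Suc k))) < e / 4"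
      by (rule eventually_happens'[OF sequentially_bot order_tendstoD(2)[OF drop]]) (use that in simp)
    then obtain k where k: "M powr (2 * \<beta>) / \<gamma>\<^sup>2 * (\<kappa> * (a k - a (Suc k))) < e / 4" ..
    define T where "T = 2 * real k"
    have T: "T \<ge> 0" by (simp add: T_def)
    have "M powr (2 * \<beta>) / \<gamma>\<^sup>2 * weak_energy (x T) \<le> M powr (2 * \<beta>) / \<gamma>\<^sup>2 * (\<kappa> * (a k - a (Suc k)))"
      using \<kappa>(2)[OF T] by (intro mult_left_mono) (auto simp: a_def T_def algebra_simps)
    moreover have "(norm (x T))\<^sup>2 \<le> M powr (2 * \<beta>) / \<gamma>\<^sup>2 * weak_energy (x T) + 2 / M\<^sup>2 * C + 2 * \<omega>\<^sup>2"
      unfolding C_def by (rule average_estimate[OF x T h(1) M(1)]) (use h(2) F in auto)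
    ultimately have "(norm (x T))\<^sup>2 < e"
      using k M' \<omega>(2) that by linarith
    then show ?thesis using T by blast
  qed
  show ?thesis
  proof (rule tendstoI)
    fix e :: real assume e: "e > 0"
    then obtain T where T: "T \<ge> 0" "(norm (x T))\<^sup>2 < e\<^sup>2" using small[of "e\<^sup>2"] by auto
    then have "norm (x T) < e" using e by (simp add: power_less_imp_less_base)
    then have "dist (norm (x t)) 0 < e" if "t \<ge> T" for t
      using trajectory_norm_antimono[OF x T(1) that] by simp
    then show "\<forall>\<^sub>F t in at_top. dist (norm (x t)) 0 < e"
      by (rule eventually_mono[OF eventually_ge_at_top[of T]])
  qed
qed

theorem trajectory_decay:
  assumes x: "trajectory x" and h0: "h0 > 0"
    and K: "\<And>h. 0 \<le> h \<Longrightarrow> h \<le> h0 \<Longrightarrow> norm (x h - x 0) \<le> K * h"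
  shows "(\<lambda>t. norm (x t)) \<in> O[at_top](\<lambda>t. t powr (- 1 / (2 * \<beta>)))"
proof -
  obtain \<kappa> where \<kappa>: "\<kappa> > 0" "\<And>t. t \<ge> 0 \<Longrightarrow>
      weak_energy (x t) \<le> \<kappa> * ((norm (x t))\<^sup>2 - (norm (x (t + 2)))\<^sup>2)"
    using trajectory_weak_energy[OF x] by blast
  obtain F where F: "\<And>s. s \<ge> 0 \<Longrightarrow> cmod (\<phi> (obs (x s))) \<le> F"
    using trajectory_feedback_bounded[OF x] by blast
  define C where "C = 2 * K\<^sup>2 + 2 * coef_norm2 * F\<^sup>2 + 1"
  have C: "C > 0" by (simp add: C_def coef_norm2_nonneg add_nonneg_pos)
  \<comment> \<open>For spans \<open>h0 / (n + 1)\<close> the oscillation is at most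
    \<open>K * h\<close>, while the difference quotient stays below \<open>K\<close>. The limit in
    \<open>n\<close> therefore removes the oscillation term and keeps the constant
    \<open>C\<close>.\<close>
  have est: "(norm (x t))\<^sup>2 \<le> M powr (2 * \<beta>) / \<gamma>\<^sup>2 * weak_energy (x t) + 2 / M\<^sup>2 * C"
    if t: "t \<ge> 0" and M: "M > 0" for t M
  proof (rule LIMSEQ_le_const)
    show "(\<lambda>n. M powr (2 * \<beta>) / \<gamma>\<^sup>2 * weak_energy (x t) + 2 / M\<^sup>2 * C + 2 * (K * (h0 / real (Suc n)))\<^sup>2)
      \<longlonglongrightarrow> M powr (2 * \<beta>) / \<gamma>\<^sup>2 * weak_energy (x t) + 2 / M\<^sup>2 * C"
      by (rule tendsto_eq_intros refl LIMSEQ_Suc[OF lim_const_over_n])+ simp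
    have "(norm (x t))\<^sup>2 \<le> M powr (2 * \<beta>) / \<gamma>\<^sup>2 * weak_energy (x t) + 2 / M\<^sup>2 * C
        + 2 * (K * (h0 / real (Suc n)))\<^sup>2" for n
    proof -
      define h where "h = h0 / real (Suc n)"
      have h: "h > 0" "h \<le> h0" using h0 by (auto simp: h_def divide_le_eq)
      have "(norm (x t))\<^sup>2 \<le> M powr (2 * \<beta>) / \<gamma>\<^sup>2 * weak_energy (x t)
        + 2 / M\<^sup>2 * (2 * (norm (x h - x 0) / h)\<^sup>2 + 2 * coef_norm2 * F\<^sup>2) + 2 * (K * h)\<^sup>2"
      proof (rule average_estimate[OF x t h(1) M _ F])
        have K0: "0 \<le> K * h" using K[of h] h norm_ge_zero order_trans by (metis less_imp_le)
        then have "K \<ge> 0" using h by (simp add: zero_le_mult_iff)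
        then show "norm (x s - x 0) \<le> K * h" if "0 \<le> s" "s \<le> h" for s
          using K[of s] that h mult_left_mono[OF that(2), of K] by linarith
      qed
      also have "(norm (x h - x 0) / h)\<^sup>2 \<le> K\<^sup>2"
        using K[of h] h by (intro power_mono) (auto simp: divide_le_eq)
      then have "2 / M\<^sup>2 * (2 * (norm (x h - x 0) / h)\<^sup>2 + 2 * coef_norm2 * F\<^sup>2) \<le> 2 / M\<^sup>2 * C"
        unfolding C_def by (intro mult_left_mono) auto
      finally show ?thesis by (simp add: h_def)
    qed
    then show "\<exists>N. \<forall>n\<ge>N. (norm (x t))\<^sup>2 \<le> M powr (2 * \<beta>) / \<gamma>\<^sup>2 * weak_energy (x t) + 2 / M\<^sup>2 * C
        + 2 * (K * (h0 / real (Suc n)))\<^sup>2" by blast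
  qed
  \<comment> \<open>Obtained by solving the estimate for \<open>a k / 2\<close> in
    \<open>step\<close> for the energy loss \<open>a k - a (Suc k)\<close>.\<close>
  define \<eta> where "\<eta> = \<gamma>\<^sup>2 / (2 * \<kappa> * (4 * C) powr \<beta>)"
  have \<eta>: "\<eta> > 0" using \<gamma> \<kappa> C by (simp add: \<eta>_def)
  define a where "a k = (norm (x (2 * real k)))\<^sup>2" for k
  have step: "a (Suc k) \<le> a k - \<eta> * a k powr (1 + \<beta>)" for k
  proof (cases "a k = 0")
    case True
    then show ?thesis using trajectory_norm_antimono[OF x, of "2 * real k" "2 * real (Suc k)"] by (simp add: a_def)
  next
    case False
    then have a: "a k > 0" by (simp add: a_def)
    \<comment> \<open>This threshold makes the high modes account for at most half of
      \<open>a k\<close>; the other half must then be covered by the weak energy.\<close>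
    define M where "M = sqrt (4 * C / a k)"
    have M: "M > 0" "M\<^sup>2 = 4 * C / a k" using C a by (auto simp: M_def)
    have "M powr (2 * \<beta>) = (M powr 2) powr \<beta>" by (simp add: powr_powr)
    also have "M powr 2 = M\<^sup>2" using M(1) by simp
    also have "(M\<^sup>2) powr \<beta> = (4 * C) powr \<beta> / a k powr \<beta>"
      using C a by (simp add: M(2) powr_divide)
    finally have Mb: "M powr (2 * \<beta>) = (4 * C) powr \<beta> / a k powr \<beta>" .
    have "2 / M\<^sup>2 * C = a k / 2" using C by (simp add: M(2))
    moreover have "a k \<le> M powr (2 * \<beta>) / \<gamma>\<^sup>2 * weak_energy (x (2 * real k)) + 2 / M\<^sup>2 * C"
      unfolding a_def by (rule est[OF _ M(1)]) simp
    ultimately have "a k / 2 \<le> (4 * C) powr \<beta> / a k powr \<beta> / \<gamma>\<^sup>2 * weak_energy (x (2 * real k))"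
      unfolding Mb by linarith
    also have "\<dots> \<le> (4 * C) powr \<beta> / a k powr \<beta> / \<gamma>\<^sup>2 * (\<kappa> * (a k - a (Suc k)))"
      using \<kappa>(2)[of "2 * real k"] by (intro mult_left_mono) (auto simp: a_def algebra_simps)
    finally have "\<eta> * a k powr \<beta> * 2 * (a k / 2) \<le> \<eta> * a k powr \<beta> * 2 *
        ((4 * C) powr \<beta> / a k powr \<beta> / \<gamma>\<^sup>2 * (\<kappa> * (a k - a (Suc k))))"
      using \<eta> by (intro mult_left_mono) auto
    also have "\<dots> = a k - a (Suc k)" using \<gamma> \<kappa> C a by (simp add: \<eta>_def)
    finally show ?thesis using a by (simp add: powr_add mult_ac)
  qed
  \<comment> \<open>For \<open>t\<close> at least 2 the number \<open>k\<close> of complete spans is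
    at least \<open>t / 4\<close>, which explains the quotient by 4. The exponent is halved on
    passing from energy to norm.\<close>
  define B where "B = (\<beta> * \<eta> / 4) powr (- 1 / (2 * \<beta>))"
  have "norm (x t) \<le> B * t powr (- 1 / (2 * \<beta>))" if t: "t \<ge> 2" for t
  proof -
    define k where "k = nat \<lfloor>t / 2\<rfloor>"
    have "\<lfloor>t / 2\<rfloor> \<ge> 1" using t by (simp add: le_floor_iff)
    then have "real k = of_int \<lfloor>t / 2\<rfloor>" "k \<ge> 1" unfolding k_def by linarith+
    then have k: "k \<ge> 1" "2 * real k \<le> t" "t / 4 \<le> real k"
      using of_int_floor_le[of "t / 2"] floor_correct[of "t / 2"] by linarith+
    have "(norm (x t))\<^sup>2 \<le> a k"
      unfolding a_def using k by (intro power_mono trajectory_norm_antimono[OF x]) auto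
    also have "\<dots> \<le> (\<beta> * \<eta> * real k) powr (- 1 / \<beta>)"
      by (rule polynomial_decay[where a = a, OF _ \<eta> \<beta> step k(1)]) (simp add: a_def)
    also have "\<dots> \<le> (\<beta> * \<eta> * (t / 4)) powr (- 1 / \<beta>)"
      using k \<beta> \<eta> t by (intro powr_mono2') auto
    also have "\<dots> = ((\<beta> * \<eta> / 4 * t) powr (- 1 / (2 * \<beta>)))\<^sup>2"
      using \<beta> \<eta> t by (simp add: powr_power)
    finally have "norm (x t) \<le> (\<beta> * \<eta> / 4 * t) powr (- 1 / (2 * \<beta>))"
      by (rule power2_le_imp_le) simp
    also have "\<dots> = B * t powr (- 1 / (2 * \<beta>))"
      unfolding B_def by (rule powr_mult)
    finally show ?thesis .
  qed
  then have "\<forall>\<^sub>F t in at_top. norm (norm (x t)) \<le> B * norm (t powr (- 1 / (2 * \<beta>)))"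
    by (intro eventually_mono[OF eventually_ge_at_top[of 2]]) simp
  then show ?thesis by (rule bigoI)
qed

end

section \<open>Completeness of the state space\<close>

lemma square_integrable_const: "square_integrable (\<lambda>x. z::complex)"
  by (intro square_integrable_continuous continuous_intros)

lemma norm_l2_abs_square:
  "square_integrable f \<Longrightarrow> (norm (abs_l2 f))\<^sup>2 = (LINT x|unit_interval. (cmod (f x))\<^sup>2)"
  by (simp add: norm_l2_abs)

lemma inner_l2_abs:
  assumes "square_integrable f" "square_integrable g"
  shows "inner (abs_l2 f) (abs_l2 g) = Re (LINT x|unit_interval. f x * cnj (g x))"
  using assms by (intro inner_l2.abs_eq) (auto simp: l2_rel_def)

lemma l2_diff_abs:
  assumes "square_integrable f" "square_integrable g"
  shows "abs_l2 f - abs_l2 g = abs_l2 (\<lambda>x. f x - g x)"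
  using assms by (intro minus_l2.abs_eq) (auto simp: l2_rel_def)

lemma measure_unit_interval: "measure unit_interval {0<..<1} = 1"
  by (simp add: measure_restrict_space)

text \<open>Cauchy-Schwarz against the constant 1, whose norm is 1 on an interval of length
  1.\<close>

lemma l1_le_l2_norm:
  assumes f: "square_integrable f"
  shows "integrable unit_interval (\<lambda>x. cmod (f x))" "(LINT x|unit_interval. cmod (f x)) \<le> norm (abs_l2 f)"
proof -
  have nf: "square_integrable (\<lambda>x. complex_of_real (cmod (f x)))"
    using f by (auto simp: square_integrable_def)
  have "norm (abs_l2 (\<lambda>x. complex_of_real (cmod (f x)))) = norm (abs_l2 f)" "norm (abs_l2 (\<lambda>x. 1)) = 1"
    using measure_unit_interval by (simp_all add: norm_l2_abs nf f square_integrable_const)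
  moreover have "inner (abs_l2 (\<lambda>x. complex_of_real (cmod (f x)))) (abs_l2 (\<lambda>x. 1)) =
      (LINT x|unit_interval. cmod (f x))"
    by (simp add: inner_l2_abs nf square_integrable_const)
  ultimately show "(LINT x|unit_interval. cmod (f x)) \<le> norm (abs_l2 f)"
    using norm_cauchy_schwarz by (metis mult.right_neutral)
  show "integrable unit_interval (\<lambda>x. cmod (f x))"
    using integrable_norm[OF square_integrable_mult[OF f square_integrable_const[of 1]]] by simp
qed

text \<open>The Riesz-Fischer argument: a Cauchy sequence in the square norm is Cauchy in mean, so a
  subsequence of representatives converges almost everywhere, and Fatou's lemma transfers the Cauchy
  estimate to the limit function.\<close>

lemma l2_Cauchy_convergent:
  fixes X :: "nat \<Rightarrow> l2"
  assumes "Cauchy X"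
  shows "convergent X"
proof -
  define f where "f k = rep_l2 (X k)" for k
  have sf: "square_integrable (f k)" for k by (simp add: f_def rep_l2)
  then have mf [measurable]: "f k \<in> borel_measurable unit_interval" for k by (simp add: square_integrable_def)
  have sd: "square_integrable (\<lambda>x. f j x - f k x)" for j k by (intro square_integrable_diff sf)
  have nd: "norm (abs_l2 (\<lambda>x. f j x - f k x)) = norm (X j - X k)" for j k
    using l2_diff_abs[OF sf sf] by (metis abs_rep_l2 f_def)
  have fi: "integrable unit_interval (f k)" for k
    using square_integrable_mult[OF sf square_integrable_const[of 1]] by simp
  have "\<exists>N. \<forall>i\<ge>N. \<forall>j\<ge>N. (LINT x|unit_interval. cmod (f i x - f j x)) < e" if "e > 0" for e
  proof -
    obtain N where N: "\<And>i j. i \<ge> N \<Longrightarrow> j \<ge> N \<Longrightarrow> norm (X i - X j) < e"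
      using CauchyD[OF assms \<open>e > 0\<close>] by blast
    have "(LINT x|unit_interval. cmod (f i x - f j x)) < e" if "i \<ge> N" "j \<ge> N" for i j
      using order_le_less_trans[OF l1_le_l2_norm(2)[OF sd]] N[OF that] by (simp add: nd)
    then show ?thesis by blast
  qed
  with fi obtain r where r: "strict_mono r" "AE x in unit_interval. Cauchy (\<lambda>k. f (r k) x)"
    by (rule cauchy_L1_AE_cauchy_subseq)
  define g where "g x = lim (\<lambda>k. f (r k) x)" for x
  have mg [measurable]: "g \<in> borel_measurable unit_interval"
    unfolding g_def by (intro borel_measurable_lim_metric mf)
  have conv: "AE x in unit_interval. (\<lambda>k. f (r k) x) \<longlonglongrightarrow> g x"
    using r(2) by eventually_elim (simp add: g_def convergent_LIMSEQ_iff[symmetric] Cauchy_convergent)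
  \<comment> \<open>Fatou's lemma runs along the subsequence in \<open>j\<close>, whereas
    \<open>k\<close> ranges over all indices. The estimate thus concerns the full sequence at
    once.\<close>
  have bound: "(\<integral>\<^sup>+x. ennreal ((cmod (g x - f k x))\<^sup>2) \<partial>unit_interval) \<le> ennreal (e\<^sup>2)"
    if "e > 0" and e: "\<And>j. j \<ge> N \<Longrightarrow> norm (X j - X k) \<le> e" for e k N
  proof -
    have "(\<integral>\<^sup>+x. ennreal ((cmod (g x - f k x))\<^sup>2) \<partial>unit_interval) =
        (\<integral>\<^sup>+x. liminf (\<lambda>j. ennreal ((cmod (f (r j) x - f k x))\<^sup>2)) \<partial>unit_interval)"
    proof (rule nn_integral_cong_AE)
      show "AE x in unit_interval. ennreal ((cmod (g x - f k x))\<^sup>2) =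
          liminf (\<lambda>j. ennreal ((cmod (f (r j) x - f k x))\<^sup>2))"
        using conv
      proof eventually_elim
        case (elim x)
        have "(\<lambda>j. ennreal ((cmod (f (r j) x - f k x))\<^sup>2)) \<longlonglongrightarrow> ennreal ((cmod (g x - f k x))\<^sup>2)"
          by (intro tendsto_ennrealI tendsto_intros elim)
        then show ?case using lim_imp_Liminf[OF sequentially_bot] by metis
      qed
    qed
    also have "\<dots> \<le> liminf (\<lambda>j. \<integral>\<^sup>+x. ennreal ((cmod (f (r j) x - f k x))\<^sup>2) \<partial>unit_interval)"
      by (intro nn_integral_liminf) simp
    also have "\<dots> \<le> ennreal (e\<^sup>2)"
    proof (rule Liminf_le)
      have "(\<integral>\<^sup>+x. ennreal ((cmod (f (r j) x - f k x))\<^sup>2) \<partial>unit_interval) \<le> ennreal (e\<^sup>2)"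
        if "j \<ge> N" for j
      proof -
        have "(\<integral>\<^sup>+x. ennreal ((cmod (f (r j) x - f k x))\<^sup>2) \<partial>unit_interval) =
            ennreal (LINT x|unit_interval. (cmod (f (r j) x - f k x))\<^sup>2)"
          using sd[of "r j" k] by (intro nn_integral_eq_integral) (auto simp: square_integrable_def)
        also have "\<dots> = ennreal ((norm (X (r j) - X k))\<^sup>2)"
          by (simp only: norm_l2_abs_square[OF sd, symmetric] nd)
        also have "\<dots> \<le> ennreal (e\<^sup>2)"
          using e[of "r j"] seq_suble[OF r(1), of j] that by (intro ennreal_leI power_mono) auto
        finally show ?thesis .
      qed
      then show "\<forall>\<^sub>F j in sequentially. (\<integral>\<^sup>+x. ennreal ((cmod (f (r j) x - f k x))\<^sup>2) \<partial>unit_interval)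
          \<le> ennreal (e\<^sup>2)"
        by (rule eventually_sequentiallyI)
    qed simp
    finally show ?thesis .
  qed
  have sgf: "square_integrable (\<lambda>x. g x - f k x)"
    if "e > 0" "\<And>j. j \<ge> N \<Longrightarrow> norm (X j - X k) \<le> e" for e k N
    unfolding square_integrable_def
  proof
    show m: "(\<lambda>x. g x - f k x) \<in> borel_measurable unit_interval" by simp
    show "integrable unit_interval (\<lambda>x. (cmod (g x - f k x))\<^sup>2)"
    proof (rule integrableI_nonneg)
      show "(\<integral>\<^sup>+x. ennreal ((cmod (g x - f k x))\<^sup>2) \<partial>unit_interval) < \<infinity>"
        using order.strict_trans1[OF bound[OF that]] by simp
    qed auto
  qed
  obtain N1 where N1: "\<And>j k. j \<ge> N1 \<Longrightarrow> k \<ge> N1 \<Longrightarrow> norm (X j - X k) < 1"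
    using CauchyD[OF assms, of 1] by auto
  have sg: "square_integrable g"
    using square_integrable_add[OF sgf[of 1 N1 N1] sf[of N1]] N1 by (simp add: less_imp_le)
  have "X \<longlonglongrightarrow> abs_l2 g"
  proof (rule LIMSEQ_I)
    fix e :: real assume "e > 0"
    then obtain N where N: "\<And>j k. j \<ge> N \<Longrightarrow> k \<ge> N \<Longrightarrow> norm (X j - X k) < e / 2"
      using CauchyD[OF assms, of "e / 2"] by auto
    have "norm (X k - abs_l2 g) < e" if "k \<ge> N" for k
    proof -
      have k: "\<And>j. j \<ge> N \<Longrightarrow> norm (X j - X k) \<le> e / 2" "e / 2 > 0"
        using N[OF _ that] \<open>e > 0\<close> by (auto simp: less_imp_le)
      have "ennreal (LINT x|unit_interval. (cmod (g x - f k x))\<^sup>2) \<le> ennreal ((e / 2)\<^sup>2)"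
        using bound[OF k(2,1)] sgf[OF k(2,1)]
        by (subst nn_integral_eq_integral[symmetric]) (auto simp: square_integrable_def)
      then have "(LINT x|unit_interval. (cmod (g x - f k x))\<^sup>2) \<le> (e / 2)\<^sup>2"
        by (subst (asm) ennreal_le_iff) auto
      then have "(norm (abs_l2 g - X k))\<^sup>2 \<le> (e / 2)\<^sup>2"
        using l2_diff_abs[OF sg sf[of k]] norm_l2_abs_square[OF sgf[OF k(2,1)]]
        by (simp add: f_def abs_rep_l2)
      then have "norm (abs_l2 g - X k) \<le> e / 2"
        by (rule power2_le_imp_le) (use \<open>e > 0\<close> in simp)
      then show ?thesis using \<open>e > 0\<close> by (simp add: norm_minus_commute)
    qed
    then show "\<exists>N. \<forall>k\<ge>N. norm (X k - abs_l2 g) < e" by blast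
  qed
  then show ?thesis by (auto simp: convergent_def)
qed

instance l2 :: banach
  by standard (rule l2_Cauchy_convergent)

text \<open>The pairing is bilinear without conjugation, whereas \<open>l2\<close> carries a real
  inner product only. Written as two real inner products, the pairing inherits boundedness from
  Cauchy-Schwarz.\<close>

lemma l2_pairing_cnj:
  assumes "square_integrable g"
  shows "Re (l2_pairing u (abs_l2 g)) = inner u (abs_l2 (\<lambda>x. cnj (g x)))"
    "Im (l2_pairing u (abs_l2 g)) = inner u (abs_l2 (\<lambda>x. \<i> * cnj (g x)))"
proof -
  note r = rep_l2[of u] square_integrable_cnj[OF assms]
  have ig: "square_integrable (\<lambda>x. \<i> * cnj (g x))"
    using r(2) by (auto simp: square_integrable_def norm_mult)
  have "inner (abs_l2 (rep_l2 u)) (abs_l2 (\<lambda>x. \<i> * cnj (g x))) =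
      Re (LINT x|unit_interval. - \<i> * (rep_l2 u x * g x))"
    using r ig by (simp add: inner_l2_abs mult.left_commute)
  also have "\<dots> = Im (LINT x|unit_interval. rep_l2 u x * g x)"
    by (subst integral_mult_right_zero) simp
  finally show "Im (l2_pairing u (abs_l2 g)) = inner u (abs_l2 (\<lambda>x. \<i> * cnj (g x)))"
    using l2_pairing_abs[OF r(1) assms] by (simp add: abs_rep_l2)
  show "Re (l2_pairing u (abs_l2 g)) = inner u (abs_l2 (\<lambda>x. cnj (g x)))"
    using inner_l2_abs[OF r] l2_pairing_abs[OF r(1) assms] by (simp add: abs_rep_l2)
qed

lemma bounded_linear_l2_pairing:
  "bounded_linear (\<lambda>u. l2_pairing u v)"
proof -
  have v: "v = abs_l2 (rep_l2 v)" by (simp add: abs_rep_l2)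
  have "(\<lambda>u. l2_pairing u v) = (\<lambda>u. complex_of_real (inner u (abs_l2 (\<lambda>x. cnj (rep_l2 v x))))
      + \<i> * complex_of_real (inner u (abs_l2 (\<lambda>x. \<i> * cnj (rep_l2 v x)))))"
    by (subst v, rule ext, rule complex_eqI)
       (simp_all add: l2_pairing_cnj[OF rep_l2])
  moreover have "bounded_linear (\<lambda>u. complex_of_real (inner u (abs_l2 (\<lambda>x. cnj (rep_l2 v x))))
      + \<i> * complex_of_real (inner u (abs_l2 (\<lambda>x. \<i> * cnj (rep_l2 v x)))))"
    by (intro bounded_linear_add bounded_linear_const_mult
        bounded_linear_compose[OF bounded_linear_of_real bounded_linear_inner_left])
  ultimately show ?thesis by simp
qed

lemma l2_pairing_commute: "l2_pairing u v = l2_pairing v u"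
  by transfer (simp add: mult.commute)

section \<open>Closedness of the weak derivative and completeness of the displacement space\<close>

lemma H1_diff_weak_derivative:
  "u \<in> H1 \<Longrightarrow> v \<in> H1 \<Longrightarrow> weak_derivative (u - v) = weak_derivative u - weak_derivative v"
  by (intro weak_derivative_eqI has_weak_derivative_diff has_weak_derivative_weak_derivative)

text \<open>For a fixed test function both sides of the defining identity are continuous in the
  function and its derivative.\<close>

lemma has_weak_derivative_limit:
  assumes "\<And>k. has_weak_derivative (X k) (Y k)" "X \<longlonglongrightarrow> u" "Y \<longlonglongrightarrow> g"
  shows "has_weak_derivative u g"
  unfolding has_weak_derivative_def
proof (intro allI impI)
  fix \<psi> assume \<psi>: "test_function \<psi>"
  note lim = bounded_linear.tendsto[OF bounded_linear_l2_pairing]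
  have "(\<lambda>k. l2_pairing (X k) (abs_l2 (\<lambda>x. vector_derivative \<psi> (at x)))) \<longlonglongrightarrow>
      l2_pairing u (abs_l2 (\<lambda>x. vector_derivative \<psi> (at x)))"
    by (intro lim assms)
  moreover have "(\<lambda>k. - l2_pairing (Y k) (abs_l2 \<psi>)) \<longlonglongrightarrow> - l2_pairing g (abs_l2 \<psi>)"
    by (intro lim assms tendsto_minus)
  ultimately show "l2_pairing u (abs_l2 (\<lambda>x. vector_derivative \<psi> (at x))) = - l2_pairing g (abs_l2 \<psi>)"
    using assms(1) \<psi> LIMSEQ_unique by (simp add: has_weak_derivative_def)
qed

lemma H1_0_closed:
  assumes "\<And>k. X k \<in> H1_0" "X \<longlonglongrightarrow> u" "(\<lambda>k. weak_derivative (X k)) \<longlonglongrightarrow> g"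
  shows "u \<in> H1_0" "weak_derivative u = g"
proof -
  have XH: "X k \<in> H1" for k using assms(1) by (simp add: H1_0_def)
  have ug: "has_weak_derivative u g"
    by (rule has_weak_derivative_limit[OF has_weak_derivative_weak_derivative[OF XH] assms(2,3)])
  then show wd: "weak_derivative u = g" by (rule weak_derivative_eqI)
  have uH: "u \<in> H1" using ug by (auto simp: H1_def)
  have "(\<lambda>k. (u - X k, weak_derivative u - weak_derivative (X k))) \<longlonglongrightarrow> (u - u, weak_derivative u - g)"
    by (intro tendsto_intros assms)
  then have "(\<lambda>k. H1_norm (u - X k)) \<longlonglongrightarrow> norm (u - u, weak_derivative u - g)"
    using tendsto_norm XH uH by (fastforce simp: H1_norm_prod H1_diff_weak_derivative)
  then have lim: "(\<lambda>k. H1_norm (u - X k)) \<longlonglongrightarrow> 0" by (simp add: wd zero_prod_def[symmetric])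
  have "\<exists>\<psi>. test_function \<psi> \<and> H1_norm (u - abs_l2 \<psi>) < e" if "e > 0" for e
  proof -
    obtain k where k: "H1_norm (u - X k) < e / 2"
      using order_tendstoD(2)[OF lim, of "e / 2"] \<open>e > 0\<close> by (auto simp: eventually_sequentially)
    obtain \<psi> where \<psi>: "test_function \<psi>" "H1_norm (X k - abs_l2 \<psi>) < e / 2"
      using assms(1)[of k] \<open>e > 0\<close> by (auto simp: H1_0_def dest: spec[of _ "e / 2"])
    have "H1_norm ((u - X k) + (X k - abs_l2 \<psi>)) \<le> H1_norm (u - X k) + H1_norm (X k - abs_l2 \<psi>)"
      by (intro H1_norm_add_le H1_diff uH XH test_function_H1 \<psi>)
    then show ?thesis using k \<psi> by (intro exI[of _ \<psi>]) simp
  qed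
  then show "u \<in> H1_0" using uH by (simp add: H1_0_def)
qed

lemma norm_h10: "norm u = norm (weak_derivative (Rep_h10 u))"
  by (simp add: norm_h10_def inner_h10_def norm_eq_sqrt_inner)

lemma weak_derivative_Rep_h10_diff:
  "weak_derivative (Rep_h10 (u - v)) = weak_derivative (Rep_h10 u) - weak_derivative (Rep_h10 v)"
  by (simp add: minus_h10.rep_eq H1_diff_weak_derivative Rep_h10_H1)

lemma norm_Rep_h10_le: "norm (Rep_h10 u) \<le> norm u"
  unfolding norm_h10 by (intro H1_0_poincare Rep_h10)

lemma bounded_linear_Rep_h10: "bounded_linear Rep_h10"
  by (rule bounded_linear_intro[of _ 1])
     (simp_all add: plus_h10.rep_eq scaleR_h10.rep_eq norm_Rep_h10_le)

lemma bounded_linear_weak_derivative_Rep_h10: "bounded_linear (\<lambda>u. weak_derivative (Rep_h10 u))"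
  by (rule bounded_linear_intro[of _ 1])
     (simp_all add: plus_h10.rep_eq scaleR_h10.rep_eq H1_add H1_scaleR Rep_h10_H1 norm_h10)

text \<open>The norm of \<open>h10\<close> sees the derivative alone. Poincare's inequality makes
  the functions themselves a Cauchy sequence as well, and closedness identifies the limit of the
  derivatives.\<close>

lemma h10_Cauchy_convergent:
  fixes X :: "nat \<Rightarrow> h10"
  assumes "Cauchy X"
  shows "convergent X"
proof -
  obtain u g where ug: "(\<lambda>k. Rep_h10 (X k)) \<longlonglongrightarrow> u" "(\<lambda>k. weak_derivative (Rep_h10 (X k))) \<longlonglongrightarrow> g"
    using bounded_linear.Cauchy[OF bounded_linear_Rep_h10 assms]
      bounded_linear.Cauchy[OF bounded_linear_weak_derivative_Rep_h10 assms]
    by (auto simp: Cauchy_convergent_iff convergent_def)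
  note u = H1_0_closed[OF Rep_h10 ug]
  have "(\<lambda>k. norm (weak_derivative (Rep_h10 (X k)) - g)) \<longlonglongrightarrow> 0"
    using ug(2) by (simp add: LIM_zero tendsto_norm_zero)
  then have "(\<lambda>k. norm (X k - Abs_h10 u)) \<longlonglongrightarrow> 0"
    by (simp add: norm_h10 weak_derivative_Rep_h10_diff Abs_h10_inverse u)
  then have "X \<longlonglongrightarrow> Abs_h10 u" by (simp add: tendsto_norm_zero_iff LIM_zero_iff)
  then show ?thesis by (auto simp: convergent_def)
qed

instance h10 :: banach
  by standard (rule h10_Cauchy_convergent)

section \<open>Approximation by test functions and integration by parts\<close>

text \<open>Shaped for cutoffs: \<open>r k\<close> will be one minus the cutoff, which is at most 1
  and tends to 0 at each interior point, so dominated convergence applies to the squares.\<close>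

lemma l2_tendsto_dominated:
  assumes sq: "\<And>k. square_integrable (f k)" "square_integrable g"
    and le: "\<And>k x. x \<in> {0<..<1} \<Longrightarrow> cmod (f k x - g x) \<le> B * r k x"
    and r: "\<And>k x. x \<in> {0<..<1} \<Longrightarrow> 0 \<le> r k x \<and> r k x \<le> 1"
      "\<And>x. x \<in> {0<..<1} \<Longrightarrow> (\<lambda>k. r k x) \<longlonglongrightarrow> 0"
  shows "(\<lambda>k. abs_l2 (f k)) \<longlonglongrightarrow> abs_l2 g"
proof -
  have sd: "square_integrable (\<lambda>x. f k x - g x)" for k by (intro square_integrable_diff sq)
  have "(\<lambda>k. LINT x|unit_interval. (cmod (f k x - g x))\<^sup>2) \<longlonglongrightarrow> (LINT x|unit_interval. 0)"
  proof (rule integral_dominated_convergence)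
    show "integrable unit_interval (\<lambda>x. B\<^sup>2)"
      using square_integrable_const[of "of_real B"] by (simp add: square_integrable_def)
    show "(\<lambda>x. (cmod (f k x - g x))\<^sup>2) \<in> borel_measurable unit_interval" for k
      using sd[of k] by (simp add: square_integrable_def borel_measurable_integrable)
    show "AE x in unit_interval. (\<lambda>k. (cmod (f k x - g x))\<^sup>2) \<longlonglongrightarrow> 0"
    proof (rule AE_I2)
      fix x assume "x \<in> space unit_interval"
      then have x: "x \<in> {0<..<1}" by simp
      have "(\<lambda>k. (B * r k x)\<^sup>2) \<longlonglongrightarrow> (B * 0)\<^sup>2" by (intro tendsto_intros r(2) x)
      then have lim: "(\<lambda>k. (B * r k x)\<^sup>2) \<longlonglongrightarrow> 0" by simp
      have "norm ((cmod (f k x - g x))\<^sup>2) \<le> (B * r k x)\<^sup>2" for k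
        using power_mono[OF le[OF x, of k] norm_ge_zero, of 2] by simp
      then show "(\<lambda>k. (cmod (f k x - g x))\<^sup>2) \<longlonglongrightarrow> 0"
        by (rule Lim_null_comparison[OF always_eventually[OF allI] lim])
    qed
    show "AE x in unit_interval. norm ((cmod (f k x - g x))\<^sup>2) \<le> B\<^sup>2" for k
    proof (rule AE_I2)
      fix x assume "x \<in> space unit_interval"
      then have x: "x \<in> {0<..<1}" by simp
      then have "cmod (f k x - g x) \<le> \<bar>B\<bar> * 1"
        using le[OF x, of k] r(1)[OF x, of k]
          mult_mono[of B "\<bar>B\<bar>" "r k x" 1] by linarith
      then have "(cmod (f k x - g x))\<^sup>2 \<le> \<bar>B\<bar>\<^sup>2" by (intro power_mono) auto
      then show "norm ((cmod (f k x - g x))\<^sup>2) \<le> B\<^sup>2" by simp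
    qed
  qed simp
  then have "(\<lambda>k. (norm (abs_l2 (f k) - abs_l2 g))\<^sup>2) \<longlonglongrightarrow> 0"
    by (simp add: l2_diff_abs sq norm_l2_abs_square[OF sd])
  then have "(\<lambda>k. norm (abs_l2 (f k) - abs_l2 g)) \<longlonglongrightarrow> 0"
    using tendsto_real_sqrt by fastforce
  then show ?thesis by (simp add: tendsto_norm_zero_iff LIM_zero_iff)
qed

text \<open>Boundary terms vanish through the test function, so \<open>f\<close> may have arbitrary
  boundary values; the cosines rely on this.\<close>

lemma has_weak_derivative_C1:
  assumes f: "\<And>x. (f has_vector_derivative f' x) (at x)" "continuous_on UNIV f'"
  shows "has_weak_derivative (abs_l2 f) (abs_l2 f')"
  unfolding has_weak_derivative_def
proof (intro allI impI)
  fix \<eta> assume \<eta>: "test_function \<eta>"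
  let ?\<eta>' = "\<lambda>x. vector_derivative \<eta> (at x)"
  have "continuous_on UNIV f"
    using f(1) by (intro continuous_at_imp_continuous_on ballI) (rule has_vector_derivative_continuous)
  then have sq: "square_integrable f" "square_integrable f'" using f(2) by (auto intro: square_integrable_continuous)
  note sq\<eta> = test_function_square_integrable[OF \<eta>]
  have i1: "integrable unit_interval (\<lambda>x. f x * ?\<eta>' x)" and i2: "integrable unit_interval (\<lambda>x. f' x * \<eta> x)"
    using sq sq\<eta> by (auto intro: square_integrable_mult)
  have "((\<lambda>x. f x * ?\<eta>' x + f' x * \<eta> x) has_integral (f 1 * \<eta> 1 - f 0 * \<eta> 0)) {0..1}"
    by (intro fundamental_theorem_of_calculus has_vector_derivative_mult
          has_vector_derivative_at_within[OF f(1)]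
          has_vector_derivative_at_within[OF test_function_deriv(1)[OF \<eta>]]) simp
  then have "((\<lambda>x. f x * ?\<eta>' x + f' x * \<eta> x) has_integral 0) {0<..<1}"
    by (simp add: test_function_boundary[OF \<eta>] has_integral_Icc_iff_Ioo)
  moreover have "((\<lambda>x. f x * ?\<eta>' x + f' x * \<eta> x) has_integral
      (LINT x|unit_interval. f x * ?\<eta>' x + f' x * \<eta> x)) {0<..<1}"
    using i1 i2 by (intro has_integral_integral_lebesgue_on) auto
  ultimately have "(LINT x|unit_interval. f x * ?\<eta>' x + f' x * \<eta> x) = 0"
    using has_integral_unique by blast
  then have "(LINT x|unit_interval. f x * ?\<eta>' x) = - (LINT x|unit_interval. f' x * \<eta> x)"
    using i1 i2 by (simp add: eq_neg_iff_add_eq_0)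
  then show "l2_pairing (abs_l2 f) (abs_l2 ?\<eta>') = - l2_pairing (abs_l2 f') (abs_l2 \<eta>)"
    using sq sq\<eta> by (simp add: l2_pairing_abs)
qed

lemma test_function_H1_0: "test_function \<psi> \<Longrightarrow> abs_l2 \<psi> \<in> H1_0"
  using test_function_H1 H1_scaleR(2)[of "abs_l2 \<psi>" 0]
  by (auto simp: H1_0_def H1_norm_def intro!: exI[of _ \<psi>])

text \<open>Integrate the derivative from the nearer endpoint. The distance to the farther endpoint
  is then at least 1/2, which explains the factor 2.\<close>

lemma C1_vanishing_bound:
  fixes f :: "real \<Rightarrow> complex"
  assumes f: "\<And>x. (f has_vector_derivative f' x) (at x)" and z: "f 0 = 0" "f 1 = 0"
    and D: "\<And>x. x \<in> {0..1} \<Longrightarrow> cmod (f' x) \<le> D" and x: "x \<in> {0..1}"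
  shows "cmod (f x) \<le> 2 * D * (x * (1 - x))"
proof -
  have "D \<ge> 0" using order_trans[OF norm_ge_zero D[of 0]] by simp
  have b: "cmod (f v - f u) \<le> D * (v - u)" if "0 \<le> u" "u \<le> v" "v \<le> 1" for u v
  proof -
    have "(f' has_integral f v - f u) {u..v}"
      using that by (intro fundamental_theorem_of_calculus has_vector_derivative_at_within[OF f])
    then have "cmod (f v - f u) \<le> D * measure lborel {u..v}"
      by (intro has_integral_bound_real[OF \<open>D \<ge> 0\<close> finite.emptyI]) (use D that in auto)
    then show ?thesis using that by simp
  qed
  have "cmod (f x) \<le> D * x" "cmod (f x) \<le> D * (1 - x)"
    using b[of 0 x] b[of x 1] x z by auto
  moreover have "D * x \<le> 2 * D * (x * (1 - x))" if "x \<le> 1 / 2"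
    using mult_left_mono[of "1" "2 * (1 - x)" "D * x"] that x \<open>D \<ge> 0\<close> by (simp add: mult_ac)
  moreover have "D * (1 - x) \<le> 2 * D * (x * (1 - x))" if "x \<ge> 1 / 2"
    using mult_left_mono[of "1" "2 * x" "D * (1 - x)"] that x \<open>D \<ge> 0\<close> by (simp add: mult_ac)
  ultimately show ?thesis by linarith
qed

(* Multiply f by cutoffs vanishing near the boundary. Since f is O(x (1 - x)), the steep gradient
   of the cutoff, of size K on a layer of width 1 / K, is compensated. *)
lemma C1_vanishing_mem_H1_0:
  fixes f :: "real \<Rightarrow> complex"
  assumes f: "\<And>x. (f has_vector_derivative f' x) (at x)" "continuous_on UNIV f'"
    and z: "f 0 = 0" "f 1 = 0"
  shows "abs_l2 f \<in> H1_0"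
proof -
  have cf: "continuous_on UNIV f"
    using f(1) by (intro continuous_at_imp_continuous_on ballI) (rule has_vector_derivative_continuous)
  have "compact (f' ` {0..1})"
    by (intro compact_continuous_image continuous_on_subset[OF f(2)]) auto
  then obtain D where D: "\<And>x. x \<in> {0..1} \<Longrightarrow> cmod (f' x) \<le> D"
    using compact_imp_bounded bounded_iff by (metis imageI)
  have D0: "D \<ge> 0" using order_trans[OF norm_ge_zero D[of 0]] by simp
  \<comment> \<open>The offset 3 keeps \<open>1 / K k\<close> below 1/2 for every \<open>k\<close>,
    so that the cutoff lives on a nonempty interval.\<close>
  define K :: "nat \<Rightarrow> real" where "K k = real (k + 3)" for k
  have K: "K k \<ge> 3" "K k > 0" for k by (auto simp: K_def)
  define m where "m k x = max 0 ((x - 1 / K k) * (1 - 1 / K k - x))" for k x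
  \<comment> \<open>\<open>r k\<close> is one minus the cutoff, since the parameter
    \<open>(k + 3)\<^sup>2\<close> given to \<open>bump\<close> is \<open>(K k)\<^sup>2\<close>.
    Both error estimates are proportional to it.\<close>
  define r where "r k x = 1 / (1 + (K k * m k x)\<^sup>2)" for k x
  have r01: "0 \<le> r k x" "r k x \<le> 1" for k x by (auto simp: r_def divide_le_eq add_pos_nonneg)
  define \<theta> where "\<theta> k = bump (1 / K k) (1 - 1 / K k) ((k + 3)\<^sup>2)" for k
  have \<theta>: "\<theta> k x = 1 - r k x" for k x
    by (simp add: \<theta>_def bump_def r_def m_def K_def power_mult_distrib inverse_eq_divide)
  define \<theta>' where "\<theta>' k x = (K k)\<^sup>2 * (2 * m k x * (1 - 2 * x)) * (r k x)\<^sup>2" for k x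
  have \<theta>': "(\<theta> k has_real_derivative \<theta>' k x) (at x)" for k x
    using bump_deriv[of "1 / K k" "1 - 1 / K k" "(k + 3)\<^sup>2" x]
    by (simp add: \<theta>_def \<theta>'_def m_def r_def K_def power_mult_distrib power_divide)
  have c\<theta>': "continuous_on UNIV (\<theta>' k)" for k
  proof -
    have "1 + (K k * m k x)\<^sup>2 \<noteq> 0" for x by (smt (verit) zero_le_power2)
    then show ?thesis unfolding \<theta>'_def r_def m_def by (intro continuous_intros) auto
  qed
  have test\<theta>: "test_function (\<lambda>x. of_real (\<theta> k x))" for k
    unfolding \<theta>_def using K[of k] by (intro test_function_bump) (auto simp: field_simps)
  define \<psi> where "\<psi> k x = f x * of_real (\<theta> k x)" for k x
  define \<psi>' where "\<psi>' k x = f x * of_real (\<theta>' k x) + f' x * of_real (\<theta> k x)" for k x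
  have \<psi>': "(\<psi> k has_vector_derivative \<psi>' k x) (at x)" for k x
    unfolding \<psi>_def \<psi>'_def by (intro has_vector_derivative_mult f(1) has_vector_derivative_of_real \<theta>')
  have c\<psi>': "continuous_on UNIV (\<psi>' k)" for k
    unfolding \<psi>'_def
    by (intro continuous_intros cf f(2) c\<theta>' test_function_deriv(3)[OF test\<theta>])
  have test: "test_function (\<psi> k)" for k
  proof -
    have "\<psi> k C1_differentiable_on UNIV"
      using \<psi>' c\<psi>' unfolding C1_differentiable_on_def by blast
    moreover obtain L where "compact L" "L \<subseteq> {0<..<1}" "\<forall>x. x \<notin> L \<longrightarrow> complex_of_real (\<theta> k x) = 0"
      using test\<theta>[of k] by (auto simp: test_function_def)
    ultimately show ?thesis
      unfolding test_function_def \<psi>_def by (metis mult_zero_right)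
  qed
  have \<psi>_wd: "weak_derivative (abs_l2 (\<psi> k)) = abs_l2 (\<psi>' k)" for k
    by (intro weak_derivative_eqI has_weak_derivative_C1 \<psi>' c\<psi>')
  have rlim: "(\<lambda>k. r k x) \<longlonglongrightarrow> 0" if x: "x \<in> {0<..<1}" for x
  proof -
    define d where "d = x * (1 - x)"
    have d: "d > 0" using x by (simp add: d_def)
    have le: "K k * d - 1 \<le> 1 + (K k * m k x)\<^sup>2" for k
    proof -
      have "(x - 1 / K k) * (1 - 1 / K k - x) = d - 1 / K k + (1 / K k)\<^sup>2"
        by (simp add: d_def power2_eq_square algebra_simps)
      then have "d - 1 / K k \<le> m k x" unfolding m_def using zero_le_power2[of "1 / K k"] by linarith
      then have "K k * (d - 1 / K k) \<le> K k * m k x" using K[of k] by (intro mult_left_mono) auto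
      then have "K k * d - 1 \<le> K k * m k x" using K[of k] by (simp add: algebra_simps)
      also have "\<dots> \<le> 1 + (K k * m k x)\<^sup>2"
        using zero_le_power2[of "K k * m k x - 1 / 2"] unfolding power2_diff by (simp add: power_one_over)
      finally show ?thesis .
    qed
    have "filterlim (\<lambda>k. (3 * d - 1) + real k * d) at_top sequentially"
      by (intro filterlim_tendsto_add_at_top[OF tendsto_const]
          filterlim_at_top_mult_tendsto_pos[OF tendsto_const d] filterlim_real_sequentially)
    then have "filterlim (\<lambda>k. K k * d - 1) at_top sequentially"
      by (simp add: K_def algebra_simps)
    then have "filterlim (\<lambda>k. 1 + (K k * m k x)\<^sup>2) at_top sequentially"
      by (rule filterlim_at_top_mono) (simp only: le eventually_True)
    from tendsto_inverse_0_at_top[OF this] show ?thesis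
      unfolding r_def by (simp add: inverse_eq_divide)
  qed
  have fb: "cmod (f x) \<le> 2 * D * (x * (1 - x))" if "x \<in> {0..1}" for x
    using C1_vanishing_bound[OF f(1) z D that] .
  have fD: "cmod (f x) \<le> 9 * D" if x: "x \<in> {0<..<1}" for x
  proof -
    have "x * (1 - x) \<le> 1 * 1" using x by (intro mult_mono) auto
    then show ?thesis using fb[of x] x mult_left_mono[of "x * (1 - x)" 1 "2 * D"] D0 by auto
  qed
  have steep: "cmod (f x) * \<bar>\<theta>' k x\<bar> \<le> 8 * D * r k x" if x: "x \<in> {0<..<1}" for k x
  proof (cases "m k x > 0")
    case False
    then have "m k x = 0" by (simp add: m_def max_def split: if_splits)
    then show ?thesis using D0 r01[of k x] by (simp add: \<theta>'_def)
  next
    case True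
    \<comment> \<open>In terms of \<open>s\<close>, the distance factor \<open>x * (1 - x)\<close>
      is at most \<open>(s + 1) / K k\<close> and the slope of the cutoff at most
      \<open>2 * K k * s * (r k x)\<^sup>2\<close>, so \<open>K k\<close> cancels. As
      \<open>r k x * (1 + s\<^sup>2) = 1\<close> and
      \<open>s * (s + 1) \<le> 2 * (1 + s\<^sup>2)\<close>, one factor \<open>r k x\<close>
      survives.\<close>
    define s where "s = K k * m k x"
    have s: "s > 0" using True K[of k] by (simp add: s_def)
    have "m k x = (x - 1 / K k) * (1 - 1 / K k - x)" using True by (simp add: m_def max_def split: if_splits)
    also have "\<dots> = x * (1 - x) - 1 / K k * (1 - 1 / K k)" by (simp add: algebra_simps)
    finally have "x * (1 - x) \<le> m k x + 1 / K k"
      using K[of k] mult_left_mono[of "1 - 1 / K k" 1 "1 / K k"] by simp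
    then have "K k * (x * (1 - x)) \<le> K k * (m k x + 1 / K k)" using K[of k] by (intro mult_left_mono) auto
    then have xs: "K k * (x * (1 - x)) \<le> s + 1" using K[of k] by (simp add: s_def algebra_simps)
    have "\<bar>\<theta>' k x\<bar> = 2 * K k * s * \<bar>1 - 2 * x\<bar> * (r k x)\<^sup>2"
      using True K[of k] by (simp add: \<theta>'_def s_def abs_mult power2_eq_square)
    also have "\<dots> \<le> 2 * K k * s * 1 * (r k x)\<^sup>2"
      using x s K[of k] by (intro mult_right_mono mult_left_mono) auto
    finally have "cmod (f x) * \<bar>\<theta>' k x\<bar> \<le> (2 * D * (x * (1 - x))) * (2 * K k * s * 1 * (r k x)\<^sup>2)"
      using fb[of x] x D0 by (intro mult_mono) auto
    also have "\<dots> = 4 * D * s * (r k x)\<^sup>2 * (K k * (x * (1 - x)))" by simp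
    also have "\<dots> \<le> 4 * D * s * (r k x)\<^sup>2 * (s + 1)" using xs D0 s by (intro mult_left_mono) auto
    also have "\<dots> = 4 * D * (r k x)\<^sup>2 * (s * (s + 1))" by simp
    also have "\<dots> \<le> 4 * D * (r k x)\<^sup>2 * (2 * (1 + s\<^sup>2))"
      using D0 sum_squares_bound[of 1 s] s by (intro mult_left_mono) (auto simp: power2_eq_square algebra_simps)
    also have "\<dots> = 8 * D * r k x * (r k x * (1 + s\<^sup>2))" by (simp add: power2_eq_square)
    also have "r k x * (1 + s\<^sup>2) = 1"
      using add_pos_nonneg[of 1 "s\<^sup>2"] by (simp add: r_def s_def)
    finally show ?thesis by simp
  qed
  have sq: "square_integrable f" "square_integrable f'" "square_integrable (\<psi> k)" "square_integrable (\<psi>' k)" for k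
    using cf f(2) c\<psi>' test_function_square_integrable(1)[OF test] by (auto intro: square_integrable_continuous)
  have "(\<lambda>k. abs_l2 (\<psi> k)) \<longlonglongrightarrow> abs_l2 f"
  proof (rule l2_tendsto_dominated[OF sq(3,1) _ _ rlim])
    fix k and x :: real assume x: "x \<in> {0<..<1}"
    have "\<psi> k x - f x = - (f x * of_real (r k x))" by (simp add: \<psi>_def \<theta> algebra_simps)
    then show "cmod (\<psi> k x - f x) \<le> 9 * D * r k x"
      using mult_right_mono[OF fD[OF x] r01(1)] r01(1)[of k x] by (simp add: norm_mult)
  qed (use r01 in auto)
  moreover have "(\<lambda>k. abs_l2 (\<psi>' k)) \<longlonglongrightarrow> abs_l2 f'"
  proof (rule l2_tendsto_dominated[OF sq(4,2) _ _ rlim])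
    fix k and x :: real assume x: "x \<in> {0<..<1}"
    have "\<psi>' k x - f' x = f x * of_real (\<theta>' k x) - f' x * of_real (r k x)"
      by (simp add: \<psi>'_def \<theta> algebra_simps)
    also have "cmod \<dots> \<le> cmod (f x) * \<bar>\<theta>' k x\<bar> + cmod (f' x) * r k x"
      using norm_triangle_ineq4[of "f x * of_real (\<theta>' k x)" "f' x * of_real (r k x)"] r01(1)[of k x]
      by (simp add: norm_mult)
    also have "\<dots> \<le> 8 * D * r k x + D * r k x"
      using steep[OF x] D[of x] x r01 by (intro add_mono mult_right_mono) auto
    finally show "cmod (\<psi>' k x - f' x) \<le> 9 * D * r k x" by simp
  qed (use r01 in auto)
  ultimately show ?thesis
    using H1_0_closed(1)[OF test_function_H1_0[OF test]] by (simp add: \<psi>_wd)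
qed

lemma H1_0_approx_sequence:
  assumes "u \<in> H1_0"
  obtains \<psi> where "\<And>k. test_function (\<psi> k)" "(\<lambda>k. abs_l2 (\<psi> k)) \<longlonglongrightarrow> u"
    "(\<lambda>k. weak_derivative (abs_l2 (\<psi> k))) \<longlonglongrightarrow> weak_derivative u"
proof -
  have "\<exists>\<psi>. test_function \<psi> \<and> norm (u - abs_l2 \<psi>) < 1 / real (Suc k)
      \<and> norm (weak_derivative u - weak_derivative (abs_l2 \<psi>)) < 1 / real (Suc k)" for k
    by (rule H1_0_approx[OF assms, of "1 / real (Suc k)"]) auto
  then obtain \<psi> where \<psi>: "\<And>k. test_function (\<psi> k)" "\<And>k. norm (u - abs_l2 (\<psi> k)) < 1 / real (Suc k)"
    "\<And>k. norm (weak_derivative u - weak_derivative (abs_l2 (\<psi> k))) < 1 / real (Suc k)" by metis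
  have lim: "X \<longlonglongrightarrow> l" if "\<And>k. norm (l - X k) < 1 / real (Suc k)" for X :: "nat \<Rightarrow> l2" and l
  proof -
    have "(\<lambda>k. X k - l) \<longlonglongrightarrow> 0"
      by (rule Lim_null_comparison[OF _ LIMSEQ_Suc[OF lim_1_over_n]])
         (use that in \<open>auto intro!: always_eventually less_imp_le simp: norm_minus_commute\<close>)
    then show ?thesis by (simp add: LIM_zero_iff)
  qed
  show ?thesis by (rule that[OF \<psi>(1) lim[OF \<psi>(2)] lim[OF \<psi>(3)]])
qed

text \<open>By definition this holds for test functions in place of \<open>u\<close>. Both sides are
  continuous under simultaneous convergence of \<open>u\<close> and its weak derivative, so it
  extends to their closure.\<close>

lemma integration_by_parts:
  assumes v: "v \<in> H1" and u: "u \<in> H1_0"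
  shows "l2_pairing v (weak_derivative u) = - l2_pairing (weak_derivative v) u"
proof -
  obtain \<psi> where \<psi>: "\<And>k. test_function (\<psi> k)" "(\<lambda>k. abs_l2 (\<psi> k)) \<longlonglongrightarrow> u"
    "(\<lambda>k. weak_derivative (abs_l2 (\<psi> k))) \<longlonglongrightarrow> weak_derivative u"
    using H1_0_approx_sequence[OF u] by blast
  have "l2_pairing v (weak_derivative (abs_l2 (\<psi> k))) = - l2_pairing (weak_derivative v) (abs_l2 (\<psi> k))" for k
    using has_weak_derivative_weak_derivative[OF v] \<psi>(1)[of k]
      weak_derivative_eqI[OF has_weak_derivative_test_function[OF \<psi>(1)[of k]]]
    by (simp add: has_weak_derivative_def)
  then have e: "l2_pairing (weak_derivative (abs_l2 (\<psi> k))) v = - l2_pairing (abs_l2 (\<psi> k)) (weak_derivative v)" for k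
    by (simp add: l2_pairing_commute)
  have "(\<lambda>k. l2_pairing (weak_derivative (abs_l2 (\<psi> k))) v) \<longlonglongrightarrow> l2_pairing (weak_derivative u) v"
    by (intro bounded_linear.tendsto[OF bounded_linear_l2_pairing] \<psi>)
  moreover have "(\<lambda>k. l2_pairing (weak_derivative (abs_l2 (\<psi> k))) v) \<longlonglongrightarrow> - l2_pairing u (weak_derivative v)"
    unfolding e by (intro tendsto_minus bounded_linear.tendsto[OF bounded_linear_l2_pairing] \<psi>)
  ultimately show ?thesis using LIMSEQ_unique by (metis l2_pairing_commute)
qed

section \<open>The sine basis\<close>

text \<open>The factor \<open>sqrt 2\<close> normalises on an interval of length 1. The cosines are
  the normalised derivatives of the sines and serve for the derivative of the displacement.\<close>

definition sine :: "nat \<Rightarrow> real \<Rightarrow> real" where "sine n x = sqrt 2 * sin (freq n * x)"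
definition cosine :: "nat \<Rightarrow> real \<Rightarrow> real" where "cosine n x = sqrt 2 * cos (freq n * x)"

text \<open>\<open>l2\<close> is a real vector space, so complex multiples of a real function are
  introduced as a separate embedding of the complex coefficients.\<close>

definition l2_real :: "(real \<Rightarrow> real) \<Rightarrow> complex \<Rightarrow> l2" where
  "l2_real e z = abs_l2 (\<lambda>x. of_real (e x) * z)"

lemma square_integrable_of_real:
  "square_integrable e \<Longrightarrow> square_integrable (\<lambda>x. complex_of_real (e x) * z)"
  by (auto simp: square_integrable_def norm_mult power_mult_distrib)

lemma square_integrable_sine: "square_integrable (sine n)" "square_integrable (cosine n)"
proof -
  have c: "continuous_on UNIV (\<lambda>x. complex_of_real (sine n x))" "continuous_on UNIV (\<lambda>x. complex_of_real (cosine n x))"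
    unfolding sine_def cosine_def by (intro continuous_intros)+
  have *: "square_integrable e" if "square_integrable (\<lambda>x. complex_of_real (e x))" for e :: "real \<Rightarrow> real"
    using that by (auto simp: square_integrable_def borel_measurable_complex_iff)
  show "square_integrable (sine n)" "square_integrable (cosine n)"
    by (intro * square_integrable_continuous c)+
qed

(* Real-valued functions act on both components of the complex coordinate at once, which turns
   the real inner product of l2 into the complex pairing. *)
lemma inner_l2_real:
  assumes "square_integrable e"
  shows "inner u (l2_real e z) = inner (l2_pairing u (l2_real e 1)) z"
proof -
  note sq = rep_l2[of u] square_integrable_of_real[OF assms]
  have "inner (abs_l2 (rep_l2 u)) (l2_real e z) = Re (LINT x|unit_interval. (rep_l2 u x * of_real (e x)) * cnj z)"
    unfolding l2_real_def by (subst inner_l2_abs[OF sq]) (simp add: mult.assoc)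
  also have "\<dots> = Re ((LINT x|unit_interval. rep_l2 u x * of_real (e x)) * cnj z)"
    by (simp only: integral_mult_left_zero)
  also have "(LINT x|unit_interval. rep_l2 u x * of_real (e x)) = l2_pairing (abs_l2 (rep_l2 u)) (l2_real e 1)"
    unfolding l2_real_def using l2_pairing_abs[OF sq, of 1] by simp
  finally show ?thesis by (simp add: abs_rep_l2 inner_complex_def)
qed

lemma l2_pairing_real:
  assumes "square_integrable e" "square_integrable e'"
  shows "l2_pairing (l2_real e z) (l2_real e' 1) = of_real (LINT x|unit_interval. e x * e' x) * z"
proof -
  have "l2_pairing (l2_real e z) (l2_real e' 1) = (LINT x|unit_interval. of_real (e x * e' x) * z)"
    using l2_pairing_abs[OF square_integrable_of_real[OF assms(1), of z] square_integrable_of_real[OF assms(2), of 1]]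
    by (simp add: l2_real_def mult_ac)
  also have "\<dots> = of_real (LINT x|unit_interval. e x * e' x) * z"
    by (simp only: integral_mult_left_zero integral_complex_of_real)
  finally show ?thesis .
qed

lemma LINT_unit_interval_eqI:
  fixes f :: "real \<Rightarrow> real"
  assumes "continuous_on UNIV f" "(f has_integral I) {0..1}"
  shows "(LINT x|unit_interval. f x) = I"
proof -
  have "square_integrable (\<lambda>x. complex_of_real (f x))"
    by (intro square_integrable_continuous continuous_intros assms)
  then have "integrable unit_interval (\<lambda>x. complex_of_real (f x))"
    using square_integrable_mult[OF _ square_integrable_const[of 1]] by simp
  then have "integrable unit_interval f" by (simp add: complex_of_real_integrable_eq)
  then have "(f has_integral (LINT x|unit_interval. f x)) {0<..<1}"
    by (intro has_integral_integral_lebesgue_on) auto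
  moreover have "(f has_integral I) {0<..<1}"
    using assms(2) by (simp add: has_integral_Icc_iff_Ioo)
  ultimately show ?thesis by (rule has_integral_unique)
qed

lemma has_integral_cos_int:
  "((\<lambda>x. cos (of_int k * pi * x)) has_integral (if k = 0 then 1 else 0)) {0..1}"
proof (cases "k = 0")
  case True
  then show ?thesis using has_integral_const_real[of "1::real" 0 1] by simp
next
  case False
  have "((\<lambda>x. cos (of_int k * pi * x)) has_integral
      sin (of_int k * pi * 1) / (of_int k * pi) - sin (of_int k * pi * 0) / (of_int k * pi)) {0..1}"
    using False by (intro fundamental_theorem_of_calculus)
      (auto intro!: derivative_eq_intros simp flip: has_real_derivative_iff_has_vector_derivative)
  then show ?thesis using False sin_npi_int[of k] by (simp add: mult.commute)
qed

lemma orthonormal_sine: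
  "(LINT x|unit_interval. sine m x * sine n x) = (if m = n then 1 else 0)"
  "(LINT x|unit_interval. cosine m x * cosine n x) = (if m = n then 1 else 0)"
proof -
  define j k where "j = int m - int n" and "k = int m + int n + 2"
  have jk: "k \<noteq> 0" "j = 0 \<longleftrightarrow> m = n" by (auto simp: j_def k_def)
  have arg: "freq m * x - freq n * x = of_int j * pi * x" "freq m * x + freq n * x = of_int k * pi * x" for x
    by (simp_all add: j_def k_def freq_def algebra_simps)
  have e: "sine m x * sine n x = cos (of_int j * pi * x) - cos (of_int k * pi * x)"
    "cosine m x * cosine n x = cos (of_int j * pi * x) + cos (of_int k * pi * x)" for x
    unfolding arg[symmetric] cos_diff cos_add by (simp_all add: sine_def cosine_def)
  have "((\<lambda>x. cos (of_int j * pi * x) - cos (of_int k * pi * x)) has_integral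
      (if j = 0 then 1 else 0) - (if k = 0 then 1 else 0)) {0..1}"
    by (intro has_integral_diff has_integral_cos_int)
  then show "(LINT x|unit_interval. sine m x * sine n x) = (if m = n then 1 else 0)"
    unfolding e by (intro LINT_unit_interval_eqI continuous_intros) (simp add: jk)
  have "((\<lambda>x. cos (of_int j * pi * x) + cos (of_int k * pi * x)) has_integral
      (if j = 0 then 1 else 0) + (if k = 0 then 1 else 0)) {0..1}"
    by (intro has_integral_add has_integral_cos_int)
  then show "(LINT x|unit_interval. cosine m x * cosine n x) = (if m = n then 1 else 0)"
    unfolding e by (intro LINT_unit_interval_eqI continuous_intros) (simp add: jk)
qed

text \<open>A product of \<open>sin (n * pi * x)\<close> and \<open>cos (pi * x)\<close> is half the
  sum of the sines with neighbouring indices, so orthogonality to all sines survives each further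
  factor \<open>cos (pi * x)\<close>. Hence \<open>n\<close> must vary in the induction.\<close>

lemma sine_orthogonal_cos_power:
  fixes g :: "real \<Rightarrow> complex"
  assumes g: "square_integrable g"
    and orth: "\<And>n. (LINT x|unit_interval. g x * of_real (sin (real n * pi * x))) = 0"
  shows "(LINT x|unit_interval. g x * of_real (sin (real n * pi * x) * cos (pi * x) ^ i)) = 0"
proof (induction i arbitrary: n)
  case 0
  then show ?case using orth by simp
next
  case (Suc i)
  note IH = Suc.IH
  show ?case
  proof (cases n)
    case (Suc m)
    have int: "integrable unit_interval (\<lambda>x. g x * of_real (sin (real k * pi * x) * cos (pi * x) ^ i))" for k
      by (intro square_integrable_mult g square_integrable_continuous continuous_intros)
    have eq: "g x * of_real (sin (real n * pi * x) * cos (pi * x) ^ Suc i) =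
        (1 / 2) * (g x * of_real (sin (real (Suc n) * pi * x) * cos (pi * x) ^ i)) +
        (1 / 2) * (g x * of_real (sin (real m * pi * x) * cos (pi * x) ^ i))" for x
    proof -
      have "real (Suc n) * pi * x = real n * pi * x + pi * x" "real m * pi * x = real n * pi * x - pi * x"
        using Suc by (simp_all add: algebra_simps)
      then have "sin (real n * pi * x) * cos (pi * x) = (sin (real (Suc n) * pi * x) + sin (real m * pi * x)) / 2"
        by (simp add: sin_add sin_diff)
      then have "sin (real n * pi * x) * cos (pi * x) ^ Suc i =
          (sin (real (Suc n) * pi * x) + sin (real m * pi * x)) / 2 * cos (pi * x) ^ i"
        unfolding power_Suc mult.assoc[symmetric] by (simp only:)
      moreover have "z * of_real ((S + R) / 2 * C) = (1 / 2) * (z * of_real (S * C)) + (1 / 2) * (z * of_real (R * C))"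
        for z :: complex and S R C :: real
        by (simp add: algebra_simps add_divide_distrib)
      ultimately show ?thesis by (simp only:)
    qed
    show ?thesis
      unfolding eq Bochner_Integration.integral_add[OF integrable_mult_right[OF int] integrable_mult_right[OF int]]
        integral_mult_right_zero IH by simp
  qed simp
qed

text \<open>Divide by \<open>sin (pi * x)\<close>, which is harmless because \<open>\<psi>\<close>
  vanishes near the endpoints, substitute \<open>y = cos (pi * x)\<close> and approximate the
  resulting function of \<open>y\<close> by polynomials.\<close>

lemma continuous_compact_support_approx:
  fixes \<psi> :: "real \<Rightarrow> real"
  assumes \<psi>: "continuous_on UNIV \<psi>" and L: "compact L" "L \<subseteq> {0<..<1}" "\<And>x. x \<notin> L \<Longrightarrow> \<psi> x = 0" and e: "e > 0"
  obtains a N where "\<And>x. x \<in> {0<..<1} \<Longrightarrow> \<bar>\<psi> x - sin (pi * x) * (\<Sum>i\<le>N. a i * cos (pi * x) ^ i)\<bar> < e"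
proof -
  have sin_pos: "sin (pi * x) > 0" if "x \<in> {0<..<1}" for x
    using that by (intro sin_gt_zero) auto
  \<comment> \<open>Where the sine vanishes this is 0 divided by 0, hence 0. So \<open>h\<close>
    vanishes on the open complement of \<open>L\<close>, and the two open sets
    \<open>{0<..<1}\<close> and \<open>- L\<close> cover the line.\<close>
  define h where "h x = \<psi> x / sin (pi * x)" for x
  have "continuous_on {0<..<1} h"
    unfolding h_def using sin_pos
    by (intro continuous_intros continuous_on_subset[OF \<psi>]) force+
  moreover have "continuous_on (- L) h"
    by (rule continuous_on_eq[of _ "\<lambda>x. 0"]) (auto simp: h_def L)
  moreover have "{0<..<1} \<union> - L = UNIV" using L by auto
  ultimately have "continuous_on UNIV h"
    using continuous_on_open_Un[of "{0<..<1}" "- L" h] compact_imp_closed[OF L(1)] by (simp add: open_Compl)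
  then have ch: "continuous_on {0..1} h" by (rule continuous_on_subset) simp
  define F where "F y = h (arccos y / pi)" for y
  have "continuous_on {-1..1} F"
    unfolding F_def
    by (rule continuous_on_compose2[OF ch])
       (auto intro!: continuous_intros simp: arccos_lbound arccos_ubound divide_le_eq)
  then obtain p where p: "real_polynomial_function p" "\<And>y. y \<in> {-1..1} \<Longrightarrow> \<bar>F y - p y\<bar> < e"
    using Stone_Weierstrass_real_polynomial_function[of "{-1..1::real}" F e] e by auto
  obtain a N where a: "p = (\<lambda>y. \<Sum>i\<le>N. a i * y ^ i)"
    using p(1) by (auto simp: real_polynomial_function_iff_sum)
  show ?thesis
  proof (rule that)
    fix x :: real assume x: "x \<in> {0<..<1}"
    have "F (cos (pi * x)) = h x" using x by (simp add: F_def arccos_cos)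
    then have "\<bar>h x - p (cos (pi * x))\<bar> < e" using p(2)[of "cos (pi * x)"] by simp
    moreover have "\<psi> x - sin (pi * x) * p (cos (pi * x)) = sin (pi * x) * (h x - p (cos (pi * x)))"
      using sin_pos[OF x] by (simp add: h_def algebra_simps)
    moreover have "\<bar>sin (pi * x) * (h x - p (cos (pi * x)))\<bar> \<le> 1 * \<bar>h x - p (cos (pi * x))\<bar>"
      unfolding abs_mult by (intro mult_right_mono) auto
    ultimately show "\<bar>\<psi> x - sin (pi * x) * (\<Sum>i\<le>N. a i * cos (pi * x) ^ i)\<bar> < e"
      by (simp add: a)
  qed
qed

text \<open>Orthogonality to all sines passes to the sine of \<open>pi * x\<close> times polynomials
  in its cosine. These approximate compactly supported continuous functions uniformly, at an error
  of \<open>e\<close> times the integral of \<open>cmod (g x)\<close>, so \<open>g\<close> is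
  orthogonal to every test function.\<close>

lemma sine_total:
  assumes "\<And>n. l2_pairing v (l2_real (sine n) 1) = 0"
  shows "v = 0"
proof -
  define g where "g = rep_l2 v"
  have g: "square_integrable g" by (simp add: g_def rep_l2)
  have gi: "integrable unit_interval (\<lambda>x. cmod (g x))" by (rule l1_le_l2_norm(1)[OF g])
  have orth: "(LINT x|unit_interval. g x * of_real (sin (real n * pi * x))) = 0" for n
  proof (cases n)
    case (Suc m)
    have "0 = l2_pairing (abs_l2 g) (l2_real (sine m) 1)" using assms by (simp add: g_def abs_rep_l2)
    also have "\<dots> = (LINT x|unit_interval. of_real (sqrt 2) * (g x * of_real (sin (real n * pi * x))))"
      unfolding l2_real_def
      by (subst l2_pairing_abs[OF g square_integrable_of_real[OF square_integrable_sine(1)]])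
         (simp add: sine_def freq_def Suc mult_ac)
    finally show ?thesis by simp
  qed simp
  have real: "(LINT x|unit_interval. g x * of_real (\<psi> x)) = 0"
    if \<psi>: "continuous_on UNIV \<psi>" and L: "compact L" "L \<subseteq> {0<..<1}" "\<And>x. x \<notin> L \<Longrightarrow> \<psi> x = 0"
    for \<psi> :: "real \<Rightarrow> real" and L
  proof -
    define I where "I = (LINT x|unit_interval. cmod (g x))"
    have "cmod (LINT x|unit_interval. g x * of_real (\<psi> x)) \<le> e * I" if e: "e > 0" for e
    proof -
      obtain a N where a: "\<And>x. x \<in> {0<..<1} \<Longrightarrow> \<bar>\<psi> x - sin (pi * x) * (\<Sum>i\<le>N. a i * cos (pi * x) ^ i)\<bar> < e"
        using continuous_compact_support_approx[OF \<psi> L e] by blast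
      define S where "S x = sin (pi * x) * (\<Sum>i\<le>N. a i * cos (pi * x) ^ i)" for x
      have int: "integrable unit_interval (\<lambda>x. g x * of_real (\<psi> x))" "integrable unit_interval (\<lambda>x. g x * of_real (S x))"
        unfolding S_def by (intro square_integrable_mult g square_integrable_continuous continuous_intros \<psi>)+
      have "(LINT x|unit_interval. g x * of_real (S x)) =
          (LINT x|unit_interval. (\<Sum>i\<le>N. of_real (a i) * (g x * of_real (sin (real 1 * pi * x) * cos (pi * x) ^ i))))"
        by (simp add: S_def sum_distrib_left mult_ac)
      also have "\<dots> = (\<Sum>i\<le>N. LINT x|unit_interval. of_real (a i) * (g x * of_real (sin (real 1 * pi * x) * cos (pi * x) ^ i)))"
        by (intro Bochner_Integration.integral_sum integrable_mult_right square_integrable_mult g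
            square_integrable_continuous continuous_intros)
      also have "\<dots> = 0"
        using sine_orthogonal_cos_power[OF g orth, of 1] by simp
      finally have "(LINT x|unit_interval. g x * of_real (\<psi> x)) = (LINT x|unit_interval. g x * of_real (\<psi> x - S x))"
        using Bochner_Integration.integral_diff[OF int] by (simp add: right_diff_distrib)
      also have "cmod \<dots> \<le> (LINT x|unit_interval. e * cmod (g x))"
      proof (rule Bochner_Integration.integral_norm_bound_integral)
        show "integrable unit_interval (\<lambda>x. g x * of_real (\<psi> x - S x))"
          using Bochner_Integration.integrable_diff[OF int] by (simp add: right_diff_distrib)
        show "cmod (g x * of_real (\<psi> x - S x)) \<le> e * cmod (g x)" if "x \<in> space unit_interval" for x
          using a[of x] that mult_left_mono[of "\<bar>\<psi> x - S x\<bar>" e "cmod (g x)"]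
          by (simp add: S_def norm_mult mult.commute less_imp_le flip: of_real_diff)
      qed (use gi in simp)
      finally show ?thesis by (simp add: I_def)
    qed
    then have "\<forall>\<^sub>F e in at_right 0. cmod (LINT x|unit_interval. g x * of_real (\<psi> x)) \<le> e * I"
      by (simp add: eventually_at_right_less[THEN eventually_mono])
    moreover have "((\<lambda>e. e * I) \<longlongrightarrow> 0 * I) (at_right 0)" by (intro tendsto_intros)
    ultimately have "cmod (LINT x|unit_interval. g x * of_real (\<psi> x)) \<le> 0"
      by (intro tendsto_lowerbound[of "\<lambda>e. e * I" _ "at_right 0"]) auto
    then show ?thesis by simp
  qed
  have "AE x in unit_interval. g x = 0"
  proof (rule AE_zero_if_orthogonal_test_functions[OF g])
    fix \<psi> assume \<psi>: "test_function \<psi>"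
    obtain L where L: "compact L" "L \<subseteq> {0<..<1}" "\<And>x. x \<notin> L \<Longrightarrow> \<psi> x = 0"
      using \<psi> by (auto simp: test_function_def)
    note c\<psi> = test_function_deriv(3)[OF \<psi>]
    have cR: "continuous_on UNIV (\<lambda>x. Re (\<psi> x))" "continuous_on UNIV (\<lambda>x. Im (\<psi> x))"
      by (intro continuous_intros c\<psi>)+
    have int: "integrable unit_interval (\<lambda>x. g x * of_real (Re (\<psi> x)))" "integrable unit_interval (\<lambda>x. g x * of_real (Im (\<psi> x)))"
      by (intro square_integrable_mult g square_integrable_continuous continuous_intros c\<psi>)+
    have "(LINT x|unit_interval. g x * \<psi> x) =
        (LINT x|unit_interval. g x * of_real (Re (\<psi> x)) + \<i> * (g x * of_real (Im (\<psi> x))))"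
      by (rule Bochner_Integration.integral_cong) (simp_all add: complex_eq_iff algebra_simps)
    also have "\<dots> = 0"
      using int real[OF cR(1) L(1,2)] real[OF cR(2) L(1,2)] L(3) by simp
    finally show "(LINT x|unit_interval. g x * \<psi> x) = 0" .
  qed
  then have "abs_l2 g = abs_l2 (\<lambda>_. 0)"
    using g square_integrable_zero by (simp add: abs_l2_eq_iff)
  then show ?thesis by (simp add: g_def abs_rep_l2 zero_l2_def)
qed

section \<open>Modal form of the wave equation\<close>

lemma freq_pos: "freq n > 0"
  by (simp add: freq_def)

lemma l2_real_scaleR: "square_integrable e \<Longrightarrow> r *\<^sub>R l2_real e z = l2_real e (r *\<^sub>R z)"
  unfolding l2_real_def
  by (subst l2_scaleR_abs[OF square_integrable_of_real]) (simp_all add: scaleR_conv_of_real mult.left_commute)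

lemma l2_real_add: "square_integrable e \<Longrightarrow> l2_real e z + l2_real e w = l2_real e (z + w)"
  unfolding l2_real_def
  by (subst l2_add_abs[OF square_integrable_of_real square_integrable_of_real]) (simp_all add: distrib_left)

lemma weak_derivative_cosine:
  "l2_real (cosine n) z \<in> H1" "weak_derivative (l2_real (cosine n) z) = - freq n *\<^sub>R l2_real (sine n) z"
proof -
  have "has_weak_derivative (l2_real (cosine n) z) (l2_real (sine n) (- freq n *\<^sub>R z))"
    unfolding l2_real_def
  proof (rule has_weak_derivative_C1)
    fix x
    have "(cosine n has_real_derivative - freq n * sine n x) (at x)"
      unfolding cosine_def[abs_def] sine_def by (auto intro!: derivative_eq_intros)
    from has_vector_derivative_mult_left[OF has_vector_derivative_of_real[OF this], of z]
    show "((\<lambda>x. complex_of_real (cosine n x) * z) has_vector_derivative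
        complex_of_real (sine n x) * (- freq n *\<^sub>R z)) (at x)"
      by (simp add: scaleR_conv_of_real mult_ac)
  qed (auto intro!: continuous_intros simp: sine_def)
  then show "l2_real (cosine n) z \<in> H1" "weak_derivative (l2_real (cosine n) z) = - freq n *\<^sub>R l2_real (sine n) z"
    by (auto simp: H1_def weak_derivative_eqI l2_real_scaleR[OF square_integrable_sine(1)])
qed

lemma weak_derivative_sine:
  "l2_real (sine n) z \<in> H1_0" "weak_derivative (l2_real (sine n) z) = freq n *\<^sub>R l2_real (cosine n) z"
proof -
  have d: "((\<lambda>x. complex_of_real (sine n x) * z) has_vector_derivative
        complex_of_real (cosine n x) * (freq n *\<^sub>R z)) (at x)" for x
  proof -
    have "(sine n has_real_derivative freq n * cosine n x) (at x)"
      unfolding sine_def[abs_def] cosine_def by (auto intro!: derivative_eq_intros)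
    from has_vector_derivative_mult_left[OF has_vector_derivative_of_real[OF this], of z]
    show ?thesis by (simp add: scaleR_conv_of_real mult_ac)
  qed
  have c: "continuous_on UNIV (\<lambda>x. complex_of_real (cosine n x) * (freq n *\<^sub>R z))"
    by (auto intro!: continuous_intros simp: cosine_def)
  have "sin (freq n) = 0" using sin_npi_int[of "int (Suc n)"] by (simp add: freq_def mult.commute)
  then show "l2_real (sine n) z \<in> H1_0"
    unfolding l2_real_def by (intro C1_vanishing_mem_H1_0[OF d c]) (simp_all add: sine_def)
  show "weak_derivative (l2_real (sine n) z) = freq n *\<^sub>R l2_real (cosine n) z"
    unfolding l2_real_scaleR[OF square_integrable_sine(2)]
    by (rule weak_derivative_eqI, unfold l2_real_def, rule has_weak_derivative_C1[OF d c])
qed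

text \<open>Taken from the derivative, so that it equals \<open>freq n\<close> times the sine
  coefficient of the displacement and the energy norm becomes the plain sum of squares of all
  coordinates.\<close>

definition wave_P :: "nat \<Rightarrow> state \<Rightarrow> complex" where
  "wave_P n x = l2_pairing (weak_derivative (Rep_h10 (fst x))) (l2_real (cosine n) 1)"

definition wave_Q :: "nat \<Rightarrow> state \<Rightarrow> complex" where
  "wave_Q n x = l2_pairing (snd x) (l2_real (sine n) 1)"

text \<open>The division by \<open>freq n\<close> compensates the derivative in the norm of
  \<open>h10\<close>, which makes this an isometric embedding of coordinate pairs.\<close>

definition wave_mode :: "nat \<Rightarrow> complex \<times> complex \<Rightarrow> state" where
  "wave_mode n = (\<lambda>(z, w). (Abs_h10 (l2_real (sine n) (z /\<^sub>R freq n)), l2_real (sine n) w))"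

lemma Rep_wave_mode: "Rep_h10 (fst (wave_mode n (z, w))) = l2_real (sine n) (z /\<^sub>R freq n)"
  by (simp add: wave_mode_def Abs_h10_inverse weak_derivative_sine)

lemma weak_derivative_wave_mode:
  "weak_derivative (Rep_h10 (fst (wave_mode n (z, w)))) = l2_real (cosine n) z"
  using freq_pos[of n]
  by (simp add: Rep_wave_mode weak_derivative_sine l2_real_scaleR[OF square_integrable_sine(2)])

lemma inner_wave_mode: "inner x (wave_mode n a) = inner (wave_P n x, wave_Q n x) a"
proof -
  obtain z w where a: "a = (z, w)" by force
  have "inner (fst x) (fst (wave_mode n a)) = inner (wave_P n x) z"
    unfolding inner_h10_def a weak_derivative_wave_mode wave_P_def
    by (rule inner_l2_real[OF square_integrable_sine(2)])
  moreover have "inner (snd x) (snd (wave_mode n a)) = inner (wave_Q n x) w"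
    using inner_l2_real[OF square_integrable_sine(1)] by (simp add: a wave_mode_def wave_Q_def)
  ultimately show ?thesis by (simp add: inner_prod_def a)
qed

lemma wave_P_mode: "wave_P m (wave_mode n (z, w)) = (if m = n then z else 0)"
  unfolding wave_P_def weak_derivative_wave_mode
  by (auto simp: l2_pairing_real square_integrable_sine orthonormal_sine)

lemma wave_Q_mode: "wave_Q m (wave_mode n (z, w)) = (if m = n then w else 0)"
  by (auto simp: wave_Q_def wave_mode_def l2_pairing_real square_integrable_sine orthonormal_sine)

lemma wave_expansion:
  "(\<lambda>n. inner (wave_P n x) (wave_P n y) + inner (wave_Q n x) (wave_Q n y)) sums inner x y"
proof -
  have "(\<lambda>n. inner (wave_P n x, wave_Q n x) (wave_P n y, wave_Q n y)) sums inner x y"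
  proof (rule orthogonal_expansion[where E = wave_mode])
    show "inner (wave_mode m a) (wave_mode n c) = (if m = n then inner a c else 0)" for m n a c
      by (cases a; cases c) (auto simp: inner_wave_mode wave_P_mode wave_Q_mode)
    show "inner x (wave_mode n a) = inner (wave_P n x, wave_Q n x) a" for n x a
      by (rule inner_wave_mode)
    fix x :: state assume z: "\<And>n. (wave_P n x, wave_Q n x) = 0"
    have "snd x = 0"
      using z by (intro sine_total) (simp add: wave_Q_def zero_prod_def)
    \<comment> \<open>The cosines of positive frequency omit the constants, so completeness cannot
      be applied to the derivative itself. Integration by parts turns its cosine coefficients into
      sine coefficients of the displacement.\<close>
    moreover have "Rep_h10 (fst x) = 0"
    proof (rule sine_total)
      fix n
      have "0 = l2_pairing (l2_real (cosine n) 1) (weak_derivative (Rep_h10 (fst x)))"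
        using z[of n] by (simp add: wave_P_def zero_prod_def l2_pairing_commute)
      also have "\<dots> = freq n *\<^sub>R l2_pairing (l2_real (sine n) 1) (Rep_h10 (fst x))"
        using integration_by_parts[OF weak_derivative_cosine(1) Rep_h10]
        by (simp add: weak_derivative_cosine l2_pairing_scaleR_left
            linear_neg[OF bounded_linear.linear[OF bounded_linear_l2_pairing]] scaleR_conv_of_real)
      finally show "l2_pairing (Rep_h10 (fst x)) (l2_real (sine n) 1) = 0"
        using freq_pos[of n] by (simp add: l2_pairing_commute)
    qed
    then have "fst x = 0" using Rep_h10_inject[of "fst x" 0] by (simp add: zero_h10.rep_eq)
    ultimately show "x = 0" by (simp add: prod_eq_iff)
  qed
  then show ?thesis by (simp add: inner_prod_def)
qed

definition wave_coef :: "(real \<Rightarrow> real) \<Rightarrow> nat \<Rightarrow> real" where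
  "wave_coef b n = (LINT x|unit_interval. b x * sine n x)"

lemma control_eq: "control b z = (0, l2_real b z)"
  by (simp add: control_def l2_real_def)

lemma wave_P_control: "wave_P n (control b z) = 0"
proof -
  have "weak_derivative (Rep_h10 0) = 0"
    using linear_0[OF bounded_linear.linear[OF bounded_linear_weak_derivative_Rep_h10]] .
  then show ?thesis
    using linear_0[OF bounded_linear.linear[OF bounded_linear_l2_pairing]]
    by (simp add: wave_P_def control_eq)
qed

lemma wave_Q_control: "square_integrable b \<Longrightarrow> wave_Q n (control b z) = wave_coef b n *\<^sub>R z"
  by (simp add: wave_Q_def control_eq wave_coef_def l2_pairing_real square_integrable_sine scaleR_conv_of_real)

lemma observation_eq: "observation b x = l2_pairing (snd x) (l2_real b 1)"
  by (cases x) (simp add: observation_def l2_real_def l2_pairing_commute)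

lemma inner_control: "square_integrable b \<Longrightarrow> inner x (control b z) = inner (observation b x) z"
  by (simp add: control_eq inner_prod_def inner_l2_real observation_eq)

text \<open>The observation series is the Parseval identity paired with \<open>control b z\<close>,
  for \<open>z\<close> equal to 1 and to the imaginary unit; summability of the squared coefficients
  is the same identity for \<open>control b 1\<close> with itself.\<close>

lemma wave_modal_system:
  assumes b: "square_integrable b"
  shows "modal_system wave_P wave_Q (wave_coef b) (observation b)"
proof (rule modal_system.intro)
  show "bounded_linear (wave_P n)" for n
    unfolding wave_P_def[abs_def]
    by (rule bounded_linear_compose[OF bounded_linear_l2_pairing
          bounded_linear_compose[OF bounded_linear_weak_derivative_Rep_h10 bounded_linear_fst]])
  show "bounded_linear (wave_Q n)" for n
    unfolding wave_Q_def[abs_def] by (rule bounded_linear_compose[OF bounded_linear_l2_pairing bounded_linear_snd])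
  show "bounded_linear (observation b)"
    unfolding observation_eq[abs_def] by (rule bounded_linear_compose[OF bounded_linear_l2_pairing bounded_linear_snd])
  show "(\<lambda>n. (cmod (wave_P n x))\<^sup>2 + (cmod (wave_Q n x))\<^sup>2) sums (norm x)\<^sup>2" for x
    using wave_expansion[of x x] by (simp add: power2_norm_eq_inner)
  have s: "(\<lambda>n. inner (wave_coef b n *\<^sub>R wave_Q n x) z) sums inner (observation b x) z" for x z
    using wave_expansion[of x "control b z"] by (simp add: wave_P_control wave_Q_control inner_control b)
  show "(\<lambda>n. wave_coef b n *\<^sub>R wave_Q n x) sums observation b x" for x
    using s[of x 1] s[of x \<i>] by (simp add: sums_complex_iff inner_complex_def)
  show "summable (\<lambda>n. (wave_coef b n)\<^sup>2)"
    using sums_summable[OF wave_expansion[of "control b 1" "control b 1"]]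
    by (simp add: wave_P_control wave_Q_control b power2_eq_square)
qed

text \<open>Here the boundary condition is carried by the velocity; the cosine lies in
  \<open>H1\<close> only.\<close>

lemma wave_P_operator:
  assumes "x \<in> wave_domain"
  shows "wave_P n (wave_operator x) = freq n *\<^sub>R wave_Q n x"
proof -
  obtain u v where x: "x = (u, v)" by force
  have v: "v \<in> H1_0" using assms by (simp add: x wave_domain_def)
  have "wave_P n (wave_operator x) = l2_pairing (l2_real (cosine n) 1) (weak_derivative v)"
    by (simp add: x wave_operator_def wave_P_def Abs_h10_inverse v l2_pairing_commute)
  also have "\<dots> = - l2_pairing (- freq n *\<^sub>R l2_real (sine n) 1) v"
    using integration_by_parts[OF weak_derivative_cosine(1) v] by (simp add: weak_derivative_cosine(2))
  also have "\<dots> = freq n *\<^sub>R wave_Q n x"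
    using linear_scale[OF bounded_linear.linear[OF bounded_linear_l2_pairing], of "- freq n" "l2_real (sine n) 1" v]
    by (simp add: wave_Q_def x l2_pairing_commute[of v])
  finally show ?thesis .
qed

text \<open>Here the boundary condition is carried by the sine; the derivative of the displacement
  lies in \<open>H1\<close> only.\<close>

lemma wave_Q_operator:
  assumes "x \<in> wave_domain"
  shows "wave_Q n (wave_operator x) = - (freq n *\<^sub>R wave_P n x)"
proof -
  obtain u v where x: "x = (u, v)" by force
  have u: "weak_derivative (Rep_h10 u) \<in> H1" using assms by (simp add: x wave_domain_def H2_def)
  have "wave_Q n (wave_operator x) = - l2_pairing (weak_derivative (Rep_h10 u)) (freq n *\<^sub>R l2_real (cosine n) 1)"
    using integration_by_parts[OF u weak_derivative_sine(1)[of n 1]]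
    by (simp add: x wave_operator_def wave_Q_def weak_derivative_sine(2))
  also have "\<dots> = - (freq n *\<^sub>R wave_P n x)"
    using linear_scale[OF bounded_linear.linear[OF bounded_linear_l2_pairing], of "freq n" "l2_real (cosine n) 1"]
    by (simp add: wave_P_def x l2_pairing_commute[of "weak_derivative (Rep_h10 u)"])
  finally show ?thesis .
qed

lemma wave_mode_domain: "wave_mode n a \<in> wave_domain"
proof -
  obtain z w where a: "a = (z, w)" by force
  have "Rep_h10 (fst (wave_mode n a)) \<in> H1" by (rule Rep_h10_H1)
  moreover have "weak_derivative (Rep_h10 (fst (wave_mode n a))) \<in> H1"
    by (simp add: a weak_derivative_wave_mode weak_derivative_cosine)
  moreover have "snd (wave_mode n a) \<in> H1_0" by (simp add: a wave_mode_def weak_derivative_sine)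
  ultimately show ?thesis by (simp add: wave_domain_def H2_def case_prod_beta)
qed

lemma wave_operator_mode:
  "wave_operator (wave_mode n (z, w)) = wave_mode n (freq n *\<^sub>R w, - (freq n *\<^sub>R z))"
proof -
  have "weak_derivative (weak_derivative (Rep_h10 (fst (wave_mode n (z, w))))) = l2_real (sine n) (- (freq n *\<^sub>R z))"
    unfolding weak_derivative_wave_mode weak_derivative_cosine l2_real_scaleR[OF square_integrable_sine(1)] by simp
  moreover have "snd (wave_mode n (z, w)) = l2_real (sine n) w" by (simp add: wave_mode_def)
  ultimately show ?thesis
    using freq_pos[of n] by (simp add: wave_operator_def wave_mode_def)
qed

lemma classical_imp_solution:
  assumes b: "square_integrable b" and \<phi>: "continuous_on UNIV \<phi>"
    and x: "classical_solution wave_domain wave_operator (\<lambda>y. control b (\<phi> (observation b y))) x"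
  shows "modal_system.solution wave_P wave_Q (wave_coef b) x (\<lambda>t. \<phi> (observation b (x t)))"
proof -
  interpret modal_system wave_P wave_Q "wave_coef b" "observation b"
    using b by (rule wave_modal_system)
  obtain x' where x': "\<And>t. t \<ge> 0 \<Longrightarrow> (x has_vector_derivative x' t) (at t within {0..})"
    "\<And>t. t \<ge> 0 \<Longrightarrow> x t \<in> wave_domain"
    "\<And>t. t \<ge> 0 \<Longrightarrow> x' t = wave_operator (x t) - control b (\<phi> (observation b (x t)))"
    using x unfolding classical_solution_def by blast
  have cx: "continuous_on {0..} x"
    unfolding continuous_on_eq_continuous_within
    using x'(1) has_vector_derivative_continuous by (metis atLeast_iff)
  show ?thesis
  proof (rule solutionI[OF cx])
    show "continuous_on {0..} (\<lambda>t. \<phi> (observation b (x t)))"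
      by (rule continuous_on_compose2[OF \<phi> continuous_on_obs[OF cx]]) simp
    fix n and t :: real assume t: "t \<ge> 0"
    show "((\<lambda>t. wave_P n (x t)) has_vector_derivative freq n *\<^sub>R wave_Q n (x t)) (at t within {0..})"
      using bounded_linear.has_vector_derivative[OF bounded_linear_P x'(1)[OF t], of n]
      by (simp add: x'(3)[OF t] P_diff wave_P_operator[OF x'(2)[OF t]] wave_P_control)
    show "((\<lambda>t. wave_Q n (x t)) has_vector_derivative
        - (freq n *\<^sub>R wave_P n (x t)) - wave_coef b n *\<^sub>R \<phi> (observation b (x t))) (at t within {0..})"
      using bounded_linear.has_vector_derivative[OF bounded_linear_Q x'(1)[OF t], of n]
      by (simp add: x'(3)[OF t] Q_diff wave_Q_operator[OF x'(2)[OF t]] wave_Q_control b)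
  qed
qed

section \<open>The wave semigroup and mild solutions\<close>

lemma right_difference_quotient:
  assumes "(f has_vector_derivative D) (at 0 within {0..})"
  shows "((\<lambda>h. (f h - f 0) /\<^sub>R h) \<longlongrightarrow> D) (at_right 0)"
proof -
  have "((\<lambda>h. (1 / norm (h - 0)) *\<^sub>R (f h - (f 0 + (h - 0) *\<^sub>R D)) + D) \<longlongrightarrow> 0 + D) (at_right 0)"
    using assms by (intro tendsto_intros)
      (simp add: has_vector_derivative_def has_derivative_within at_within_Ici_at_right)
  then have "((\<lambda>h. (1 / norm (h - 0)) *\<^sub>R (f h - (f 0 + (h - 0) *\<^sub>R D)) + D) \<longlongrightarrow> D) (at_right 0)"
    by simp
  then show ?thesis
  proof (rule Lim_transform_eventually)
    show "\<forall>\<^sub>F h in at_right 0. (1 / norm (h - 0)) *\<^sub>R (f h - (f 0 + (h - 0) *\<^sub>R D)) + D = (f h - f 0) /\<^sub>R h"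
      using eventually_at_right_less[of 0]
      by (rule eventually_mono) (simp add: scaleR_diff_right scaleR_add_right divide_inverse)
  qed
qed

lemma contraction_semigroupD:
  assumes "contraction_semigroup T"
  shows "t \<ge> 0 \<Longrightarrow> linear (T t)" "t \<ge> 0 \<Longrightarrow> norm (T t x) \<le> norm x" "T 0 x = x"
    "s \<ge> 0 \<Longrightarrow> t \<ge> 0 \<Longrightarrow> T (s + t) x = T s (T t x)" "continuous_on {0..} (\<lambda>t. T t x)"
  using assms by (auto simp: contraction_semigroup_def)

text \<open>Consistency and stability give convergence: split \<open>[0, t]\<close> into equal
  steps, each adding an error \<open>\<delta> h\<close> that contractivity never amplifies. The
  total is \<open>t * (\<delta> h / h)\<close>, which tends to 0.\<close>

lemma contraction_semigroup_eqI:
  fixes T :: "real \<Rightarrow> 'a::real_normed_vector \<Rightarrow> 'a"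
  assumes T: "contraction_semigroup T"
    and y: "\<And>s h. s \<ge> 0 \<Longrightarrow> h > 0 \<Longrightarrow> norm (T h (y s) - y (s + h)) \<le> \<delta> h"
    and \<delta>: "((\<lambda>h. \<delta> h / h) \<longlongrightarrow> 0) (at_right 0)"
    and t: "t \<ge> 0"
  shows "T t (y 0) = y t"
proof (cases "t = 0")
  case True
  then show ?thesis by (simp add: contraction_semigroupD[OF T])
next
  case False
  then have t: "t > 0" using assms by simp
  have steps: "norm (T (real k * h) (y 0) - y (real k * h)) \<le> real k * \<delta> h" if h: "h > 0" for h k
  proof (induction k)
    case (Suc k)
    have k: "real k * h \<ge> 0" using h by simp
    have "T (real (Suc k) * h) (y 0) = T h (T (real k * h) (y 0))"
      using contraction_semigroupD(4)[OF T, of h "real k * h"] h by (simp add: algebra_simps)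
    then have "T (real (Suc k) * h) (y 0) - y (real (Suc k) * h) =
        T h (T (real k * h) (y 0) - y (real k * h)) + (T h (y (real k * h)) - y (real k * h + h))"
      using linear_diff[OF contraction_semigroupD(1)[OF T]] h by (simp add: algebra_simps)
    also have "norm \<dots> \<le> norm (T (real k * h) (y 0) - y (real k * h)) + \<delta> h"
      using contraction_semigroupD(2)[OF T, of h] y[OF k h] h
      by (intro order_trans[OF norm_triangle_ineq] add_mono) auto
    finally show ?case using Suc by (simp add: algebra_simps)
  qed (simp add: contraction_semigroupD[OF T])
  have "filterlim (\<lambda>k. t / real (Suc k)) (at_right 0) sequentially"
    using t LIMSEQ_Suc[OF lim_const_over_n[of t]]
    by (auto simp: filterlim_at intro!: always_eventually)
  then have "(\<lambda>k. t * (\<delta> (t / real (Suc k)) / (t / real (Suc k)))) \<longlonglongrightarrow> t * 0"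
    by (intro tendsto_intros filterlim_compose[OF \<delta>])
  moreover have "norm (T t (y 0) - y t) \<le> t * (\<delta> (t / real (Suc k)) / (t / real (Suc k)))" for k
  proof -
    have "t * (d / (t / real (Suc k))) = real (Suc k) * d" for d using t by simp
    then show ?thesis using steps[of "t / real (Suc k)" "Suc k"] t by (simp add: mult.commute)
  qed
  ultimately have "norm (T t (y 0) - y t) \<le> 0"
    by (intro LIMSEQ_le_const[of _ 0]) auto
  then show ?thesis by simp
qed

text \<open>In the inequality between the squared norms of \<open>T (x + r *\<^sub>R e)\<close> and
  \<open>x + r *\<^sub>R e\<close> the terms quadratic in \<open>r\<close> cancel. What remains is
  linear in \<open>r\<close> and bounded above, so its slope vanishes.\<close>

lemma contraction_inner:
  fixes T :: "'a::real_inner \<Rightarrow> 'a"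
  assumes T: "linear T" "\<And>x. norm (T x) \<le> norm x" and e: "norm (T e) = norm e"
  shows "inner (T x) (T e) = inner x e"
proof (rule ccontr)
  assume ne: "inner (T x) (T e) \<noteq> inner x e"
  define d where "d = inner (T x) (T e) - inner x e"
  have le: "2 * r * d \<le> (norm x)\<^sup>2" for r
  proof -
    have "(norm (T (x + r *\<^sub>R e)))\<^sup>2 \<le> (norm (x + r *\<^sub>R e))\<^sup>2"
      using T(2) by (intro power_mono) auto
    moreover have "(norm (u + r *\<^sub>R v))\<^sup>2 = (norm u)\<^sup>2 + 2 * r * inner u v + r\<^sup>2 * (norm v)\<^sup>2" for u v :: 'a
      unfolding power2_norm_eq_inner
      by (simp add: inner_add_left inner_add_right inner_commute[of v u] power2_eq_square[of r] distrib_left)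
    ultimately have "(norm (T x))\<^sup>2 + 2 * r * inner (T x) (T e) + r\<^sup>2 * (norm (T e))\<^sup>2
        \<le> (norm x)\<^sup>2 + 2 * r * inner x e + r\<^sup>2 * (norm e)\<^sup>2"
      unfolding linear_add[OF T(1)] linear_scale[OF T(1)] by simp
    then have "(norm (T x))\<^sup>2 + 2 * r * d \<le> (norm x)\<^sup>2"
      by (simp add: d_def e algebra_simps)
    then show ?thesis using zero_le_power2[of "norm (T x)"] by linarith
  qed
  have "d \<noteq> 0" using ne by (simp add: d_def)
  then have "2 * (((norm x)\<^sup>2 + 1) / (2 * d)) * d = (norm x)\<^sup>2 + 1" by simp
  with le[of "((norm x)\<^sup>2 + 1) / (2 * d)"] show False by simp
qed

text \<open>The free flow of the coordinate pair of one mode, with angle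
  \<open>freq n * t\<close>.\<close>

definition rotation :: "real \<Rightarrow> complex \<times> complex \<Rightarrow> complex \<times> complex" where
  "rotation \<theta> = (\<lambda>(z, w). (cos \<theta> *\<^sub>R z + sin \<theta> *\<^sub>R w, cos \<theta> *\<^sub>R w - sin \<theta> *\<^sub>R z))"

lemma rotation_add: "rotation (\<theta> + \<eta>) a = rotation \<theta> (rotation \<eta> a)"
  by (cases a) (simp add: rotation_def cos_add sin_add algebra_simps)

lemma inner_rotation: "inner (rotation \<theta> a) (rotation \<theta> c) = inner a c"
proof -
  obtain z w z' w' where ac: "a = (z, w)" "c = (z', w')" by force
  have "inner (k *\<^sub>R z + l *\<^sub>R w, k *\<^sub>R w - l *\<^sub>R z) (k *\<^sub>R z' + l *\<^sub>R w', k *\<^sub>R w' - l *\<^sub>R z')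
      = (k\<^sup>2 + l\<^sup>2) * inner a c" for k l :: real
    by (simp add: ac inner_add_left inner_add_right inner_diff_left inner_diff_right
        power2_eq_square algebra_simps)
  then show ?thesis by (simp add: ac rotation_def)
qed

lemma rotation_split: "rotation \<theta> (z, w) = cos \<theta> *\<^sub>R (z, w) + sin \<theta> *\<^sub>R (w, - z)"
  by (simp add: rotation_def)

lemma inner_eqI:
  assumes "\<And>c. inner x c = inner y c"
  shows "x = y"
proof -
  have "inner (x - y) (x - y) = 0" using assms[of "x - y"] by (simp add: inner_diff_left)
  then show ?thesis by simp
qed

lemma linear_wave_mode: "linear (wave_mode n)"
proof (rule linearI)
  have inner: "inner (wave_mode n a) x = inner (wave_P n x, wave_Q n x) a" for a x
    unfolding inner_commute[of "wave_mode n a"] by (rule inner_wave_mode)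
  show "wave_mode n (a + c) = wave_mode n a + wave_mode n c" for a c
    by (rule inner_eqI) (simp only: inner inner_add_left inner_add_right)
  show "wave_mode n (r *\<^sub>R a) = r *\<^sub>R wave_mode n a" for r a
    by (rule inner_eqI) (simp only: inner inner_scaleR_left inner_scaleR_right)
qed

lemma norm_wave_mode: "norm (wave_mode n a) = norm a"
  by (cases a) (simp add: norm_eq_sqrt_inner inner_wave_mode wave_P_mode wave_Q_mode)

lemma semigroup_wave_mode:
  assumes T: "contraction_semigroup T" and G: "is_generator wave_domain wave_operator T" and t: "t \<ge> 0"
  shows "T t (wave_mode n a) = wave_mode n (rotation (freq n * t) a)"
proof -
  define \<Delta> where "\<Delta> h a = T h (wave_mode n a) - wave_mode n (rotation (freq n * h) a)" for h a
  have \<Delta>_lim: "((\<lambda>h. norm (\<Delta> h a) / h) \<longlongrightarrow> 0) (at_right 0)" for a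
  proof -
    obtain z w where a: "a = (z, w)" by force
    define A where "A = wave_operator (wave_mode n a)"
    have A: "A = freq n *\<^sub>R wave_mode n (w, - z)"
      unfolding A_def a wave_operator_mode
      by (simp add: linear_scale[OF linear_wave_mode, symmetric])
    have 1: "((\<lambda>h. (T h (wave_mode n a) - wave_mode n a) /\<^sub>R h) \<longlongrightarrow> A) (at_right 0)"
      using G[unfolded is_generator_def, THEN spec, THEN spec, of "wave_mode n a" A] wave_mode_domain
      by (simp add: A_def)
    have "((\<lambda>h. cos (freq n * h) *\<^sub>R wave_mode n a + sin (freq n * h) *\<^sub>R wave_mode n (w, - z))
        has_vector_derivative A) (at 0 within {0..})"
      unfolding A by (auto intro!: derivative_eq_intros simp flip: has_real_derivative_iff_has_vector_derivative)
    from right_difference_quotient[OF this] have "((\<lambda>h. (wave_mode n (rotation (freq n * h) a) - wave_mode n a) /\<^sub>R h) \<longlongrightarrow> A) (at_right 0)"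
      unfolding a rotation_split linear_add[OF linear_wave_mode] linear_scale[OF linear_wave_mode]
      by simp
    from tendsto_diff[OF 1 this] have "((\<lambda>h. \<Delta> h a /\<^sub>R h) \<longlongrightarrow> 0) (at_right 0)"
      by (simp add: \<Delta>_def flip: scaleR_diff_right)
    then have "((\<lambda>h. norm (\<Delta> h a /\<^sub>R h)) \<longlongrightarrow> 0) (at_right 0)" by (rule tendsto_norm_zero)
    then show ?thesis
      by (rule Lim_transform_eventually)
         (auto intro!: eventually_at_right_less[THEN eventually_mono] simp: divide_inverse mult.commute)
  qed
  obtain z w where a: "a = (z, w)" by force
  \<comment> \<open>At time \<open>s\<close> the rotated pair is a combination of \<open>a\<close>
    and \<open>(w, - z)\<close> with coefficients at most 1 in modulus. The two errors at time 0
    therefore bound the error uniformly in \<open>s\<close>.\<close>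
  define \<delta> where "\<delta> h = norm (\<Delta> h a) + norm (\<Delta> h (w, - z))" for h
  have "T t (wave_mode n (rotation (freq n * 0) a)) = wave_mode n (rotation (freq n * t) a)"
  proof (rule contraction_semigroup_eqI[OF T _ _ t])
    show "((\<lambda>h. \<delta> h / h) \<longlongrightarrow> 0) (at_right 0)"
      unfolding \<delta>_def add_divide_distrib using tendsto_add[OF \<Delta>_lim \<Delta>_lim] by simp
    fix s h :: real assume h: "h > 0"
    have R: "rotation (freq n * (s + h)) a = cos (freq n * s) *\<^sub>R rotation (freq n * h) a
        + sin (freq n * s) *\<^sub>R rotation (freq n * h) (w, - z)"
      by (simp add: a rotation_def cos_add sin_add algebra_simps)
    have split: "wave_mode n (cos (freq n * s) *\<^sub>R c + sin (freq n * s) *\<^sub>R d) =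
        cos (freq n * s) *\<^sub>R wave_mode n c + sin (freq n * s) *\<^sub>R wave_mode n d" for c d
      by (simp only: linear_add[OF linear_wave_mode] linear_scale[OF linear_wave_mode])
    have "T h (wave_mode n (rotation (freq n * s) a)) =
        cos (freq n * s) *\<^sub>R T h (wave_mode n a) + sin (freq n * s) *\<^sub>R T h (wave_mode n (w, - z))"
      using h unfolding a rotation_split[of "freq n * s"] split
      by (simp add: linear_add[OF contraction_semigroupD(1)[OF T]] linear_scale[OF contraction_semigroupD(1)[OF T]])
    then have "T h (wave_mode n (rotation (freq n * s) a)) - wave_mode n (rotation (freq n * (s + h)) a) =
        cos (freq n * s) *\<^sub>R \<Delta> h a + sin (freq n * s) *\<^sub>R \<Delta> h (w, - z)"
      unfolding R split by (simp add: \<Delta>_def scaleR_diff_right)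
    also have "norm \<dots> \<le> 1 * norm (\<Delta> h a) + 1 * norm (\<Delta> h (w, - z))"
      by (intro order_trans[OF norm_triangle_ineq] add_mono) (simp_all add: mult_left_le_one_le)
    finally show "norm (T h (wave_mode n (rotation (freq n * s) a)) - wave_mode n (rotation (freq n * (s + h)) a)) \<le> \<delta> h"
      by (simp add: \<delta>_def)
  qed
  then show ?thesis by (simp add: a rotation_def)
qed

text \<open>So far \<open>T\<close> is known on the modes alone. It maps them isometrically, so
  \<open>contraction_inner\<close> lets it be removed from both sides of an inner product; testing
  against a rotated mode then yields every coordinate of \<open>T t x\<close>.\<close>

lemma semigroup_coordinates:
  assumes T: "contraction_semigroup T" and G: "is_generator wave_domain wave_operator T" and t: "t \<ge> 0"
  shows "(wave_P n (T t x), wave_Q n (T t x)) = rotation (freq n * t) (wave_P n x, wave_Q n x)"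
proof -
  let ?R = "rotation (freq n * t)"
  have "inner (wave_P n (T t x), wave_Q n (T t x)) c = inner (?R (wave_P n x, wave_Q n x)) c" for c
  proof -
    define a where "a = rotation (- (freq n * t)) c"
    have c: "c = ?R a" unfolding a_def rotation_add[symmetric] by (cases c) (simp add: rotation_def)
    have Ta: "T t (wave_mode n a) = wave_mode n c" by (simp add: semigroup_wave_mode[OF T G t] c)
    have na: "norm c = norm a" by (simp add: c norm_eq_sqrt_inner inner_rotation)
    have "inner (wave_P n (T t x), wave_Q n (T t x)) c = inner (T t x) (T t (wave_mode n a))"
      by (simp add: inner_wave_mode Ta)
    also have "\<dots> = inner x (wave_mode n a)"
      using contraction_semigroupD(1,2)[OF T t] by (rule contraction_inner) (simp add: Ta norm_wave_mode na)
    also have "\<dots> = inner (?R (wave_P n x, wave_Q n x)) c" by (simp add: inner_wave_mode c inner_rotation)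
    finally show ?thesis .
  qed
  then show ?thesis by (rule inner_eqI)
qed

section \<open>Mild solutions in modal coordinates\<close>

lemma integral_has_vector_derivative_Ici:
  fixes g :: "real \<Rightarrow> 'a::banach"
  assumes "continuous_on {0..} g" "t \<ge> 0"
  shows "((\<lambda>t. integral {0..t} g) has_vector_derivative g t) (at t within {0..})"
proof -
  have "((\<lambda>t. integral {0..t} g) has_vector_derivative g t) (at t within {0..t + 1})"
    using assms by (intro integral_has_vector_derivative continuous_on_subset[OF assms(1)]) auto
  moreover have "at t within {0..t + 1} = at t within {0..}"
    using assms(2) by (intro at_within_nhd[of _ "{..<t + 1}"]) auto
  ultimately show ?thesis by simp
qed

text \<open>In each coordinate the semigroup is a rotation, so the addition formulas separate
  \<open>t\<close> from \<open>s\<close> and the convolution becomes a combination of the integrals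
  \<open>I\<close> and \<open>J\<close>. These are differentiable in \<open>t\<close> although
  \<open>x\<close> need not be.\<close>

lemma mild_imp_solution:
  assumes b: "square_integrable b" and \<phi>: "continuous_on UNIV \<phi>"
    and T: "contraction_semigroup T" and G: "is_generator wave_domain wave_operator T"
    and x: "mild_solution T (\<lambda>y. control b (\<phi> (observation b y))) x"
  shows "modal_system.solution wave_P wave_Q (wave_coef b) x (\<lambda>t. \<phi> (observation b (x t)))"
proof -
  interpret modal_system wave_P wave_Q "wave_coef b" "observation b"
    using b by (rule wave_modal_system)
  define f where "f t = \<phi> (observation b (x t))" for t
  have cx: "continuous_on {0..} x" using x by (simp add: mild_solution_def)
  have cf: "continuous_on {0..} f"
    unfolding f_def by (rule continuous_on_compose2[OF \<phi> continuous_on_obs[OF cx]]) simp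
  have duhamel: "x t = T t (x 0) - integral {0..t} (\<lambda>s. T (t - s) (control b (f s)))" if "t \<ge> 0" for t
    using x that unfolding mild_solution_def f_def by blast
  \<comment> \<open>Splitting the forcing into two fixed directions with real weights uses only real
    linearity of \<open>T t\<close>, and it reduces continuity of the integrand to continuity of
    single orbits.\<close>
  have control: "control b z = Re z *\<^sub>R control b 1 + Im z *\<^sub>R control b \<i>" for z
  proof -
    have "z = Re z *\<^sub>R 1 + Im z *\<^sub>R \<i>" by (simp add: complex_eq_iff)
    then have "l2_real b z = Re z *\<^sub>R l2_real b 1 + Im z *\<^sub>R l2_real b \<i>"
      by (metis l2_real_scaleR[OF b] l2_real_add[OF b])
    then show ?thesis by (simp add: control_eq)
  qed
  have int: "(\<lambda>s. T (t - s) (control b (f s))) integrable_on {0..t}" if "t \<ge> 0" for t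
  proof -
    have c: "continuous_on {0..t} (\<lambda>s. T (t - s) y)" for y
      by (rule continuous_on_compose2[OF contraction_semigroupD(5)[OF T]]) (auto intro!: continuous_intros)
    have cf': "continuous_on {0..t} f" using cf by (rule continuous_on_subset) auto
    have "continuous_on {0..t} (\<lambda>s. Re (f s) *\<^sub>R T (t - s) (control b 1) + Im (f s) *\<^sub>R T (t - s) (control b \<i>))"
      by (intro continuous_intros c cf')
    moreover have "T (t - s) (control b (f s)) =
        Re (f s) *\<^sub>R T (t - s) (control b 1) + Im (f s) *\<^sub>R T (t - s) (control b \<i>)" if "s \<in> {0..t}" for s
      using that contraction_semigroupD(1)[OF T, of "t - s"]
      by (subst control) (simp add: linear_add linear_scale)
    ultimately have "continuous_on {0..t} (\<lambda>s. T (t - s) (control b (f s)))"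
      using continuous_on_eq by (metis (no_types, lifting))
    then show ?thesis by (rule integrable_continuous_interval)
  qed
  define p q and I J :: "nat \<Rightarrow> real \<Rightarrow> complex" where "p n = wave_P n (x 0)" and "q n = wave_Q n (x 0)"
    and "I n t = integral {0..t} (\<lambda>s. cos (freq n * s) *\<^sub>R f s)"
    and "J n t = integral {0..t} (\<lambda>s. sin (freq n * s) *\<^sub>R f s)" for n t
  have cc: "continuous_on {0..} (\<lambda>s. cos (freq n * s) *\<^sub>R f s)" "continuous_on {0..} (\<lambda>s. sin (freq n * s) *\<^sub>R f s)" for n
    by (intro continuous_intros cf)+
  have IJ: "(I n has_vector_derivative cos (freq n * t) *\<^sub>R f t) (at t within {0..})"
    "(J n has_vector_derivative sin (freq n * t) *\<^sub>R f t) (at t within {0..})" if "t \<ge> 0" for n t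
    unfolding I_def J_def using that by (auto intro!: integral_has_vector_derivative_Ici cc)
  have IJ': "((\<lambda>s. cos (freq n * s) *\<^sub>R f s) has_integral I n t) {0..t}"
    "((\<lambda>s. sin (freq n * s) *\<^sub>R f s) has_integral J n t) {0..t}" for n t
    unfolding I_def J_def
    by (intro integrable_integral integrable_continuous_interval continuous_on_subset[OF cc(1)]
        continuous_on_subset[OF cc(2)]; auto)+
  have coord: "wave_P n (T (t - s) (control b (f s))) =
      wave_coef b n *\<^sub>R (sin (freq n * t) *\<^sub>R cos (freq n * s) *\<^sub>R f s - cos (freq n * t) *\<^sub>R sin (freq n * s) *\<^sub>R f s)"
    "wave_Q n (T (t - s) (control b (f s))) =
      wave_coef b n *\<^sub>R (cos (freq n * t) *\<^sub>R cos (freq n * s) *\<^sub>R f s + sin (freq n * t) *\<^sub>R sin (freq n * s) *\<^sub>R f s)"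
    if "s \<in> {0..t}" for n s t
    using semigroup_coordinates[OF T G, of "t - s" n "control b (f s)"] that
    by (simp_all add: rotation_def wave_P_control wave_Q_control[OF b] right_diff_distrib sin_diff cos_diff
        scaleR_add_left scaleR_diff_left scaleR_add_right scaleR_diff_right mult_ac)
  have P: "wave_P n (x t) = cos (freq n * t) *\<^sub>R p n + sin (freq n * t) *\<^sub>R q n
      - wave_coef b n *\<^sub>R (sin (freq n * t) *\<^sub>R I n t - cos (freq n * t) *\<^sub>R J n t)" if t: "t \<ge> 0" for n t
  proof -
    have "((\<lambda>s. wave_P n (T (t - s) (control b (f s)))) has_integral
        wave_coef b n *\<^sub>R (sin (freq n * t) *\<^sub>R I n t - cos (freq n * t) *\<^sub>R J n t)) {0..t}"
      by (rule has_integral_eq[OF _ has_integral_cmul[OF has_integral_diff[OF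
            has_integral_cmul[OF IJ'(1)] has_integral_cmul[OF IJ'(2)]]]]) (simp add: coord)
    moreover have "((\<lambda>s. wave_P n (T (t - s) (control b (f s)))) has_integral
        wave_P n (integral {0..t} (\<lambda>s. T (t - s) (control b (f s))))) {0..t}"
      using has_integral_linear[OF integrable_integral[OF int[OF t]] bounded_linear_P] by (simp add: o_def)
    ultimately have "wave_P n (integral {0..t} (\<lambda>s. T (t - s) (control b (f s)))) =
        wave_coef b n *\<^sub>R (sin (freq n * t) *\<^sub>R I n t - cos (freq n * t) *\<^sub>R J n t)"
      using has_integral_unique by blast
    then show ?thesis
      using semigroup_coordinates[OF T G t, of n "x 0"]
      by (subst duhamel[OF t]) (simp add: P_diff rotation_def p_def q_def)
  qed
  have Q: "wave_Q n (x t) = cos (freq n * t) *\<^sub>R q n - sin (freq n * t) *\<^sub>R p n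
      - wave_coef b n *\<^sub>R (cos (freq n * t) *\<^sub>R I n t + sin (freq n * t) *\<^sub>R J n t)" if t: "t \<ge> 0" for n t
  proof -
    have "((\<lambda>s. wave_Q n (T (t - s) (control b (f s)))) has_integral
        wave_coef b n *\<^sub>R (cos (freq n * t) *\<^sub>R I n t + sin (freq n * t) *\<^sub>R J n t)) {0..t}"
      by (rule has_integral_eq[OF _ has_integral_cmul[OF has_integral_add[OF
            has_integral_cmul[OF IJ'(1)] has_integral_cmul[OF IJ'(2)]]]]) (simp add: coord)
    moreover have "((\<lambda>s. wave_Q n (T (t - s) (control b (f s)))) has_integral
        wave_Q n (integral {0..t} (\<lambda>s. T (t - s) (control b (f s))))) {0..t}"
      using has_integral_linear[OF integrable_integral[OF int[OF t]] bounded_linear_Q] by (simp add: o_def)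
    ultimately have "wave_Q n (integral {0..t} (\<lambda>s. T (t - s) (control b (f s)))) =
        wave_coef b n *\<^sub>R (cos (freq n * t) *\<^sub>R I n t + sin (freq n * t) *\<^sub>R J n t)"
      using has_integral_unique by blast
    then show ?thesis
      using semigroup_coordinates[OF T G t, of n "x 0"]
      by (subst duhamel[OF t]) (simp add: Q_diff rotation_def p_def q_def)
  qed
  have "solution x f"
  proof (rule solutionI[OF cx cf])
    fix n and t :: real assume t: "t \<ge> 0"
    have c: "((\<lambda>t. cos (freq n * t)) has_real_derivative - (freq n * sin (freq n * t))) (at t within {0..})"
      "((\<lambda>t. sin (freq n * t)) has_real_derivative freq n * cos (freq n * t)) (at t within {0..})"
      by (auto intro!: derivative_eq_intros)
    note const = has_vector_derivative_const
    \<comment> \<open>In the derivative of the displacement coordinate the two products with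
      \<open>f t\<close> cancel; in that of the velocity coordinate they combine to
      \<open>f t\<close> by this identity.\<close>
    have trig: "cos (freq n * t) *\<^sub>R cos (freq n * t) *\<^sub>R f t + sin (freq n * t) *\<^sub>R sin (freq n * t) *\<^sub>R f t = f t"
      using sin_cos_squared_add2[of "freq n * t"] by (simp flip: scaleR_add_left power2_eq_square)
    have "((\<lambda>t. cos (freq n * t) *\<^sub>R p n + sin (freq n * t) *\<^sub>R q n
      - wave_coef b n *\<^sub>R (sin (freq n * t) *\<^sub>R I n t - cos (freq n * t) *\<^sub>R J n t))
      has_vector_derivative freq n *\<^sub>R wave_Q n (x t)) (at t within {0..})"
      unfolding Q[OF t]
      by (rule has_vector_derivative_eq_rhs, rule has_vector_derivative_diff[OF has_vector_derivative_add[OF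
            has_vector_derivative_scaleR[OF c(1) const] has_vector_derivative_scaleR[OF c(2) const]]
            has_vector_derivative_scaleR[OF DERIV_const has_vector_derivative_diff[OF
              has_vector_derivative_scaleR[OF c(2) IJ(1)[OF t]] has_vector_derivative_scaleR[OF c(1) IJ(2)[OF t]]]]])
         (simp add: algebra_simps)
    then show "((\<lambda>t. wave_P n (x t)) has_vector_derivative freq n *\<^sub>R wave_Q n (x t)) (at t within {0..})"
      by (rule has_vector_derivative_transform[rotated 2]) (use t in \<open>auto simp: P\<close>)
    have "((\<lambda>t. cos (freq n * t) *\<^sub>R q n - sin (freq n * t) *\<^sub>R p n
      - wave_coef b n *\<^sub>R (cos (freq n * t) *\<^sub>R I n t + sin (freq n * t) *\<^sub>R J n t))
      has_vector_derivative - (freq n *\<^sub>R wave_P n (x t)) - wave_coef b n *\<^sub>R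
        (cos (freq n * t) *\<^sub>R cos (freq n * t) *\<^sub>R f t + sin (freq n * t) *\<^sub>R sin (freq n * t) *\<^sub>R f t)) (at t within {0..})"
      unfolding P[OF t]
      by (rule has_vector_derivative_eq_rhs, rule has_vector_derivative_diff[OF has_vector_derivative_diff[OF
            has_vector_derivative_scaleR[OF c(1) const] has_vector_derivative_scaleR[OF c(2) const]]
            has_vector_derivative_scaleR[OF DERIV_const has_vector_derivative_add[OF
              has_vector_derivative_scaleR[OF c(1) IJ(1)[OF t]] has_vector_derivative_scaleR[OF c(2) IJ(2)[OF t]]]]])
         (simp add: algebra_simps)
    then show "((\<lambda>t. wave_Q n (x t)) has_vector_derivative
        - (freq n *\<^sub>R wave_P n (x t)) - wave_coef b n *\<^sub>R f t) (at t within {0..})"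
      unfolding trig by (rule has_vector_derivative_transform[rotated 2]) (use t in \<open>auto simp: Q\<close>)
  qed
  then show ?thesis by (simp add: f_def[abs_def])
qed

theorem proposition3p1:
  fixes b :: "real \<Rightarrow> real" and \<phi> :: "complex \<Rightarrow> complex" and \<beta> c\<^sub>0 \<delta> c :: real
  assumes "square_integrable b"
    and "\<beta> > 0" and "c\<^sub>0 > 0"
    and "\<And>n::nat. n \<ge> 1 \<Longrightarrow>
      \<bar>LINT x|unit_interval. b x * sin (real n * pi * x)\<bar> \<ge> c\<^sub>0 * real n powr (- \<beta>)"
    and "\<And>u\<^sub>1 u\<^sub>2. Re ((\<phi> u\<^sub>1 - \<phi> u\<^sub>2) * cnj (u\<^sub>1 - u\<^sub>2)) \<ge> 0"
    and "\<And>u. \<exists>r>0. \<exists>L. L-lipschitz_on (ball u r) \<phi>"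
    and "\<delta> > 0" and "c > 0"
    and "\<And>u. norm u \<le> \<delta> \<Longrightarrow> Re (\<phi> u * cnj u) \<ge> c * (norm u)\<^sup>2"
    and "\<And>u. norm u > \<delta> \<Longrightarrow> Re (\<phi> u * cnj u) \<ge> c"
  shows "(\<forall>T x. contraction_semigroup T \<longrightarrow> is_generator wave_domain wave_operator T \<longrightarrow>
            mild_solution T (\<lambda>y. control b (\<phi> (observation b y))) x \<longrightarrow>
            ((\<lambda>t. norm (x t)) \<longlongrightarrow> 0) at_top) \<and>
         (\<forall>x. classical_solution wave_domain wave_operator
                (\<lambda>y. control b (\<phi> (observation b y))) x \<longrightarrow>
            (\<lambda>t. norm (x t)) \<in> O[at_top](\<lambda>t. t powr (- 1 / (2 * \<beta>))))"
proof -
  have inner: "inner z w = Re (z * cnj w)" for z w by (simp add: inner_complex_def)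
  have coef: "\<bar>wave_coef b n\<bar> \<ge> c\<^sub>0 * real (Suc n) powr (- \<beta>)" for n
  proof -
    have "wave_coef b n = (LINT x|unit_interval. sqrt 2 * (b x * sin (real (Suc n) * pi * x)))"
      by (simp add: wave_coef_def sine_def freq_def mult_ac)
    also have "\<dots> = sqrt 2 * (LINT x|unit_interval. b x * sin (real (Suc n) * pi * x))"
      by (rule integral_mult_right_zero)
    finally have "\<bar>wave_coef b n\<bar> = sqrt 2 * \<bar>LINT x|unit_interval. b x * sin (real (Suc n) * pi * x)\<bar>"
      by (simp add: abs_mult)
    \<comment> \<open>The normalisation of the sines contributes a factor \<open>sqrt 2\<close>,
      here bounded below by 1 so that \<open>c\<^sub>0\<close> can be kept.\<close>
    also have "\<dots> \<ge> 1 * \<bar>LINT x|unit_interval. b x * sin (real (Suc n) * pi * x)\<bar>"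
      by (intro mult_right_mono) auto
    finally show ?thesis using assms(4)[of "Suc n"] by linarith
  qed
  interpret damped_system wave_P wave_Q "wave_coef b" "observation b" \<phi> \<beta> c\<^sub>0 \<delta> c
    using assms coef
    by (intro damped_system.intro damped_system_axioms.intro wave_modal_system) (simp_all add: inner)
  show ?thesis
  proof (intro conjI allI impI)
    fix T x
    assume "contraction_semigroup T" "is_generator wave_domain wave_operator T"
      "mild_solution T (\<lambda>y. control b (\<phi> (observation b y))) x"
    then have "trajectory x"
      unfolding trajectory_def by (rule mild_imp_solution[OF assms(1) continuous_on_\<phi>])
    then show "((\<lambda>t. norm (x t)) \<longlongrightarrow> 0) at_top" by (rule trajectory_stable)
  next
    fix x assume x: "classical_solution wave_domain wave_operator (\<lambda>y. control b (\<phi> (observation b y))) x"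
    then have tr: "trajectory x"
      unfolding trajectory_def by (rule classical_imp_solution[OF assms(1) continuous_on_\<phi>])
    \<comment> \<open>The derivative at time 0 yields a linear bound on the increments over short
      spans starting there, as \<open>trajectory_decay\<close> requires.\<close>
    obtain x' where x': "(x has_vector_derivative x') (at 0 within {0..})"
      using x unfolding classical_solution_def by blast
    have "((\<lambda>h. (x h - x 0) /\<^sub>R h) \<longlongrightarrow> x') (at_right 0)"
      using x' by (rule right_difference_quotient)
    then have "((\<lambda>h. norm ((x h - x 0) /\<^sub>R h)) \<longlongrightarrow> norm x') (at_right 0)" by (rule tendsto_norm)
    then have "\<forall>\<^sub>F h in at_right 0. norm ((x h - x 0) /\<^sub>R h) < norm x' + 1"
      by (rule order_tendstoD) simp
    then obtain h0 where h0: "h0 > 0" "\<And>h. 0 < h \<Longrightarrow> h < h0 \<Longrightarrow> norm ((x h - x 0) /\<^sub>R h) < norm x' + 1"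
      by (auto simp: eventually_at_right_field)
    show "(\<lambda>t. norm (x t)) \<in> O[at_top](\<lambda>t. t powr (- 1 / (2 * \<beta>)))"
    proof (rule trajectory_decay[OF tr])
      show "h0 / 2 > 0" using h0 by simp
      show "norm (x h - x 0) \<le> (norm x' + 1) * h" if "0 \<le> h" "h \<le> h0 / 2" for h
      proof (cases "h = 0")
        case False
        then have h: "h > 0" "h < h0" using h0 that by auto
        have "\<bar>inverse h\<bar> * norm (x h - x 0) < norm x' + 1"
          using h0(2)[OF h] unfolding norm_scaleR .
        then show ?thesis using h(1) by (simp add: field_simps)
      qed simp
    qed
  qed
qed

end
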